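(* Let $\boldsymbol{\lambda}^0\in\mathcal{N}_\delta^\bot$, let $r>0$, let $\alpha\ge 0$, and let $\boldsymbol{z}^0\in\mathbb{L}^2([0,T];\mathbb{R}^m)$. If $f$ is convex, proper and lower semi-continuous (in its first argument), then the sequence $(\boldsymbol{x}^k,\boldsymbol{\lambda}^k,\boldsymbol{z}^k)$ defined for $k\ge 0$ by $$\boldsymbol{x}^{k+1}\in\operatorname*{arg\,min}_{\boldsymbol{x}\in\mathbb{L}^2([0,T];\mathbb{R}^m)}\ \mathbb{E}\big(f(\boldsymbol{x},\boldsymbol{\xi})\big)+\langle\boldsymbol{\lambda}^k,\boldsymbol{x}\rangle_{\mathbb{L}^2}+\frac r2\big\|\boldsymbol{x}-\mathrm{Proj}_{\mathcal{N}_\delta}(\boldsymbol{z}^k)\big\|_{\mathbb{L}^2}^2,$$ $$\boldsymbol{\lambda}^{k+1}:=\boldsymbol{\lambda}^k+r\,\mathrm{Proj}_{\mathcal{N}_\delta^\bot}(\boldsymbol{x}^{k+1}),$$ $$\boldsymbol{z}^{k+1}=\boldsymbol{z}^k-\boldsymbol{x}^{k+1}+\frac{1}{r+\alpha}\Big[\alpha\,\mathbb{E}(2\boldsymbol{x}^{k+1}-\boldsymbol{z}^k)+r\,\mathrm{Proj}_{\mathcal{N}_\delta}(2\boldsymbol{x}^{k+1}-\boldsymbol{z}^k)\Big]$$ converges weakly to a fixed point $(\bar{\boldsymbol{x}},\bar{\boldsymbol{\lambda}},\bar{\boldsymbol{z}})$ of this iteration such that $\bar{\boldsymbol{x}}$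 is an optimal solution of $$\inf_{\boldsymbol{x}\in\mathbb{L}^2([0,T];\mathbb{R}^m)}\ \mathbb{E}\big(f(\boldsymbol{x},\boldsymbol{\xi})\big)+\frac{\alpha}{2}\big\|\boldsymbol{x}-\mathbb{E}(\boldsymbol{x})\big\|_{\mathbb{L}^2}^2+\mathrm{i}_{\mathcal{N}_\delta}(\boldsymbol{x}).$$
   Context: Let $T>0$ and $\delta\ge 0$. All random variables are defined on a finite probability space $(\Omega,\mathcal{B},\mu)$ with $|\Omega|=S$, $\mathcal{B}=2^\Omega$; the realizations (scenarios) of a random variable $\boldsymbol{x}$ are denoted $x^s$, $s=1,\dots,S$, with probabilities $\mu_s$, and $\mathbb{E}$ is the expectation. $\mathbb{L}^2([0,T];\mathbb{R}^m)$ is the Hilbert space of random variables from $\Omega$ to $L^2([0,T];\mathbb{R}^m)$ with inner product $\langle\boldsymbol{x},\boldsymbol{y}\rangle_{\mathbb{L}^2}:=\mathbb{E}(\langle\boldsymbol{x},\boldsymbol{y}\rangle_{L^2})$ and norm $\|\boldsymbol{x}\|_{\mathbb{L}^2}=\mathbb{E}(\|\boldsymbol{x}\|_{L^2}^2)^{1/2}$. The expectation $\mathbb{E}(\boldsymbol{x})\in L^2([0,T];\mathbb{R}^m)$ is identified with a deterministic (constant over $\Omega$) element of $\mathbb{L}^2([0,T];\mathbb{R}^m)$. Let $\boldsymbol{\xi}\in\mathbb{L}^2([0,T];\mathbb{R}^d)$ be a given random variable and let $(\mathcal{F}_t)_{t\in[0,T]}$ be the filtration generated (for almost all times) by $(\boldsymbol{\xi}(t))_{t\in[0,T]}$.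 A variable $\boldsymbol{x}\in\mathbb{L}^2([0,T];\mathbb{R}^m)$ is called $\delta$-adapted to $\boldsymbol{\xi}$ if $\boldsymbol{x}(t)=\mathbb{E}(\boldsymbol{x}(t)\mid\mathcal{F}_{t-\delta})$ for a.e. $t\in[\delta,T]$. $\mathcal{N}_\delta$ denotes the linear space of all $\boldsymbol{x}\in\mathbb{L}^2([0,T];\mathbb{R}^m)$ that are $\delta$-adapted to $\boldsymbol{\xi}$, $\mathcal{N}_\delta^\bot$ is its orthogonal complement in $\mathbb{L}^2([0,T];\mathbb{R}^m)$, and $\mathrm{Proj}_{\mathcal{N}_\delta}$, $\mathrm{Proj}_{\mathcal{N}_\delta^\bot}$ are the orthogonal projections onto them. $\mathrm{i}_{\mathcal{N}_\delta}$ is the indicator function ($0$ on $\mathcal{N}_\delta$, $+\infty$ elsewhere). The function $f$ maps $L^2([0,T];\mathbb{R}^m)\times L^2([0,T];\mathbb{R}^d)$ to $\overline{\mathbb{R}}$ (the extended real line), and $\mathbb{E}(f(\boldsymbol{x},\boldsymbol{\xi}))=\sum_{s=1}^S\mu_s f(x^s,\xi^s)$. "Convex, proper, lower semi-continuous" refers to $f(\cdot,\xi^s)$ for each scenario $s$.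
   Formalization: Additionally assumes a saddle pair: x in N_δ, λ in N_δ^⊥ with x minimizing E f + (α/2)‖x−E x‖² + ⟨λ,x⟩ over L². Without it the claim fails (S=1, α=δ=0, f(x)=∫x: iterates diverge), and the claimed conclusion itself implies it. *)

theory Defs
  imports "HOL-Probability.Probability"
begin

text \<open>
  Elements of \<open>L\<^sup>2([0,T];\<real>\<^sup>n)\<close> are represented by square-integrable functions on the real line,
  whose values outside \<open>[0,T]\<close> are irrelevant. Equality in \<open>L\<^sup>2\<close> is equality almost everywhere
  on \<open>[0,T]\<close> and is written out where it is meant.
\<close>

definition L2 :: "real \<Rightarrow> (real \<Rightarrow> real^'n) set" where
  "L2 T = {u \<in> borel_measurable (lebesgue_on {0..T}).
             integrable (lebesgue_on {0..T}) (\<lambda>t. (norm (u t))\<^sup>2)}"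

definition L2_inner :: "real \<Rightarrow> (real \<Rightarrow> real^'n) \<Rightarrow> (real \<Rightarrow> real^'n) \<Rightarrow> real" where
  "L2_inner T u v = (LINT t|lebesgue_on {0..T}. u t \<bullet> v t)"

definition L2_norm :: "real \<Rightarrow> (real \<Rightarrow> real^'n) \<Rightarrow> real" where
  "L2_norm T u = sqrt (L2_inner T u u)"

definition finite_prob_space :: "'s measure \<Rightarrow> bool" where
  "finite_prob_space M \<longleftrightarrow> prob_space M \<and> finite (space M) \<and> sets M = Pow (space M)"

text \<open>
  A random variable with values in \<open>L\<^sup>2([0,T];\<real>\<^sup>n)\<close> maps a scenario \<open>s\<close> to a path. Scenarios of
  probability zero are allowed, so equality of random variables is only up to such scenarios.
\<close>

definition rvL2 :: "'s measure \<Rightarrow> real \<Rightarrow> ('s \<Rightarrow> real \<Rightarrow> real^'n) set" where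
  "rvL2 M T = {x. \<forall>s\<in>space M. x s \<in> L2 T}"

definition rv_inner ::
    "'s measure \<Rightarrow> real \<Rightarrow> ('s \<Rightarrow> real \<Rightarrow> real^'n) \<Rightarrow> ('s \<Rightarrow> real \<Rightarrow> real^'n) \<Rightarrow> real" where
  "rv_inner M T x y = (LINT s|M. L2_inner T (x s) (y s))"

definition rv_norm :: "'s measure \<Rightarrow> real \<Rightarrow> ('s \<Rightarrow> real \<Rightarrow> real^'n) \<Rightarrow> real" where
  "rv_norm M T x = sqrt (LINT s|M. (L2_norm T (x s))\<^sup>2)"

definition rv_eq ::
    "'s measure \<Rightarrow> real \<Rightarrow> ('s \<Rightarrow> real \<Rightarrow> real^'n) \<Rightarrow> ('s \<Rightarrow> real \<Rightarrow> real^'n) \<Rightarrow> bool" where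
  "rv_eq M T x y \<longleftrightarrow> (AE s in M. AE t in lebesgue_on {0..T}. x s t = y s t)"

definition rv_mean :: "'s measure \<Rightarrow> ('s \<Rightarrow> real \<Rightarrow> real^'n) \<Rightarrow> 's \<Rightarrow> real \<Rightarrow> real^'n" where
  "rv_mean M x = (\<lambda>s t. LINT w|M. x w t)"

definition weakly_converges ::
    "'s measure \<Rightarrow> real \<Rightarrow> (nat \<Rightarrow> 's \<Rightarrow> real \<Rightarrow> real^'n) \<Rightarrow> ('s \<Rightarrow> real \<Rightarrow> real^'n) \<Rightarrow> bool" where
  "weakly_converges M T x a \<longleftrightarrow>
     a \<in> rvL2 M T \<and> (\<forall>y\<in>rvL2 M T. (\<lambda>k. rv_inner M T (x k) y) \<longlonglongrightarrow> rv_inner M T a y)"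

text \<open>
  The \<open>\<sigma>\<close>-algebra at time \<open>t\<close> is generated by \<open>\<xi>(\<tau>)\<close> for almost all \<open>\<tau> \<in> [0,t]\<close>: an event belongs to
  it iff, whatever null set \<open>N\<close> of times is discarded, it is generated by the remaining \<open>\<xi>(\<tau>)\<close>.
  Hence it does not depend on the representative of \<open>\<xi>\<close>.
\<close>

definition rv_filtration :: "'s measure \<Rightarrow> ('s \<Rightarrow> real \<Rightarrow> real^'d) \<Rightarrow> real \<Rightarrow> 's measure" where
  "rv_filtration M \<xi> t = sigma (space M)
     (\<Inter>N\<in>null_sets lebesgue.
        sigma_sets (space M)
          {(\<lambda>s. \<xi> s \<tau>) -` B \<inter> space M |\<tau> B. \<tau> \<in> {0..t} - N \<and> B \<in> sets borel})"

definition vec_cond_exp :: "'s measure \<Rightarrow> 's measure \<Rightarrow> ('s \<Rightarrow> real^'n) \<Rightarrow> 's \<Rightarrow> real^'n" where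
  "vec_cond_exp M F X = (\<lambda>s. \<chi> i. real_cond_exp M F (\<lambda>w. X w $ i) s)"

definition delta_adapted ::
    "'s measure \<Rightarrow> real \<Rightarrow> ('s \<Rightarrow> real \<Rightarrow> real^'d) \<Rightarrow> real \<Rightarrow> ('s \<Rightarrow> real \<Rightarrow> real^'m) \<Rightarrow> bool" where
  "delta_adapted M T \<xi> \<delta> x \<longleftrightarrow>
     (AE t in lebesgue_on {0..T}. \<delta> \<le> t \<longrightarrow>
        (AE s in M. x s t = vec_cond_exp M (rv_filtration M \<xi> (t - \<delta>)) (\<lambda>w. x w t) s))"

definition Nspace ::
    "'s measure \<Rightarrow> real \<Rightarrow> ('s \<Rightarrow> real \<Rightarrow> real^'d) \<Rightarrow> real \<Rightarrow> ('s \<Rightarrow> real \<Rightarrow> real^'m) set" where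
  "Nspace M T \<xi> \<delta> = {x \<in> rvL2 M T. delta_adapted M T \<xi> \<delta> x}"

definition orth_compl ::
    "'s measure \<Rightarrow> real \<Rightarrow> ('s \<Rightarrow> real \<Rightarrow> real^'m) set \<Rightarrow> ('s \<Rightarrow> real \<Rightarrow> real^'m) set" where
  "orth_compl M T V = {y \<in> rvL2 M T. \<forall>v\<in>V. rv_inner M T y v = 0}"

text \<open>Some representative of the orthogonal projection onto a closed subspace.\<close>

definition Proj ::
    "'s measure \<Rightarrow> real \<Rightarrow> ('s \<Rightarrow> real \<Rightarrow> real^'m) set \<Rightarrow> ('s \<Rightarrow> real \<Rightarrow> real^'m)
       \<Rightarrow> 's \<Rightarrow> real \<Rightarrow> real^'m" where
  "Proj M T V x = (SOME p. p \<in> V \<and> (\<lambda>s t. x s t - p s t) \<in> orth_compl M T V)"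

definition L2_convex :: "real \<Rightarrow> ((real \<Rightarrow> real^'m) \<Rightarrow> ereal) \<Rightarrow> bool" where
  "L2_convex T g \<longleftrightarrow>
     (\<forall>u\<in>L2 T. \<forall>v\<in>L2 T. \<forall>\<theta>. 0 < \<theta> \<and> \<theta> < 1 \<longrightarrow>
        g (\<lambda>t. \<theta> *\<^sub>R u t + (1 - \<theta>) *\<^sub>R v t) \<le> ereal \<theta> * g u + ereal (1 - \<theta>) * g v)"

definition L2_proper :: "real \<Rightarrow> ((real \<Rightarrow> real^'m) \<Rightarrow> ereal) \<Rightarrow> bool" where
  "L2_proper T g \<longleftrightarrow> (\<forall>u\<in>L2 T. g u \<noteq> -\<infinity>) \<and> (\<exists>u\<in>L2 T. g u < \<infinity>)"

text \<open>
  Constant sequences of approximants show that a lower semicontinuous \<open>g\<close> takes the same value on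
  functions that agree almost everywhere on \<open>[0,T]\<close>, so \<open>g\<close> is a function on \<open>L\<^sup>2\<close>.
\<close>

definition L2_lsc :: "real \<Rightarrow> ((real \<Rightarrow> real^'m) \<Rightarrow> ereal) \<Rightarrow> bool" where
  "L2_lsc T g \<longleftrightarrow>
     (\<forall>u\<in>L2 T. \<forall>v. (\<forall>n. v n \<in> L2 T) \<and> (\<lambda>n. L2_norm T (\<lambda>t. v n t - u t)) \<longlonglongrightarrow> 0 \<longrightarrow>
        g u \<le> liminf (\<lambda>n. g (v n)))"

lemma L2_lsc_AE_eq:
  assumes "L2_lsc T g" "u \<in> L2 T" "v \<in> L2 T" "AE t in lebesgue_on {0..T}. u t = v t"
  shows "g u = g v"
proof -
  have le: "g a \<le> g b" if "a \<in> L2 T" "b \<in> L2 T" "AE t in lebesgue_on {0..T}. a t = b t" for a b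
  proof -
    have "L2_norm T (\<lambda>t. b t - a t) = 0"
      unfolding L2_norm_def L2_inner_def real_sqrt_eq_zero_cancel_iff
      by (rule integral_eq_zero_AE) (use that(3) in eventually_elim, simp)
    then have "g a \<le> liminf (\<lambda>n::nat. g b)"
      using assms(1) that(1,2) unfolding L2_lsc_def by (auto dest!: bspec[of _ _ a] spec[of _ "\<lambda>_. b"])
    then show ?thesis by (simp add: Liminf_const)
  qed
  have "AE t in lebesgue_on {0..T}. v t = u t"
    using assms(4) by eventually_elim simp
  then show ?thesis using le assms by (meson antisym)
qed

definition expected_cost ::
    "'s measure \<Rightarrow> ((real \<Rightarrow> real^'m) \<Rightarrow> (real \<Rightarrow> real^'d) \<Rightarrow> ereal)
       \<Rightarrow> ('s \<Rightarrow> real \<Rightarrow> real^'d) \<Rightarrow> ('s \<Rightarrow> real \<Rightarrow> real^'m) \<Rightarrow> ereal" where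
  "expected_cost M f \<xi> x = (\<Sum>s\<in>space M. ereal (measure M {s}) * f (x s) (\<xi> s))"

definition indicator_fun :: "'a set \<Rightarrow> 'a \<Rightarrow> ereal" where
  "indicator_fun A x = (if x \<in> A then 0 else \<infinity>)"

definition optimal_solution ::
    "'s measure \<Rightarrow> real \<Rightarrow> ('s \<Rightarrow> real \<Rightarrow> real^'d) \<Rightarrow> real
       \<Rightarrow> ((real \<Rightarrow> real^'m) \<Rightarrow> (real \<Rightarrow> real^'d) \<Rightarrow> ereal) \<Rightarrow> real
       \<Rightarrow> ('s \<Rightarrow> real \<Rightarrow> real^'m) \<Rightarrow> bool" where
  "optimal_solution M T \<xi> \<delta> f \<alpha> x \<longleftrightarrow>
     is_arg_min
       (\<lambda>y. expected_cost M f \<xi> y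
            + ereal (\<alpha> / 2 * (rv_norm M T (\<lambda>s t. y s t - rv_mean M y s t))\<^sup>2)
            + indicator_fun (Nspace M T \<xi> \<delta>) y)
       (\<lambda>y. y \<in> rvL2 M T) x"

text \<open>
  Primal-dual pair for the same problem: \<open>l\<close> is a multiplier of the constraint that \<open>x\<close> lies in
  \<open>Nspace M T \<xi> \<delta>\<close>. If no such pair exists, the iteration below has no fixed point whose dual
  component is orthogonal to \<open>Nspace M T \<xi> \<delta>\<close>, and it need not converge. This happens for a
  linear \<open>f\<close> whose expectation is unbounded below on \<open>Nspace M T \<xi> \<delta>\<close>, or when the problem is
  infeasible.
\<close>

definition primal_dual_solution ::
    "'s measure \<Rightarrow> real \<Rightarrow> ('s \<Rightarrow> real \<Rightarrow> real^'d) \<Rightarrow> real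
       \<Rightarrow> ((real \<Rightarrow> real^'m) \<Rightarrow> (real \<Rightarrow> real^'d) \<Rightarrow> ereal) \<Rightarrow> real
       \<Rightarrow> ('s \<Rightarrow> real \<Rightarrow> real^'m) \<Rightarrow> ('s \<Rightarrow> real \<Rightarrow> real^'m) \<Rightarrow> bool" where
  "primal_dual_solution M T \<xi> \<delta> f \<alpha> x l \<longleftrightarrow>
     x \<in> Nspace M T \<xi> \<delta> \<and> l \<in> orth_compl M T (Nspace M T \<xi> \<delta>) \<and>
     is_arg_min
       (\<lambda>y. expected_cost M f \<xi> y
            + ereal (\<alpha> / 2 * (rv_norm M T (\<lambda>s t. y s t - rv_mean M y s t))\<^sup>2)
            + ereal (rv_inner M T l y))
       (\<lambda>y. y \<in> rvL2 M T) x"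

text \<open>One step from \<open>(l, z)\<close> to \<open>(x', l', z')\<close>; \<open>l\<close> is the multiplier \<open>\<lambda>\<close>.\<close>

definition iteration_step ::
    "'s measure \<Rightarrow> real \<Rightarrow> ('s \<Rightarrow> real \<Rightarrow> real^'d) \<Rightarrow> real
       \<Rightarrow> ((real \<Rightarrow> real^'m) \<Rightarrow> (real \<Rightarrow> real^'d) \<Rightarrow> ereal) \<Rightarrow> real \<Rightarrow> real
       \<Rightarrow> ('s \<Rightarrow> real \<Rightarrow> real^'m) \<Rightarrow> ('s \<Rightarrow> real \<Rightarrow> real^'m)
       \<Rightarrow> ('s \<Rightarrow> real \<Rightarrow> real^'m) \<Rightarrow> ('s \<Rightarrow> real \<Rightarrow> real^'m) \<Rightarrow> ('s \<Rightarrow> real \<Rightarrow> real^'m)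
       \<Rightarrow> bool" where
  "iteration_step M T \<xi> \<delta> f r \<alpha> l z x' l' z' \<longleftrightarrow>
     (let N = Nspace M T \<xi> \<delta>; w = (\<lambda>s t. 2 *\<^sub>R x' s t - z s t) in
      is_arg_min
        (\<lambda>y. expected_cost M f \<xi> y + ereal (rv_inner M T l y)
             + ereal (r / 2 * (rv_norm M T (\<lambda>s t. y s t - Proj M T N z s t))\<^sup>2))
        (\<lambda>y. y \<in> rvL2 M T) x' \<and>
      l' \<in> rvL2 M T \<and>
      rv_eq M T l' (\<lambda>s t. l s t + r *\<^sub>R Proj M T (orth_compl M T N) x' s t) \<and>
      z' \<in> rvL2 M T \<and>
      rv_eq M T z' (\<lambda>s t. z s t - x' s t
        + (1 / (r + \<alpha>)) *\<^sub>R (\<alpha> *\<^sub>R rv_mean M w s t + r *\<^sub>R Proj M T N w s t)))"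

definition iteration_fixed_point ::
    "'s measure \<Rightarrow> real \<Rightarrow> ('s \<Rightarrow> real \<Rightarrow> real^'d) \<Rightarrow> real
       \<Rightarrow> ((real \<Rightarrow> real^'m) \<Rightarrow> (real \<Rightarrow> real^'d) \<Rightarrow> ereal) \<Rightarrow> real \<Rightarrow> real
       \<Rightarrow> ('s \<Rightarrow> real \<Rightarrow> real^'m) \<Rightarrow> ('s \<Rightarrow> real \<Rightarrow> real^'m) \<Rightarrow> ('s \<Rightarrow> real \<Rightarrow> real^'m)
       \<Rightarrow> bool" where
  "iteration_fixed_point M T \<xi> \<delta> f r \<alpha> x l z \<longleftrightarrow> iteration_step M T \<xi> \<delta> f r \<alpha> l z x l z"

end

theory Submission
  imports Defs "HOL-Library.Function_Algebras"
begin

text \<open>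
  Let \<open>P\<close> be the projection onto the adapted processes. The multipliers stay orthogonal
  to the adapted processes, and \<open>u\<^sup>k = P z\<^sup>k - \<lambda>\<^sup>k / r\<close> satisfies \<open>u\<^bsup>k+1\<^esup> = u\<^sup>k - x\<^bsup>k+1\<^esup> + y\<^sup>k\<close>, where \<open>x\<^bsup>k+1\<^esup>\<close> is the
  proximal point of the expected cost at \<open>u\<^sup>k\<close> and \<open>y\<^sup>k\<close> is the proximal point of the remaining terms of
  the objective at \<open>2 x\<^bsup>k+1\<^esup> - u\<^sup>k\<close>. This is the Douglas--Rachford iteration. It is Fejer monotone, so
  \<open>x\<^bsup>k+1\<^esup> - y\<^sup>k\<close> tends to \<open>0\<close>; this makes \<open>\<langle>x\<^bsup>k+1\<^esup>, a\<^sup>k\<rangle> + \<langle>y\<^sup>k, b\<^sup>k\<rangle>\<close> vanish asymptotically for the two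
  subgradients \<open>a\<^sup>k\<close>, \<open>b\<^sup>k\<close>, so that every weak cluster point of \<open>(u, x)\<close> is a fixed point, and Opial's
  argument gives weak convergence of both \<open>u\<close> and \<open>x\<close>. Finally \<open>\<lambda>\<^sup>k = - r (u\<^sup>k - P u\<^sup>k)\<close>, and
  \<open>z\<^sup>k - u\<^sup>k\<close> does not depend on \<open>k\<close>.
\<close>

section \<open>Complete semi-inner product spaces\<close>

text \<open>Elements of the Hilbert space are functions, identified only up to null sets of times
  and scenarios of mass zero, and \<open>Proj\<close> picks an arbitrary representative. The
  argument therefore uses a semi-inner product defined on a whole type. Equations between vectors
  are tested as \<open>ip a w = ip b w\<close> for all \<open>w\<close>, and uniqueness means up to
  a null vector. One existence result, \<open>prox_exists\<close>, yields the Riesz representation,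
  orthogonal projections and Minty's maximality of the subdifferential. The vector u comes from
  completing the square: the multiplier term and the penalty together are, up to a constant, r/2
  times the squared distance to u. The average in the update of z is the proximal map of the
  deviation term restricted to the adapted processes. It sees z only through \<open>P\<close> and
  \<open>E\<close>, and both annihilate z - u up to null vectors.\<close>

text \<open>This is convexity of the epigraph. Real upper bounds keep sums of opposite infinities
  out of the arithmetic.\<close>

definition econvex :: "('v::real_vector \<Rightarrow> ereal) \<Rightarrow> bool" where
  "econvex F \<longleftrightarrow> (\<forall>x y a b t. F x \<le> ereal a \<longrightarrow> F y \<le> ereal b \<longrightarrow> 0 < t \<longrightarrow> t < 1 \<longrightarrow>
     F ((1 - t) *\<^sub>R x + t *\<^sub>R y) \<le> ereal ((1 - t) * a + t * b))"

lemma econvexD: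
  "econvex F \<Longrightarrow> F x \<le> ereal a \<Longrightarrow> F y \<le> ereal b \<Longrightarrow> 0 < t \<Longrightarrow> t < 1 \<Longrightarrow>
     F ((1 - t) *\<^sub>R x + t *\<^sub>R y) \<le> ereal ((1 - t) * a + t * b)"
  unfolding econvex_def by blast

text \<open>Non-zero vectors of seminorm zero are allowed, so limits of Cauchy sequences exist but
  need not be unique. This lets functions stand for their classes modulo null sets without a
  quotient.\<close>

locale semi_hilbert =
  fixes ip :: "'v::real_vector \<Rightarrow> 'v \<Rightarrow> real"
  assumes ip_commute: "ip x y = ip y x"
    and ip_add_left: "ip (x + y) w = ip x w + ip y w"
    and ip_scaleR_left: "ip (c *\<^sub>R x) y = c * ip x y"
    and ip_nonneg: "0 \<le> ip x x"
    and complete: "(\<And>e. e > 0 \<Longrightarrow> \<exists>K. \<forall>m\<ge>K. \<forall>n\<ge>K. ip (X m - X n) (X m - X n) < e) \<Longrightarrow>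
      \<exists>l. (\<lambda>n. ip (X n - l) (X n - l)) \<longlonglongrightarrow> 0"
begin

section \<open>Algebra of the semi-inner product\<close>

lemma ip_add_right: "ip w (x + y) = ip w x + ip w y"
  by (simp add: ip_commute[of w] ip_add_left)

lemma ip_scaleR_right: "ip x (c *\<^sub>R y) = c * ip x y"
  by (simp add: ip_commute[of x] ip_scaleR_left)

lemma ip_zero_left [simp]: "ip 0 x = 0"
  using ip_scaleR_left[of 0 x x] by simp

lemma ip_zero_right [simp]: "ip x 0 = 0"
  by (simp add: ip_commute[of x])

lemma ip_minus_left: "ip (- x) y = - ip x y"
  using ip_scaleR_left[of "-1" x y] by simp

lemma ip_minus_right: "ip x (- y) = - ip x y"
  using ip_scaleR_right[of x "-1" y] by simp

lemma ip_diff_left: "ip (x - y) w = ip x w - ip y w"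
  using ip_add_left[of x "- y" w] by (simp add: ip_minus_left)

lemma ip_diff_right: "ip w (x - y) = ip w x - ip w y"
  by (simp add: ip_commute[of w] ip_diff_left)

lemmas ip_simps = ip_add_left ip_add_right ip_diff_left ip_diff_right ip_minus_left ip_minus_right
  ip_scaleR_left ip_scaleR_right

lemma cauchy_schwarz: "(ip x y)\<^sup>2 \<le> ip x x * ip y y"
proof (cases "ip y y = 0")
  case False
  then have pos: "ip y y > 0" using ip_nonneg[of y] by simp
  define t where "t = ip x y / ip y y"
  have "0 \<le> ip (x - t *\<^sub>R y) (x - t *\<^sub>R y)" by (rule ip_nonneg)
  also have "\<dots> = ip x x - 2 * t * ip x y + t\<^sup>2 * ip y y"
    by (simp add: ip_simps ip_commute[of y x] power2_eq_square algebra_simps)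
  also have "\<dots> = ip x x - (ip x y)\<^sup>2 / ip y y"
    using pos by (simp add: t_def power2_eq_square field_simps)
  finally show ?thesis using pos by (simp add: field_simps)
next
  case True
  have "0 \<le> ip (x - t *\<^sub>R y) (x - t *\<^sub>R y)" for t by (rule ip_nonneg)
  then have *: "2 * t * ip x y \<le> ip x x" for t
    using True by (simp add: ip_simps ip_commute[of y x] power2_eq_square algebra_simps)
  have "ip x y = 0"
  proof (rule ccontr)
    assume "ip x y \<noteq> 0"
    \<comment> \<open>For this value of \<open>t\<close> the left side becomes
      \<open>ip x x + 1\<close>.\<close>
    with *[of "(ip x x + 1) / (2 * ip x y)"] show False by simp
  qed
  with True show ?thesis by simp
qed

lemma ip_null: "ip x x = 0 \<Longrightarrow> ip x y = 0"
  using cauchy_schwarz[of x y] by simp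

lemma ip_null_right: "ip x x = 0 \<Longrightarrow> ip y x = 0"
  using ip_null ip_commute by simp

lemma ip_abs_le: "2 * \<bar>ip x y\<bar> \<le> ip x x + ip y y"
  using ip_nonneg[of "x + y"] ip_nonneg[of "x - y"] by (simp add: ip_simps ip_commute[of y x])

lemma ip_sum_le: "ip (x + y) (x + y) \<le> 2 * ip x x + 2 * ip y y"
  using ip_nonneg[of "x - y"] by (simp add: ip_simps ip_commute[of y x])

section \<open>Closed convex functions and subgradients\<close>

text \<open>Sequential closedness of the epigraph, again phrased with real bounds so that it
  combines with \<open>econvex\<close>.\<close>

definition elsc :: "('v \<Rightarrow> ereal) \<Rightarrow> bool" where
  "elsc F \<longleftrightarrow> (\<forall>X l c c'. (\<forall>n. F (X n) \<le> ereal (c n)) \<longrightarrow> c \<longlonglongrightarrow> c' \<longrightarrow>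
     (\<lambda>n. ip (X n - l) (X n - l)) \<longlonglongrightarrow> 0 \<longrightarrow> F l \<le> ereal c')"

lemma elscD:
  "elsc F \<Longrightarrow> (\<And>n. F (X n) \<le> ereal (c n)) \<Longrightarrow> c \<longlonglongrightarrow> c' \<Longrightarrow>
     (\<lambda>n. ip (X n - l) (X n - l)) \<longlonglongrightarrow> 0 \<Longrightarrow> F l \<le> ereal c'"
  unfolding elsc_def by blast

text \<open>The constant sequence at one point converges in seminorm to every point at distance zero
  from it.\<close>

lemma elsc_null:
  assumes "elsc F" "ip (x - y) (x - y) = 0"
  shows "F x = F y"
proof -
  have le: "F b \<le> F a" if "ip (a - b) (a - b) = 0" for a b
    by (rule ereal_le_real, rule elscD[OF assms(1), of "\<lambda>_. a" "\<lambda>_. _"]) (use that in auto)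
  have "ip (y - x) (y - x) = 0"
    using assms(2) by (simp add: ip_simps)
  then show ?thesis using le assms(2) by (meson antisym)
qed

text \<open>Finiteness at \<open>p\<close> excludes points of value -\<infinity>, where every
  \<open>g\<close> would satisfy the inequality.\<close>

definition subgrad :: "('v \<Rightarrow> ereal) \<Rightarrow> 'v \<Rightarrow> 'v \<Rightarrow> bool" where
  "subgrad F p g \<longleftrightarrow> \<bar>F p\<bar> \<noteq> \<infinity> \<and> (\<forall>y. F p + ereal (ip g (y - p)) \<le> F y)"

lemma subgrad_finite: "subgrad F p g \<Longrightarrow> \<bar>F p\<bar> \<noteq> \<infinity>"
  by (simp add: subgrad_def)

lemma subgrad_le: "subgrad F p g \<Longrightarrow> F p + ereal (ip g (y - p)) \<le> F y"
  by (simp add: subgrad_def)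

text \<open>Add the two subgradient inequalities, each evaluated at the other point.\<close>

lemma subgrad_monotone:
  assumes "subgrad F p g" "subgrad F q h"
  shows "0 \<le> ip (p - q) (g - h)"
proof -
  obtain a b where ab: "F p = ereal a" "F q = ereal b"
    using assms subgrad_finite by (metis ereal_cases abs_ereal.simps(2,3))
  have "a + ip g (q - p) \<le> b" "b + ip h (p - q) \<le> a"
    using subgrad_le[OF assms(1), of q] subgrad_le[OF assms(2), of p] ab by simp_all
  then show ?thesis
    by (simp add: ip_simps ip_commute)
qed

lemma subgrad_cong:
  assumes "elsc F" "subgrad F p g" "ip (p - p') (p - p') = 0" "ip (g - g') (g - g') = 0"
  shows "subgrad F p' g'"
proof -
  have F: "F p' = F p" using elsc_null[OF assms(1,3)] by simp
  have "ip g (y - p) = ip g' (y - p')" for y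
    using ip_null[OF assms(4), of "y - p'"] ip_null_right[OF assms(3), of g]
    by (simp add: ip_simps)
  then show ?thesis using assms(2) by (simp add: subgrad_def F)
qed

text \<open>First-order optimality with a quadratic error. Moving only the fraction \<open>t\<close>
  from \<open>p\<close> towards \<open>y\<close> scales the linear term by \<open>t\<close> and the
  error by the square of \<open>t\<close>. After division by \<open>t\<close> the error disappears
  as \<open>t\<close> tends to 0.\<close>

lemma subgrad_of_min:
  assumes cv: "econvex F" and Fp: "F p = ereal c"
    and min: "\<And>y b. F y \<le> ereal b \<Longrightarrow> c \<le> b + ip h (y - p) + K * ip (y - p) (y - p)"
  shows "subgrad F p (- h)"
  unfolding subgrad_def
proof (intro conjI allI)
  show "\<bar>F p\<bar> \<noteq> \<infinity>" by (simp add: Fp)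
  fix y
  show "F p + ereal (ip (- h) (y - p)) \<le> F y"
  proof (rule ereal_le_real)
    fix b assume b: "F y \<le> ereal b"
    have *: "c \<le> b + ip h (y - p) + t * (K * ip (y - p) (y - p))" if t: "0 < t" "t < 1" for t
    proof -
      have eq: "(1 - t) *\<^sub>R p + t *\<^sub>R y - p = t *\<^sub>R (y - p)" by (simp add: algebra_simps)
      have "F ((1 - t) *\<^sub>R p + t *\<^sub>R y) \<le> ereal ((1 - t) * c + t * b)"
        using econvexD[OF cv _ b t, of p c] Fp by simp
      from min[OF this] have "t * c \<le> t * (b + ip h (y - p) + t * (K * ip (y - p) (y - p)))"
        unfolding eq ip_scaleR_left ip_scaleR_right by (simp only: algebra_simps)
      then show ?thesis using t by simp
    qed
    have "((\<lambda>t. b + ip h (y - p) + t * (K * ip (y - p) (y - p))) \<longlongrightarrow>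
        b + ip h (y - p) + 0 * (K * ip (y - p) (y - p))) (at_right 0)"
      by (intro tendsto_intros)
    then have "c \<le> b + ip h (y - p) + 0 * (K * ip (y - p) (y - p))"
      by (rule tendsto_lowerbound)
        (use * in \<open>auto simp: eventually_at_right_field intro!: exI[of _ 1]\<close>)
    then show "F p + ereal (ip (- h) (y - p)) \<le> ereal b"
      by (simp add: Fp ip_minus_left)
  qed
qed

section \<open>Proximal points, Riesz representation, projections\<close>

text \<open>A minimising sequence of F plus half the squared distance to \<open>v\<close> is Cauchy
  by strong convexity, and lower semicontinuity makes its limit a minimiser. The lower bound
  \<open>m0\<close> is a hypothesis because each application has an explicit one; this bypasses the
  separation argument that produces an affine minorant of a general closed convex function.\<close>

theorem prox_exists:
  assumes cv: "econvex F" and lsc: "elsc F" and proper: "F x0 \<le> ereal c0"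
    and bdd: "\<And>y b. F y \<le> ereal b \<Longrightarrow> m0 \<le> b + ip (y - v) (y - v) / 2"
  shows "\<exists>p. subgrad F p (v - p)"
proof -
  define S where "S = {b + ip (y - v) (y - v) / 2 | y b. F y \<le> ereal b}"
  define m where "m = Inf S"
  have Sne: "S \<noteq> {}" using proper by (auto simp: S_def)
  have Sbdd: "bdd_below S" using bdd by (auto simp: S_def intro!: bdd_belowI[of _ m0])
  have mle: "m \<le> b + ip (y - v) (y - v) / 2" if "F y \<le> ereal b" for y b
    unfolding m_def by (rule cInf_lower[OF _ Sbdd]) (use that in \<open>auto simp: S_def\<close>)
  have "\<exists>y b. F y \<le> ereal b \<and> b + ip (y - v) (y - v) / 2 < m + 1 / Suc n" for n
  proof -
    have "\<exists>s\<in>S. s < m + 1 / Suc n"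
      using cInf_lessD[OF Sne, of "m + 1 / Suc n"] by (simp add: m_def)
    then show ?thesis by (auto simp: S_def)
  qed
  then obtain Y b where Y: "\<And>n. F (Y n) \<le> ereal (b n)"
    and Yb: "\<And>n. b n + ip (Y n - v) (Y n - v) / 2 < m + 1 / Suc n" by metis
  \<comment> \<open>The quadratic term at the midpoint lies
    \<open>ip (Y j - Y k) (Y j - Y k) / 8\<close> below the mean of its end values. The midpoint
    still has objective at least \<open>m\<close>, while the mean is less than \<open>m\<close> plus
    half the sum of the two tolerances; hence the factor 4.\<close>
  have mid: "ip (Y j - Y k) (Y j - Y k) \<le> 4 * (1 / Suc j + 1 / Suc k)" for j k
  proof -
    have "F ((1 - 1/2) *\<^sub>R Y j + (1/2) *\<^sub>R Y k) \<le> ereal ((1 - 1/2) * b j + (1/2) * b k)"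
      by (rule econvexD[OF cv Y Y]) auto
    then have *: "m \<le> ((1 - 1/2) * b j + (1/2) * b k) + ip ((1 - 1/2) *\<^sub>R Y j + (1/2) *\<^sub>R Y k - v)
        ((1 - 1/2) *\<^sub>R Y j + (1/2) *\<^sub>R Y k - v) / 2"
      by (rule mle)
    define d e where "d = 1 / real (Suc j)" and "e = 1 / real (Suc k)"
    from * Yb[of j] Yb[of k] show ?thesis
      unfolding d_def[symmetric] e_def[symmetric]
      by (simp add: ip_simps ip_commute add_divide_distrib diff_divide_distrib)
  qed
  have "\<exists>l. (\<lambda>n. ip (Y n - l) (Y n - l)) \<longlonglongrightarrow> 0"
  proof (rule complete)
    fix e :: real assume e: "e > 0"
    then obtain K where K: "1 / real (Suc K) < e / 8"
      using nat_approx_posE[of "e / 8"] by auto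
    show "\<exists>K. \<forall>m\<ge>K. \<forall>n\<ge>K. ip (Y m - Y n) (Y m - Y n) < e"
    proof (intro exI allI impI)
      fix j k assume "K \<le> j" "K \<le> k"
      then have "1 / real (Suc j) \<le> 1 / real (Suc K)" "1 / real (Suc k) \<le> 1 / real (Suc K)"
        by (simp_all add: frac_le)
      with K have "1 / real (Suc j) + 1 / real (Suc k) < e / 4" by linarith
      then have "4 * (1 / real (Suc j) + 1 / real (Suc k)) < 4 * (e / 4)"
        by (rule mult_strict_left_mono) simp
      with mid[of j k] show "ip (Y j - Y k) (Y j - Y k) < e" by simp
    qed
  qed
  then obtain p where p: "(\<lambda>n. ip (Y n - p) (Y n - p)) \<longlonglongrightarrow> 0" by blast
  have cross: "(\<lambda>n. ip (Y n - p) w) \<longlonglongrightarrow> 0" for w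
  proof (rule Lim_null_comparison)
    show "\<forall>\<^sub>F n in sequentially. norm (ip (Y n - p) w) \<le> sqrt (ip (Y n - p) (Y n - p) * ip w w)"
      by (intro always_eventually allI real_le_rsqrt) (simp add: cauchy_schwarz)
    show "(\<lambda>n. sqrt (ip (Y n - p) (Y n - p) * ip w w)) \<longlonglongrightarrow> 0"
      using tendsto_real_sqrt[OF tendsto_mult_right[OF p, of "ip w w"]] by simp
  qed
  have nrm: "(\<lambda>n. ip (Y n - v) (Y n - v)) \<longlonglongrightarrow> ip (p - v) (p - v)"
  proof -
    have "(\<lambda>n. ip (Y n - p) (Y n - p) + 2 * ip (Y n - p) (p - v) + ip (p - v) (p - v))
        \<longlonglongrightarrow> 0 + 2 * 0 + ip (p - v) (p - v)"
      by (intro tendsto_intros p cross)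
    moreover have "ip (Y n - p) (Y n - p) + 2 * ip (Y n - p) (p - v) + ip (p - v) (p - v) =
        ip (Y n - v) (Y n - v)" for n
      by (simp add: ip_simps ip_commute)
    ultimately show ?thesis by simp
  qed
  \<comment> \<open>The value that \<open>F\<close> must have at \<open>p\<close> if
    \<open>p\<close> attains the infimum \<open>m\<close>.\<close>
  define c where "c = m - ip (p - v) (p - v) / 2"
  have Fle: "F p \<le> ereal c"
  proof (rule elscD[OF lsc _ _ p])
    show "F (Y n) \<le> ereal (m + 1 / Suc n - ip (Y n - v) (Y n - v) / 2)" for n
      by (rule order_trans[OF Y]) (use Yb[of n] in simp)
    have "(\<lambda>n. m + 1 / real (Suc n) - ip (Y n - v) (Y n - v) / 2) \<longlonglongrightarrow> m + 0 - ip (p - v) (p - v) / 2"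
      by (intro tendsto_intros nrm LIMSEQ_Suc[OF lim_inverse_n']) simp
    then show "(\<lambda>n. m + 1 / real (Suc n) - ip (Y n - v) (Y n - v) / 2) \<longlonglongrightarrow> c"
      by (simp add: c_def)
  qed
  have "ereal c \<le> F p"
  proof (rule ereal_le_real)
    fix b assume "F p \<le> ereal b"
    from mle[OF this] show "ereal c \<le> ereal b" by (simp add: c_def)
  qed
  with Fle have Fp: "F p = ereal c" by simp
  have "subgrad F p (- (p - v))"
  proof (rule subgrad_of_min[OF cv Fp, where K = "1/2"])
    fix y b assume "F y \<le> ereal b"
    from mle[OF this] show "c \<le> b + ip (p - v) (y - p) + 1/2 * ip (y - p) (y - p)"
      unfolding c_def by (simp add: ip_simps ip_commute add_divide_distrib diff_divide_distrib)
  qed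
  then show ?thesis by auto
qed

text \<open>The representing vector minimises half the squared seminorm minus \<open>L\<close>. Its
  subgradient inequality gives \<open>L d \<le> ip p d\<close> for all \<open>d\<close>, and
  replacing \<open>d\<close> by \<open>- d\<close> gives equality.\<close>

theorem riesz:
  assumes add: "\<And>x y. L (x + y) = L x + L y" and scale: "\<And>c x. L (c *\<^sub>R x) = c * L x"
    and C: "C \<ge> 0" and bound: "\<And>x. (L x)\<^sup>2 \<le> C * ip x x"
  shows "\<exists>p. \<forall>x. L x = ip p x"
proof -
  have diff: "L (x - y) = L x - L y" for x y
    using add[of "x - y" y] by simp
  \<comment> \<open>The arithmetic-geometric mean inequality turns the bound on the square of
    \<open>L y\<close> into the lower bound \<open>- (C / 2)\<close> that \<open>prox_exists\<close>
    asks for.\<close>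
  have b: "2 * L y \<le> C + ip y y" for y
  proof (rule power2_le_imp_le)
    have "(2 * L y)\<^sup>2 \<le> 4 * (C * ip y y)"
      using bound[of y] by (simp add: power_mult_distrib)
    also have "\<dots> \<le> (C + ip y y)\<^sup>2"
      using zero_le_power2[of "C - ip y y"] by (simp add: power2_eq_square algebra_simps)
    finally show "(2 * L y)\<^sup>2 \<le> (C + ip y y)\<^sup>2" .
  qed (use C ip_nonneg[of y] in simp)
  have "\<exists>p. subgrad (\<lambda>x. ereal (- L x)) p (0 - p)"
  proof (rule prox_exists)
    show "econvex (\<lambda>x. ereal (- L x))"
      unfolding econvex_def
    proof (intro allI impI)
      fix x y a b and t :: real
      assume "ereal (- L x) \<le> ereal a" "ereal (- L y) \<le> ereal b" "0 < t" "t < 1"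
      then have "(1 - t) * (- L x) \<le> (1 - t) * a" "t * (- L y) \<le> t * b"
        by (simp_all only: mult_le_cancel_left_pos ereal_less_eq diff_gt_0_iff_gt)
      then show "ereal (- L ((1 - t) *\<^sub>R x + t *\<^sub>R y)) \<le> ereal ((1 - t) * a + t * b)"
        by (simp add: add scale)
    qed
    show "elsc (\<lambda>x. ereal (- L x))"
      unfolding elsc_def
    proof (intro allI impI)
      fix X :: "nat \<Rightarrow> 'v" and l c c'
      assume X: "\<forall>n. ereal (- L (X n)) \<le> ereal (c n)" "c \<longlonglongrightarrow> c'" "(\<lambda>n. ip (X n - l) (X n - l)) \<longlonglongrightarrow> 0"
      have "(\<lambda>n. L (X n - l)) \<longlonglongrightarrow> 0"
      proof (rule Lim_null_comparison)
        show "\<forall>\<^sub>F n in sequentially. norm (L (X n - l)) \<le> sqrt (C * ip (X n - l) (X n - l))"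
          by (intro always_eventually allI real_le_rsqrt) (simp add: bound)
        show "(\<lambda>n. sqrt (C * ip (X n - l) (X n - l))) \<longlonglongrightarrow> 0"
          using tendsto_real_sqrt[OF tendsto_mult_left[OF X(3), of C]] by simp
      qed
      then have "(\<lambda>n. - (L (X n - l) + L l)) \<longlonglongrightarrow> - (0 + L l)"
        by (intro tendsto_intros)
      then have "(\<lambda>n. - L (X n)) \<longlonglongrightarrow> - L l" by (simp add: diff)
      then have "- L l \<le> c'" using X(1,2) by (intro LIMSEQ_le[of _ _ c]) auto
      then show "ereal (- L l) \<le> ereal c'" by simp
    qed
    show "ereal (- L 0) \<le> ereal (- L 0)" by simp
    show "- (C / 2) \<le> d + ip (y - 0) (y - 0) / 2" if "ereal (- L y) \<le> ereal d" for y d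
      using that b[of y] by simp
  qed
  then obtain p where p: "\<And>y. - L p + ip (0 - p) (y - p) \<le> - L y"
    unfolding subgrad_def by auto
  have le: "L d \<le> ip p d" for d
    using p[of "p + d"] by (simp add: add ip_simps)
  have "L d = ip p d" for d
    using le[of d] le[of "- d"] scale[of "-1" d] by (simp add: ip_minus_right)
  then show ?thesis by blast
qed

text \<open>The projection is the proximal point of the indicator function of \<open>N\<close>. A
  subgradient of that function at \<open>p\<close> is nonpositive on every direction in
  \<open>N\<close>, hence zero, as directions can be reversed.\<close>

theorem projection_exists:
  assumes N: "subspace N"
    and closed: "\<And>X l. (\<And>n. X n \<in> N) \<Longrightarrow> (\<lambda>n. ip (X n - l) (X n - l)) \<longlonglongrightarrow> 0 \<Longrightarrow> l \<in> N"
  shows "\<exists>p\<in>N. \<forall>v\<in>N. ip (x - p) v = 0"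
proof -
  let ?F = "\<lambda>y. if y \<in> N then 0 else (\<infinity> :: ereal)"
  have "\<exists>p. subgrad ?F p (x - p)"
  proof (rule prox_exists)
    show "econvex ?F"
      unfolding econvex_def
      by (auto split: if_splits simp: subspace_add subspace_scale N)
    show "elsc ?F"
      unfolding elsc_def
    proof (intro allI impI)
      fix X :: "nat \<Rightarrow> 'v" and l c c'
      assume X: "\<forall>n. ?F (X n) \<le> ereal (c n)" "c \<longlonglongrightarrow> c'" "(\<lambda>n. ip (X n - l) (X n - l)) \<longlonglongrightarrow> 0"
      have XN: "X n \<in> N \<and> 0 \<le> c n" for n using X(1)[rule_format, of n] by (auto split: if_splits)
      then have "l \<in> N" using closed X(3) by blast
      moreover have "0 \<le> c'" using XN X(2) by (intro LIMSEQ_le_const[of c]) auto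
      ultimately show "?F l \<le> ereal c'" by simp
    qed
    show "?F 0 \<le> ereal 0" using subspace_0[OF N] by simp
    show "0 \<le> d + ip (y - x) (y - x) / 2" if "?F y \<le> ereal d" for y d
      using that ip_nonneg[of "y - x"] by (auto split: if_splits)
  qed
  then obtain p where p: "subgrad ?F p (x - p)" by blast
  have pN: "p \<in> N" using subgrad_finite[OF p] by (auto split: if_splits)
  have le: "ip (x - p) v \<le> 0" if "v \<in> N" for v
    using subgrad_le[OF p, of "p + v"] pN that subspace_add[OF N pN that] by simp
  have "ip (x - p) v = 0" if "v \<in> N" for v
    using le[OF that] le[OF subspace_neg[OF N that]] by (simp add: ip_minus_right)
  with pN show ?thesis by blast
qed

section \<open>Weak convergence along filters\<close>

text \<open>General filters are allowed because the compactness argument produces a finer filter,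
  not a subsequence.\<close>

definition weak_lim :: "('i \<Rightarrow> 'v) \<Rightarrow> 'v \<Rightarrow> 'i filter \<Rightarrow> bool" where
  "weak_lim u l G \<longleftrightarrow> (\<forall>y. ((\<lambda>k. ip (u k) y) \<longlongrightarrow> ip l y) G)"

lemma weak_limD: "weak_lim u l G \<Longrightarrow> ((\<lambda>k. ip (u k) y) \<longlongrightarrow> ip l y) G"
  by (simp add: weak_lim_def)

lemma weak_lim_mono: "weak_lim u l G \<Longrightarrow> G' \<le> G \<Longrightarrow> weak_lim u l G'"
  unfolding weak_lim_def using tendsto_mono by blast

lemma weak_lim_diff: "weak_lim u l G \<Longrightarrow> weak_lim u' l' G \<Longrightarrow> weak_lim (\<lambda>k. u k - u' k) (l - l') G"
  unfolding weak_lim_def by (simp add: ip_diff_left tendsto_diff)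

lemma weak_lim_scaleR: "weak_lim u l G \<Longrightarrow> weak_lim (\<lambda>k. c *\<^sub>R u k) (c *\<^sub>R l) G"
  unfolding weak_lim_def by (simp add: ip_scaleR_left tendsto_mult_left)

lemma strong_tendsto_ip:
  assumes bdd: "\<And>k. ip (u k) (u k) \<le> C" and lim: "((\<lambda>k. ip (d k) (d k)) \<longlongrightarrow> 0) G"
  shows "((\<lambda>k. ip (d k) (u k)) \<longlongrightarrow> 0) G"
proof (rule Lim_null_comparison)
  show "\<forall>\<^sub>F k in G. norm (ip (d k) (u k)) \<le> sqrt (ip (d k) (d k) * C)"
  proof (intro always_eventually allI)
    fix k
    have "(norm (ip (d k) (u k)))\<^sup>2 \<le> ip (d k) (d k) * ip (u k) (u k)"
      by (simp add: cauchy_schwarz)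
    also have "\<dots> \<le> ip (d k) (d k) * C"
      by (rule mult_left_mono[OF bdd ip_nonneg])
    finally show "norm (ip (d k) (u k)) \<le> sqrt (ip (d k) (d k) * C)"
      by (rule real_le_rsqrt)
  qed
  show "((\<lambda>k. sqrt (ip (d k) (d k) * C)) \<longlongrightarrow> 0) G"
    using tendsto_real_sqrt[OF tendsto_mult_right[OF lim, of C]] by simp
qed

lemma weak_lim_strong:
  assumes "weak_lim u l G" and lim: "((\<lambda>k. ip (d k) (d k)) \<longlongrightarrow> 0) G"
  shows "weak_lim (\<lambda>k. u k + d k) l G"
  unfolding weak_lim_def
proof
  fix y
  have "((\<lambda>k. ip (d k) y) \<longlongrightarrow> 0) G"
    by (rule strong_tendsto_ip[OF _ lim, of "\<lambda>_. y" "ip y y"]) simp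
  from tendsto_add[OF weak_limD[OF assms(1)] this] show "((\<lambda>k. ip (u k + d k) y) \<longlongrightarrow> ip l y) G"
    by (simp add: ip_add_left)
qed

text \<open>Tychonoff yields a cluster point of the functionals \<open>ip (u k)\<close>, and Riesz represents it.\<close>

theorem weak_cluster:
  assumes ne: "G \<noteq> bot" and bdd: "\<And>k. ip (u k) (u k) \<le> C"
  shows "\<exists>G' l. G' \<le> G \<and> G' \<noteq> bot \<and> weak_lim u l G'"
proof -
  have C: "0 \<le> C" using order_trans[OF ip_nonneg bdd] .
  define \<phi> where "\<phi> k = ip (u k)" for k
  \<comment> \<open>These intervals contain all \<open>ip (u k) y\<close> by
    \<open>ip_abs_le\<close>; the generous bound avoids square roots.\<close>
  define K where "K = PiE UNIV (\<lambda>y. {- (C + ip y y)..C + ip y y})"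
  have "compactin (product_topology (\<lambda>_. euclidean) UNIV) K"
    unfolding K_def by (subst compactin_PiE) simp
  then have K: "compact K" by (simp add: euclidean_product_topology)
  have \<phi>K: "\<phi> k \<in> K" for k
  proof -
    have "- (C + ip y y) \<le> ip (u k) y \<and> ip (u k) y \<le> C + ip y y" for y
      using ip_abs_le[of "u k" y] bdd[of k] ip_nonneg[of y] C by linarith
    then show ?thesis unfolding K_def \<phi>_def by (intro PiE_I) (simp_all only: atLeastAtMost_iff UNIV_I not_True_eq_False)
  qed
  have "filtermap \<phi> G \<noteq> bot" using ne by (simp add: filtermap_bot_iff)
  moreover have "eventually (\<lambda>f. f \<in> K) (filtermap \<phi> G)"
    by (simp add: eventually_filtermap \<phi>K)
  ultimately have "\<exists>L\<in>K. inf (nhds L) (filtermap \<phi> G) \<noteq> bot"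
    by (rule K[unfolded compact_filter, rule_format])
  then obtain L where L: "inf (nhds L) (filtermap \<phi> G) \<noteq> bot" by blast
  \<comment> \<open>\<open>G\<close> refined by the preimages of the neighbourhoods of
    \<open>L\<close>. It is proper exactly because \<open>L\<close> is a cluster point.\<close>
  define G' where "G' = inf G (filtercomap \<phi> (nhds L))"
  have G'le: "G' \<le> G" by (simp add: G'_def)
  have G'ne: "G' \<noteq> bot"
  proof
    assume "G' = bot"
    then have "eventually (\<lambda>_. False) G'" by simp
    then obtain P Q where P: "eventually P G" and Q: "eventually Q (nhds L)"
      and PQ: "\<And>k. P k \<Longrightarrow> Q (\<phi> k) \<Longrightarrow> False"
      unfolding G'_def eventually_inf eventually_filtercomap by blast
    have "eventually (\<lambda>f. \<not> Q f) (filtermap \<phi> G)"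
      unfolding eventually_filtermap by (rule eventually_mono[OF P]) (use PQ in blast)
    then have "eventually (\<lambda>_. False) (inf (nhds L) (filtermap \<phi> G))"
      unfolding eventually_inf using Q by (intro exI[of _ Q] exI[of _ "\<lambda>f. \<not> Q f"]) simp
    with L show False by (simp add: trivial_limit_def)
  qed
  have lim: "((\<lambda>k. ip (u k) y) \<longlongrightarrow> L y) G'" for y
  proof -
    have "((\<lambda>f. f y) \<longlongrightarrow> L y) (nhds L)"
    proof (rule topological_tendstoI)
      fix S :: "real set" assume "open S" "L y \<in> S"
      moreover have "open ((\<lambda>f::'v \<Rightarrow> real. f y) -` S)"
        using \<open>open S\<close> by (rule open_vimage) simp
      ultimately show "\<forall>\<^sub>F f in nhds L. f y \<in> S"
        unfolding eventually_nhds by (intro exI[of _ "(\<lambda>f. f y) -` S"]) simp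
    qed
    moreover have "filterlim \<phi> (nhds L) G'"
      unfolding G'_def by (rule filterlim_mono[OF filterlim_filtercomap order_refl]) simp
    ultimately have "((\<lambda>k. \<phi> k y) \<longlongrightarrow> L y) G'"
      by (rule filterlim_compose)
    then show ?thesis by (simp add: \<phi>_def)
  qed
  have "\<exists>l. \<forall>y. L y = ip l y"
  proof (rule riesz[OF _ _ C])
    fix x y
    show "L (x + y) = L x + L y"
      by (rule tendsto_unique[OF G'ne lim[of "x + y"]])
        (use tendsto_add[OF lim[of x] lim[of y]] in \<open>simp add: ip_add_right\<close>)
    show "L (c *\<^sub>R x) = c * L x" for c
      by (rule tendsto_unique[OF G'ne lim[of "c *\<^sub>R x"]])
        (use tendsto_mult_left[OF lim[of x], of c] in \<open>simp add: ip_scaleR_right\<close>)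
    show "(L x)\<^sup>2 \<le> C * ip x x"
    proof (rule tendsto_upperbound[OF tendsto_power[OF lim] _ G'ne])
      show "\<forall>\<^sub>F k in G'. (ip (u k) x)\<^sup>2 \<le> C * ip x x"
        by (intro always_eventually allI order_trans[OF cauchy_schwarz] mult_right_mono bdd ip_nonneg)
    qed
  qed
  then obtain l where "\<And>y. L y = ip l y" by blast
  with lim have "weak_lim u l G'" by (simp add: weak_lim_def)
  with G'le G'ne show ?thesis by blast
qed

text \<open>If convergence failed for some test vector, boundedness would give a cluster point along
  the indices that stay away from \<open>l\<close>. Asking for a refinement with limit
  \<open>l\<close>, rather than for \<open>l' = l\<close>, respects the non-uniqueness of weak
  limits and leaves room to make a second sequence converge as well.\<close>

lemma weak_lim_if_unique_cluster:
  assumes bdd: "\<And>k. ip (u k) (u k) \<le> C"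
    and uniq: "\<And>G l'. G \<le> sequentially \<Longrightarrow> G \<noteq> bot \<Longrightarrow> weak_lim u l' G \<Longrightarrow>
      \<exists>G'\<le>G. G' \<noteq> bot \<and> weak_lim u l G'"
  shows "weak_lim u l sequentially"
  unfolding weak_lim_def
proof (rule allI, rule ccontr)
  fix y assume "\<not> (\<lambda>k. ip (u k) y) \<longlonglongrightarrow> ip l y"
  then obtain e where e: "e > 0" and nev: "\<not> eventually (\<lambda>k. dist (ip (u k) y) (ip l y) < e) sequentially"
    unfolding tendsto_iff by blast
  \<comment> \<open>The filter living on the indices where the \<open>e\<close>-test fails; it is
    proper because the test does not hold eventually.\<close>
  define G where "G = inf sequentially (principal {k. \<not> dist (ip (u k) y) (ip l y) < e})"
  have Gle: "G \<le> sequentially" by (simp add: G_def)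
  have Gne: "G \<noteq> bot"
    using nev unfolding G_def trivial_limit_def eventually_inf_principal by simp
  obtain G1 l' where G1: "G1 \<le> G" "G1 \<noteq> bot" "weak_lim u l' G1"
    using weak_cluster[where u = u and C = C, OF Gne bdd] by metis
  then obtain G' where G': "G' \<le> G1" "G' \<noteq> bot" "weak_lim u l G'"
    using uniq[OF order_trans[OF G1(1) Gle] G1(2,3)] by metis
  have "eventually (\<lambda>k. dist (ip (u k) y) (ip l y) < e) G'"
    using tendstoD[OF weak_limD[OF G'(3)] e] .
  moreover have "eventually (\<lambda>k. \<not> dist (ip (u k) y) (ip l y) < e) G'"
    by (rule filter_leD[OF order_trans[OF G'(1) G1(1)]]) (simp add: G_def eventually_inf_principal)
  ultimately have "eventually (\<lambda>_. False) G'" by eventually_elim simp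
  with G'(2) show False by (simp add: trivial_limit_def)
qed

lemma ip_null_cong:
  assumes "ip (a - b) (a - b) = 0"
  shows "ip a y = ip b y" and "ip (a - p) (a - p) = ip (b - p) (b - p)"
proof -
  show *: "ip a y = ip b y" for y
    using ip_null[OF assms, of y] by (simp add: ip_diff_left)
  show "ip (a - p) (a - p) = ip (b - p) (b - p)"
    using *[of "a - p"] *[of "b - p"] ip_commute[of a b] ip_commute[of p a] ip_commute[of p b]
    by (simp add: ip_diff_left ip_diff_right)
qed

lemma weak_lim_null_cong:
  assumes "weak_lim u l G" "ip (l - l') (l - l') = 0"
  shows "weak_lim u l' G"
  using assms(1) by (simp add: weak_lim_def ip_null_cong(1)[OF assms(2)])

section \<open>The Douglas--Rachford iteration\<close>

text \<open>\<open>A\<close> and \<open>B\<close> are graphs of monotone operators, treated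
  asymmetrically: \<open>A\<close> is maximal, while \<open>B\<close> has a graph closed under
  simultaneous weak limits of both components. The second is a strong property, available here
  because the intended \<open>B\<close> is a linear relation. The recursion for \<open>u\<close> is
  required only up to null vectors.\<close>

theorem douglas_rachford:
  fixes A B :: "'v \<Rightarrow> 'v \<Rightarrow> bool" and u x y :: "nat \<Rightarrow> 'v" and r :: real
  assumes r: "r > 0"
    and A_mono: "\<And>p g q h. A p g \<Longrightarrow> A q h \<Longrightarrow> 0 \<le> ip (p - q) (g - h)"
    and A_max: "\<And>q h. (\<And>p g. A p g \<Longrightarrow> 0 \<le> ip (q - p) (h - g)) \<Longrightarrow> A q h"
    and B_mono: "\<And>p g q h. B p g \<Longrightarrow> B q h \<Longrightarrow> 0 \<le> ip (p - q) (g - h)"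
    and B_closed: "\<And>(Y :: nat \<Rightarrow> 'v) Z q h H. (\<And>k. B (Y k) (Z k)) \<Longrightarrow> H \<noteq> bot \<Longrightarrow>
      weak_lim Y q H \<Longrightarrow> weak_lim Z h H \<Longrightarrow> B q h"
    and sol: "A xs g" "B xs (- g)"
    and Ax: "\<And>k. A (x k) (r *\<^sub>R (u k - x k))"
    and By: "\<And>k. B (y k) (r *\<^sub>R (2 *\<^sub>R x k - u k - y k))"
    and u_Suc: "\<And>k. ip (u (Suc k) - (u k - x k + y k)) (u (Suc k) - (u k - x k + y k)) = 0"
  shows "\<exists>ub xb. weak_lim u ub sequentially \<and> weak_lim x xb sequentially \<and>
    A xb (r *\<^sub>R (ub - xb)) \<and> B xb (- (r *\<^sub>R (ub - xb)))"
proof -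
  \<comment> \<open>\<open>p\<close> is a fixed point of the map on \<open>u\<close>, and
    \<open>q\<close> is the common value of both proximal points there: the second condition is the
    one in \<open>By\<close> with \<open>x k\<close> and \<open>y k\<close> both replaced by
    \<open>q\<close> and \<open>u k\<close> by \<open>p\<close>.\<close>
  define fixp where "fixp p q \<longleftrightarrow> A q (r *\<^sub>R (p - q)) \<and> B q (- (r *\<^sub>R (p - q)))" for p q
  have ux: "0 \<le> ip (x k - q) ((u k - p) - (x k - q))" if "fixp p q" for p q k
  proof -
    have "0 \<le> ip (x k - q) (r *\<^sub>R (u k - x k) - r *\<^sub>R (p - q))"
      using A_mono[OF Ax] that by (simp add: fixp_def)
    also have "r *\<^sub>R (u k - x k) - r *\<^sub>R (p - q) = r *\<^sub>R ((u k - p) - (x k - q))"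
      by (simp add: algebra_simps)
    finally show ?thesis using r by (simp add: ip_scaleR_right zero_le_mult_iff)
  qed
  have uy: "0 \<le> ip (y k - q) (2 *\<^sub>R (x k - q) - (u k - p) - (y k - q))" if "fixp p q" for p q k
  proof -
    have "0 \<le> ip (y k - q) (r *\<^sub>R (2 *\<^sub>R x k - u k - y k) - - (r *\<^sub>R (p - q)))"
      using B_mono[OF By] that unfolding fixp_def by blast
    also have "r *\<^sub>R (2 *\<^sub>R x k - u k - y k) - - (r *\<^sub>R (p - q)) =
        r *\<^sub>R (2 *\<^sub>R (x k - q) - (u k - p) - (y k - q))"
      by (simp add: algebra_simps scaleR_2)
    finally show ?thesis using r by (simp add: ip_scaleR_right zero_le_mult_iff)
  qed
  have x_le: "ip (x k - q) (x k - q) \<le> ip (u k - p) (u k - p)" if "fixp p q" for p q k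
  proof -
    define a X where "a = u k - p" and "X = x k - q"
    have "0 \<le> ip X (a - X)" using ux[OF that, of k] by (simp add: a_def X_def)
    then show ?thesis using ip_nonneg[of "a - X"]
      unfolding a_def[symmetric] X_def[symmetric] by (simp add: ip_simps ip_commute[of X a])
  qed
  \<comment> \<open>With \<open>a\<close>, \<open>X\<close>, \<open>Y\<close> as below, the left
    side equals \<open>ip a a\<close> minus twice the two quantities that \<open>ux\<close> and
    \<open>uy\<close> show to be nonnegative.\<close>
  have fejer: "ip (u (Suc k) - p) (u (Suc k) - p) + ip (x k - y k) (x k - y k) \<le> ip (u k - p) (u k - p)"
    if "fixp p q" for p q k
  proof -
    define a X Y where "a = u k - p" and "X = x k - q" and "Y = y k - q"
    have 1: "0 \<le> ip X (a - X)" and 2: "0 \<le> ip Y (2 *\<^sub>R X - a - Y)"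
      using ux[OF that, of k] uy[OF that, of k] by (simp_all add: a_def X_def Y_def)
    have "ip (u (Suc k) - p) (u (Suc k) - p) = ip (u k - x k + y k - p) (u k - x k + y k - p)"
      by (rule ip_null_cong(2)[OF u_Suc])
    also have "u k - x k + y k - p = a - X + Y" by (simp add: a_def X_def Y_def)
    finally have eq: "ip (u (Suc k) - p) (u (Suc k) - p) = ip (a - X + Y) (a - X + Y)" .
    have "x k - y k = X - Y" by (simp add: X_def Y_def)
    then show ?thesis
      using 1 2 unfolding eq a_def[symmetric]
      by (simp add: ip_simps ip_commute[of X a] ip_commute[of Y a] ip_commute[of Y X])
  qed

  \<comment> \<open>Chosen so that \<open>r *\<^sub>R (us - xs) = g\<close>.\<close>
  define us where "us = xs + (1 / r) *\<^sub>R g"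
  have sol': "fixp us xs" using sol r by (simp add: fixp_def us_def)
  define C where "C = ip (u 0 - us) (u 0 - us)"
  have D_le: "ip (u k - us) (u k - us) \<le> C" for k
  proof (induction k)
    case (Suc k)
    then show ?case using fejer[OF sol', of k] ip_nonneg[of "x k - y k"] by linarith
  qed (simp add: C_def)
  have bdd: "\<exists>C'. \<forall>k. ip (w k) (w k) \<le> C'" if "\<And>k. ip (w k - c) (w k - c) \<le> C" for w c
  proof (intro exI allI)
    fix k
    have "ip (w k) (w k) \<le> 2 * ip (w k - c) (w k - c) + 2 * ip c c"
      using ip_sum_le[of "w k - c" c] by simp
    then show "ip (w k) (w k) \<le> 2 * C + 2 * ip c c" using that[of k] by linarith
  qed
  obtain Cu where Cu: "\<And>k. ip (u k) (u k) \<le> Cu" using bdd[of u us, OF D_le] by blast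
  obtain Cx where Cx: "\<And>k. ip (x k) (x k) \<le> Cx"
    using bdd[of x xs, OF order_trans[OF x_le[OF sol'] D_le]] by blast
  have conv: "convergent (\<lambda>k. ip (u k - p) (u k - p))" if "fixp p q" for p q
  proof (rule Bseq_monoseq_convergent)
    have dec: "decseq (\<lambda>k. ip (u k - p) (u k - p))"
    proof (rule decseq_SucI)
      fix k
      show "ip (u (Suc k) - p) (u (Suc k) - p) \<le> ip (u k - p) (u k - p)"
        using fejer[OF that, of k] ip_nonneg[of "x k - y k"] by linarith
    qed
    then show "monoseq (\<lambda>k. ip (u k - p) (u k - p))" by (rule decseq_imp_monoseq)
    show "Bseq (\<lambda>k. ip (u k - p) (u k - p))"
      using dec by (rule decseq_bounded) (use ip_nonneg in blast)
  qed
  have xy: "(\<lambda>k. ip (y k - x k) (y k - x k)) \<longlonglongrightarrow> 0"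
  proof (rule tendsto_sandwich[OF _ _ tendsto_const])
    obtain L where L: "(\<lambda>k. ip (u k - us) (u k - us)) \<longlonglongrightarrow> L"
      using conv[OF sol'] by (auto simp: convergent_def)
    show "(\<lambda>k. ip (u k - us) (u k - us) - ip (u (Suc k) - us) (u (Suc k) - us)) \<longlonglongrightarrow> 0"
      using tendsto_diff[OF L LIMSEQ_Suc[OF L]] by simp
    show "\<forall>\<^sub>F k in sequentially. 0 \<le> ip (y k - x k) (y k - x k)"
      by (simp add: ip_nonneg)
    have "ip (y k - x k) (y k - x k) \<le> ip (u k - us) (u k - us) - ip (u (Suc k) - us) (u (Suc k) - us)" for k
    proof -
      have "ip (y k - x k) (y k - x k) = ip (x k - y k) (x k - y k)" by (simp add: ip_simps)
      then show ?thesis using fejer[OF sol', of k] by linarith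
    qed
    then show "\<forall>\<^sub>F k in sequentially. ip (y k - x k) (y k - x k)
        \<le> ip (u k - us) (u k - us) - ip (u (Suc k) - us) (u (Suc k) - us)" by simp
  qed

  have demiclosed: "fixp ub xb"
    if H: "H \<le> sequentially" "H \<noteq> bot" and wu: "weak_lim u ub H" and wx: "weak_lim x xb H" for H ub xb
  proof -
    define a where "a = r *\<^sub>R (ub - xb)"
    define a' where "a' k = r *\<^sub>R (u k - x k)" for k
    define d where "d k = y k - x k" for k
    have d0: "((\<lambda>k. ip (d k) (d k)) \<longlongrightarrow> 0) H"
      using tendsto_mono[OF H(1) xy] by (simp add: d_def)
    have wy: "weak_lim y xb H"
      using weak_lim_strong[OF wx d0] by (simp add: d_def)
    have wa: "weak_lim a' a H"
      unfolding a'_def a_def by (intro weak_lim_scaleR weak_lim_diff wu wx)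
    have "weak_lim (\<lambda>k. r *\<^sub>R (2 *\<^sub>R x k - u k - y k)) (r *\<^sub>R (2 *\<^sub>R xb - ub - xb)) H"
      by (intro weak_lim_scaleR weak_lim_diff wu wx wy)
    moreover have "r *\<^sub>R (2 *\<^sub>R xb - ub - xb) = - a"
      by (simp add: a_def algebra_simps scaleR_2)
    ultimately have Bxb: "B xb (- a)"
      \<comment> \<open>Having the limit in the graph of \<open>B\<close> already, the monotonicity
        of \<open>B\<close> can be tested at the limit itself when treating
        \<open>A\<close>.\<close>
      using B_closed[OF By H(2) wy] by simp
    have "A xb a"
    proof (rule A_max)
      fix p g assume Ap: "A p g"
      have bd: "ip (a' k) (a' k) \<le> r\<^sup>2 * (2 * Cu + 2 * Cx)" for k
      proof -
        have "ip (u k - x k) (u k - x k) \<le> 2 * Cu + 2 * Cx"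
          using ip_sum_le[of "u k" "- x k"] Cu[of k] Cx[of k] by (simp add: ip_minus_left ip_minus_right)
        then have "r\<^sup>2 * ip (u k - x k) (u k - x k) \<le> r\<^sup>2 * (2 * Cu + 2 * Cx)"
          by (rule mult_left_mono) simp
        then show ?thesis by (simp add: a'_def ip_scaleR_left ip_scaleR_right power2_eq_square)
      qed
      have dx: "((\<lambda>k. ip (d k) (x k)) \<longlongrightarrow> 0) H" and da: "((\<lambda>k. ip (d k) (a' k)) \<longlongrightarrow> 0) H"
        by (rule strong_tendsto_ip[OF Cx d0] strong_tendsto_ip[OF bd d0])+
      have dc: "((\<lambda>k. ip (d k) w) \<longlongrightarrow> 0) H" for w
        by (rule strong_tendsto_ip[OF _ d0, of "\<lambda>_. w" "ip w w"]) simp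
      \<comment> \<open>Sum of the monotonicity of \<open>A\<close> against \<open>(p, g)\<close>
        and of \<open>B\<close> against \<open>(xb, - a)\<close>. The product
        \<open>ip (x k) (a' k)\<close> of two merely weakly convergent sequences occurs with both
        signs and cancels. Each remaining term is constant, is linear in one such sequence, or
        contains the strongly null \<open>d k\<close>.\<close>
      have nn: "0 \<le> - ip (x k) g - ip (a' k) p + ip p g + ip (x k) a - r * ip (d k) (x k) + ip (d k) a
          - ip (d k) (a' k) - r * ip (d k) (d k) - ip xb a + ip (a' k) xb + r * ip (d k) xb" for k
      proof -
        have "0 \<le> ip (x k - p) (a' k - g)"
          using A_mono[OF Ax[of k] Ap] by (simp add: a'_def)
        moreover have "0 \<le> ip (x k + d k - xb) (a - a' k - r *\<^sub>R d k)"
        proof -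
          have "0 \<le> ip (y k - xb) (r *\<^sub>R (2 *\<^sub>R x k - u k - y k) - - a)"
            by (rule B_mono[OF By Bxb])
          also have "r *\<^sub>R (2 *\<^sub>R x k - u k - y k) - - a = a - a' k - r *\<^sub>R d k"
            by (simp add: a'_def d_def algebra_simps scaleR_2)
          also have "y k - xb = x k + d k - xb" by (simp add: d_def)
          finally show ?thesis .
        qed
        ultimately show ?thesis
          by (simp add: ip_simps ip_commute[of p "a' k"] ip_commute[of xb "a' k"] ip_commute[of xb "d k"]
              ip_commute[of "x k" "d k"] algebra_simps)
      qed
      have lim: "((\<lambda>k. - ip (x k) g - ip (a' k) p + ip p g + ip (x k) a - r * ip (d k) (x k) + ip (d k) a
          - ip (d k) (a' k) - r * ip (d k) (d k) - ip xb a + ip (a' k) xb + r * ip (d k) xb) \<longlongrightarrow>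
          - ip xb g - ip a p + ip p g + ip xb a - r * 0 + 0 - 0 - r * 0 - ip xb a + ip a xb + r * 0) H"
        by (intro tendsto_intros weak_limD[OF wx] weak_limD[OF wa] dx da dc d0)
      have "0 \<le> - ip xb g - ip a p + ip p g + ip xb a - r * 0 + 0 - 0 - r * 0 - ip xb a
          + ip a xb + r * 0"
        by (rule tendsto_lowerbound[OF lim _ H(2)]) (use nn in simp)
      then show "0 \<le> ip (xb - p) (a - g)"
        by (simp add: ip_simps ip_commute[of a])
    qed
    with Bxb show ?thesis by (simp add: fixp_def a_def)
  qed

  have opial: "ip (p - p') (p - p') = 0"
    if p: "fixp p q" and p': "fixp p' q'" and H: "H \<le> sequentially" "H \<noteq> bot" "weak_lim u p H"
      and H': "H' \<le> sequentially" "H' \<noteq> bot" "weak_lim u p' H'" for p p' q q' H H'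
  proof -
    obtain L L' where L: "(\<lambda>k. ip (u k - p) (u k - p)) \<longlonglongrightarrow> L" "(\<lambda>k. ip (u k - p') (u k - p')) \<longlonglongrightarrow> L'"
      using conv[OF p] conv[OF p'] by (auto simp: convergent_def)
    \<comment> \<open>The difference of the two squared distances is affine in \<open>u k\<close>,
      so \<open>ip (u k) (p - p')\<close> converges along the whole sequence. Its limit can be read
      off at either cluster point.\<close>
    define M where "M = (L' - L + ip p p - ip p' p') / 2"
    have "(\<lambda>k. (ip (u k - p') (u k - p') - ip (u k - p) (u k - p) + ip p p - ip p' p') / 2) \<longlonglongrightarrow> M"
      unfolding M_def by (intro tendsto_intros L) simp
    moreover have "(ip (u k - p') (u k - p') - ip (u k - p) (u k - p) + ip p p - ip p' p') / 2 =
        ip (u k) (p - p')" for k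
      by (simp add: ip_simps ip_commute[of p "u k"] ip_commute[of p' "u k"])
    ultimately have M: "(\<lambda>k. ip (u k) (p - p')) \<longlonglongrightarrow> M" by simp
    have "ip p (p - p') = M"
      by (rule tendsto_unique[OF H(2) weak_limD[OF H(3)] tendsto_mono[OF H(1) M]])
    moreover have "ip p' (p - p') = M"
      by (rule tendsto_unique[OF H'(2) weak_limD[OF H'(3)] tendsto_mono[OF H'(1) M]])
    ultimately show ?thesis by (simp add: ip_diff_left)
  qed

  obtain G1 ub where G1: "G1 \<le> sequentially" "G1 \<noteq> bot" "weak_lim u ub G1"
    using weak_cluster[where u = u and C = Cu and G = sequentially] Cu by auto
  obtain G2 xb where G2: "G2 \<le> G1" "G2 \<noteq> bot" "weak_lim x xb G2"
    using weak_cluster[where u = x and C = Cx, OF G1(2) Cx] by metis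
  have fb: "fixp ub xb"
    by (rule demiclosed[OF order_trans[OF G2(1) G1(1)] G2(2) weak_lim_mono[OF G1(3) G2(1)] G2(3)])
  have wu: "weak_lim u ub sequentially"
  proof (rule weak_lim_if_unique_cluster[where C = Cu, OF Cu])
    fix G l' assume G: "G \<le> sequentially" "G \<noteq> bot" "weak_lim u l' G"
    obtain G' x' where G': "G' \<le> G" "G' \<noteq> bot" "weak_lim x x' G'"
      using weak_cluster[where u = x and C = Cx, OF G(2) Cx] by metis
    note wl = weak_lim_mono[OF G(3) G'(1)]
    have "fixp l' x'" by (rule demiclosed[OF order_trans[OF G'(1) G(1)] G'(2) wl G'(3)])
    then have "ip (l' - ub) (l' - ub) = 0"
      by (rule opial[OF _ fb order_trans[OF G'(1) G(1)] G'(2) wl G1])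
    then show "\<exists>G'\<le>G. G' \<noteq> bot \<and> weak_lim u ub G'"
      using G' weak_lim_null_cong[OF wl] by blast
  qed
  moreover have "weak_lim x xb sequentially"
  proof (rule weak_lim_if_unique_cluster[where C = Cx, OF Cx])
    fix G x' assume G: "G \<le> sequentially" "G \<noteq> bot" "weak_lim x x' G"
    \<comment> \<open>Weak convergence of \<open>u\<close> does not pass through the nonlinear
      proximal map. Instead every cluster point of \<open>x\<close> is paired with the same
      \<open>ub\<close>, and monotonicity of \<open>A\<close> makes two such points agree up to a
      null vector.\<close>
    have "fixp ub x'" by (rule demiclosed[OF G(1,2) weak_lim_mono[OF wu G(1)] G(3)])
    then have "0 \<le> ip (x' - xb) (r *\<^sub>R (ub - x') - r *\<^sub>R (ub - xb))"
      using fb A_mono unfolding fixp_def by blast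
    also have "r *\<^sub>R (ub - x') - r *\<^sub>R (ub - xb) = (- r) *\<^sub>R (x' - xb)" by (simp add: algebra_simps)
    finally have "ip (x' - xb) (x' - xb) \<le> 0"
      using r by (simp add: ip_scaleR_right ip_minus_right mult_le_0_iff)
    then have "ip (x' - xb) (x' - xb) = 0" using ip_nonneg[of "x' - xb"] by linarith
    then show "\<exists>G'\<le>G. G' \<noteq> bot \<and> weak_lim x xb G'"
      using G weak_lim_null_cong[OF G(3)] by blast
  qed
  ultimately show ?thesis using fb unfolding fixp_def by blast
qed

lemma ip_eqI: "(\<And>w. ip a w = ip b w) \<Longrightarrow> ip (a - b) (a - b) = 0"
  by (simp add: ip_diff_left)

text \<open>\<open>q\<close> is the smooth part of an objective, and \<open>h\<close> its gradient
  at \<open>p\<close> up to a quadratic error.\<close>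

lemma subgrad_of_argmin:
  assumes "econvex F" "\<bar>F p\<bar> \<noteq> \<infinity>"
    and min: "\<And>y. F p + ereal (q p) \<le> F y + ereal (q y)"
    and q: "\<And>y. q y \<le> q p + ip h (y - p) + K * ip (y - p) (y - p)"
  shows "subgrad F p (- h)"
proof -
  obtain c where c: "F p = ereal c" using assms(2) by auto
  show ?thesis
  proof (rule subgrad_of_min[OF assms(1) c])
    fix y b assume "F y \<le> ereal b"
    then have "F y + ereal (q y) \<le> ereal b + ereal (q y)" by (rule add_right_mono)
    with min[of y] have "ereal c + ereal (q p) \<le> ereal b + ereal (q y)" unfolding c by (rule order_trans)
    then show "c \<le> b + ip h (y - p) + K * ip (y - p) (y - p)"
      using q[of y] by simp
  qed
qed

lemma argmin_of_subgrad:
  assumes sg: "subgrad F p g" and q: "q p \<le> q y + ip g (y - p)"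
  shows "F p + ereal (q p) \<le> F y + ereal (q y)"
proof -
  obtain c where c: "F p = ereal c" using subgrad_finite[OF sg] by auto
  have "F p + ereal (q p) \<le> F p + ereal (ip g (y - p)) + ereal (q y)"
    using q by (simp add: c)
  also have "\<dots> \<le> F y + ereal (q y)"
    by (rule add_right_mono[OF subgrad_le[OF sg]])
  finally show ?thesis .
qed

text \<open>Minty's argument: the proximal point \<open>p\<close> of \<open>q + h\<close> has the
  subgradient \<open>q + h - p\<close>. Comparing it with \<open>(q, h)\<close> gives minus the
  squared distance of \<open>q\<close> and \<open>p\<close> as a nonnegative number. The known
  subgradient \<open>gs\<close> supplies the affine minorant that bounds the proximal objective from
  below.\<close>

lemma subgrad_maximal:
  assumes cv: "econvex F" and lsc: "elsc F" and sol: "subgrad F xs gs"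
    and max: "\<And>p g. subgrad F p g \<Longrightarrow> 0 \<le> ip (q - p) (h - g)"
  shows "subgrad F q h"
proof -
  obtain c where c: "F xs = ereal c" using subgrad_finite[OF sol] by auto
  define v where "v = q + h"
  have "\<exists>p. subgrad F p (v - p)"
  proof (rule prox_exists[OF cv lsc])
    show "F xs \<le> ereal c" by (simp add: c)
    fix y b assume "F y \<le> ereal b"
    then have "ereal c + ereal (ip gs (y - xs)) \<le> ereal b"
      using subgrad_le[OF sol, of y] c by (metis order_trans)
    then have "c + ip gs (y - v) + ip gs (v - xs) \<le> b" by (simp add: ip_simps)
    moreover have "- ip gs gs \<le> 2 * ip gs (y - v) + ip (y - v) (y - v)"
      using ip_nonneg[of "gs + (y - v)"] unfolding ip_add_left[of gs "y - v"] ip_add_right[of _ gs "y - v"]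
      by (simp add: ip_commute[of "y - v" gs])
    ultimately show "c + ip gs (v - xs) - ip gs gs / 2 \<le> b + ip (y - v) (y - v) / 2"
      by linarith
  qed
  then obtain p where p: "subgrad F p (v - p)" by blast
  have "0 \<le> ip (q - p) (h - (v - p))" by (rule max[OF p])
  also have "h - (v - p) = - (q - p)" by (simp add: v_def)
  finally have null: "ip (q - p) (q - p) = 0"
    using ip_nonneg[of "q - p"] unfolding ip_minus_right by linarith
  show ?thesis
  proof (rule subgrad_cong[OF lsc p])
    have "p - q = - (q - p)" "v - p - h = q - p" by (simp_all add: v_def)
    then show "ip (p - q) (p - q) = 0" "ip (v - p - h) (v - p - h) = 0"
      using null by (simp_all only: ip_minus_left ip_minus_right minus_minus)
  qed
qed

end

section \<open>Decoupling along a closed subspace\<close>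

text \<open>A projection chosen by \<open>SOME\<close> is determined only up to null vectors and
  need not be additive. Hence \<open>P\<close> and \<open>E\<close> are described only through their
  inner products; \<open>E_adj\<close> and \<open>E_idem\<close> say that \<open>E\<close> is an
  orthogonal projection in this sense, with range inside \<open>N\<close>.\<close>

locale decoupling = semi_hilbert ip for ip :: "'v::real_vector \<Rightarrow> 'v \<Rightarrow> real" +
  fixes N :: "'v set" and P E :: "'v \<Rightarrow> 'v"
  assumes N_subspace: "subspace N"
    and N_null: "\<And>x y. x \<in> N \<Longrightarrow> ip (x - y) (x - y) = 0 \<Longrightarrow> y \<in> N"
    and P_in: "P x \<in> N" and P_orth: "v \<in> N \<Longrightarrow> ip (x - P x) v = 0"
    and E_in: "E x \<in> N" and E_adj: "ip (E x) y = ip x (E y)"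
    and E_idem: "ip (E x) (E y) = ip x (E y)"
begin

definition perp :: "'v \<Rightarrow> bool" where "perp x \<longleftrightarrow> (\<forall>v\<in>N. ip x v = 0)"

lemma perpD: "perp x \<Longrightarrow> v \<in> N \<Longrightarrow> ip x v = 0"
  by (simp add: perp_def)

lemma perp_diff_P: "perp (x - P x)"
  by (simp add: perp_def P_orth)

lemma ip_P_N: "v \<in> N \<Longrightarrow> ip (P x) v = ip x v"
  using P_orth[of v x] by (simp add: ip_diff_left)

lemma P_adj: "ip (P x) y = ip x (P y)"
  using ip_P_N[OF P_in[of y], of x] ip_P_N[OF P_in[of x], of y] by (simp add: ip_commute)

lemma ip_PP: "ip x (P (P y)) = ip x (P y)"
  by (metis P_adj P_in ip_P_N)

lemma ip_PE: "ip x (P (E y)) = ip x (E y)"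
  by (metis P_adj E_in ip_P_N)

lemma ip_EP: "ip x (E (P y)) = ip x (E y)"
  by (metis P_adj E_adj ip_PE ip_commute)

lemma ip_EE: "ip x (E (E y)) = ip x (E y)"
  by (metis E_adj E_idem)

lemma ip_E_commute: "ip x (E y) = ip y (E x)"
  by (metis E_adj ip_commute)

lemma ip_E_diff: "ip x (E (y - z)) = ip x (E y) - ip x (E z)"
  by (simp add: ip_E_commute[of x] ip_diff_left)

lemma ip_N_P: "v \<in> N \<Longrightarrow> ip v (P y) = ip v y"
  by (metis ip_P_N ip_commute)

lemma ip_P_right_N: "v \<in> N \<Longrightarrow> ip x (P v) = ip x v"
  by (metis ip_P_N P_adj)

lemmas op_simps = P_adj E_adj ip_PP ip_PE ip_EP ip_EE

text \<open>Testing \<open>x\<close> against \<open>x - P x\<close> shows that this difference is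
  null. As orthogonality is a weakly closed condition, this makes \<open>N\<close> weakly
  closed.\<close>

lemma N_bipolar:
  assumes "\<And>v. perp v \<Longrightarrow> ip x v = 0"
  shows "x \<in> N"
proof (rule N_null[OF P_in[of x]])
  have "ip x (x - P x) = 0" by (rule assms[OF perp_diff_P])
  moreover have "ip (P x) (x - P x) = 0" using P_orth[OF P_in[of x], of x] ip_commute by metis
  ultimately show "ip (P x - x) (P x - x) = 0"
    by (simp add: ip_simps ip_commute)
qed

lemma ip_E_le: "0 \<le> ip d d - ip d (E d)" and ip_diff_E: "ip (d - E d) (d - E d) = ip d d - ip d (E d)"
proof -
  show "ip (d - E d) (d - E d) = ip d d - ip d (E d)"
    by (simp add: ip_simps E_adj ip_EE)
  then show "0 \<le> ip d d - ip d (E d)" using ip_nonneg[of "d - E d"] by simp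
qed

lemma ip_E_self_nonneg: "0 \<le> ip d (E d)"
  using ip_nonneg[of "E d"] by (simp add: op_simps)

text \<open>The graph of the subdifferential of \<open>\<alpha>/2 \<parallel>q - E q\<parallel>\<^sup>2 + i\<^sub>N q\<close>.\<close>

definition G :: "real \<Rightarrow> 'v \<Rightarrow> 'v \<Rightarrow> bool" where
  "G \<alpha> q b \<longleftrightarrow> q \<in> N \<and> perp (b - \<alpha> *\<^sub>R (q - E q))"

text \<open>Parts normal to \<open>N\<close> vanish against differences in \<open>N\<close>, which
  leaves \<alpha> times the squared seminorm of \<open>d - E d\<close>.\<close>

lemma G_monotone:
  assumes "\<alpha> \<ge> 0" "G \<alpha> p b" "G \<alpha> q c"
  shows "0 \<le> ip (p - q) (b - c)"
proof -
  define d where "d = p - q"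
  have dN: "d \<in> N" using assms N_subspace by (simp add: G_def d_def subspace_diff)
  have "ip (b - \<alpha> *\<^sub>R (p - E p)) d = 0" "ip (c - \<alpha> *\<^sub>R (q - E q)) d = 0"
    using assms perpD[OF _ dN] by (simp_all add: G_def)
  then have "ip (b - c) d = \<alpha> * (ip d d - ip d (E d))"
    using ip_E_commute[of q p] ip_commute[of q p]
    unfolding d_def by (simp add: ip_simps ip_E_diff op_simps algebra_simps)
  then show ?thesis
    using mult_nonneg_nonneg[OF assms(1) ip_E_le[of d]] ip_commute[of "b - c" d] by (simp add: d_def)
qed

text \<open>The graph is cut out by linear equations: \<open>q\<close> against vectors orthogonal to
  \<open>N\<close>, and the pair against vectors of \<open>N\<close>. Such equations survive weak
  limits.\<close>

lemma G_closed:
  assumes G: "\<And>k. G \<alpha> (Y k) (Z k)" and H: "H \<noteq> bot" and Y: "weak_lim Y q H" and Z: "weak_lim Z c H"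
  shows "G \<alpha> q c"
  unfolding G_def perp_def
proof (intro conjI ballI)
  show "q \<in> N"
  proof (rule N_bipolar)
    fix v assume v: "perp v"
    have "ip (Y k) v = 0" for k
      using perpD[OF v, of "Y k"] G by (simp add: G_def ip_commute)
    then have "((\<lambda>k. 0) \<longlongrightarrow> ip q v) H" using weak_limD[OF Y, of v] by simp
    then show "ip q v = 0" using tendsto_unique[OF H _ tendsto_const] by blast
  qed
  fix w assume w: "w \<in> N"
  have "ip (Z k) w - \<alpha> * (ip (Y k) w - ip (Y k) (E w)) = 0" for k
    using G[of k] perpD[of "Z k - \<alpha> *\<^sub>R (Y k - E (Y k))", OF _ w]
    by (simp add: G_def ip_simps op_simps)
  moreover have "((\<lambda>k. ip (Z k) w - \<alpha> * (ip (Y k) w - ip (Y k) (E w))) \<longlongrightarrow>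
      ip c w - \<alpha> * (ip q w - ip q (E w))) H"
    by (intro tendsto_intros weak_limD Y Z)
  ultimately have "((\<lambda>k. 0) \<longlongrightarrow> ip c w - \<alpha> * (ip q w - ip q (E w))) H" by simp
  then have "ip c w - \<alpha> * (ip q w - ip q (E w)) = 0" using tendsto_unique[OF H _ tendsto_const] by blast
  then show "ip (c - \<alpha> *\<^sub>R (q - E q)) w = 0" by (simp add: ip_simps op_simps)
qed

text \<open>All optimality conditions appear as subgradients, so this part is free of minimisation
  problems. The vector \<open>n\<close> is a multiplier certifying that \<open>xb\<close> solves the
  constrained problem.\<close>

theorem decoupling_converges:
  fixes x lam z :: "nat \<Rightarrow> 'v"
  assumes r: "r > 0" and \<alpha>: "\<alpha> \<ge> 0" and cv: "econvex F" and lsc: "elsc F"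
    and sol: "xs \<in> N" "perp ls" "subgrad F xs (- (\<alpha> *\<^sub>R (xs - E xs) + ls))"
    and lam0: "perp (lam 0)"
    and x: "\<And>k. subgrad F (x k) (- (lam k + r *\<^sub>R (x k - P (z k))))"
    and lam: "\<And>k w. ip (lam (Suc k)) w = ip (lam k + r *\<^sub>R (x k - P (x k))) w"
    and z: "\<And>k w. ip (z (Suc k)) w = ip (z k - x k + (1 / (r + \<alpha>)) *\<^sub>R
      (\<alpha> *\<^sub>R E (2 *\<^sub>R x k - z k) + r *\<^sub>R P (2 *\<^sub>R x k - z k))) w"
  shows "\<exists>xb lb zb n. weak_lim x xb sequentially \<and> weak_lim lam lb sequentially \<and>
    weak_lim z zb sequentially \<and> xb \<in> N \<and>
    subgrad F xb (- (lb + r *\<^sub>R (xb - P zb))) \<and>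
    (\<forall>w. ip zb w = ip (zb - xb + (1 / (r + \<alpha>)) *\<^sub>R
      (\<alpha> *\<^sub>R E (2 *\<^sub>R xb - zb) + r *\<^sub>R P (2 *\<^sub>R xb - zb))) w) \<and>
    perp n \<and> subgrad F xb (- (\<alpha> *\<^sub>R (xb - E xb) + n))"
proof -
  have ra: "r + \<alpha> > 0" using r \<alpha> by simp
  have lamN: "perp (lam k)" for k
  proof (induction k)
    case (Suc k)
    then show ?case using perp_diff_P[of "x k"] by (simp add: perp_def lam ip_simps)
  qed (rule lam0)
  have lamP: "ip (lam k) (P w) = 0" "ip (lam k) (E w) = 0" for k w
    using lamN perpD P_in E_in by blast+
  define u where "u k = P (z k) - (1 / r) *\<^sub>R lam k" for k
  \<comment> \<open>With w = 2 x - z, a point q of \<open>N\<close> is the proximal point if r (w -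
    q) - \<alpha> (q - E q) is orthogonal to \<open>N\<close>. Up to null vectors this reads (r +
    \<alpha>) q = r P w + \<alpha> E q, and applying \<open>E\<close> gives E q = E w.\<close>
  define y where "y k = (1 / (r + \<alpha>)) *\<^sub>R
      (\<alpha> *\<^sub>R E (2 *\<^sub>R x k - z k) + r *\<^sub>R P (2 *\<^sub>R x k - z k))" for k
  have yN: "y k \<in> N" for k
    unfolding y_def using N_subspace P_in E_in by (simp add: subspace_add subspace_scale)
  have ip_u: "ip (u k) w = ip (z k) (P w) - ip (lam k) w / r" for k w
    by (simp add: u_def ip_simps op_simps)
  have ip_y: "(r + \<alpha>) * ip (y k) w = \<alpha> * (2 * ip (x k) (E w) - ip (z k) (E w)) +
      r * (2 * ip (x k) (P w) - ip (z k) (P w))" for k w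
    using ra by (simp add: y_def ip_simps op_simps)
  \<comment> \<open>Testing with \<open>E w\<close> merges both terms, since \<open>E\<close>
    absorbs \<open>P\<close>, and the factor \<open>r + \<alpha>\<close> cancels.\<close>
  have ip_y_E: "ip (y k) (E w) = 2 * ip (x k) (E w) - ip (z k) (E w)" for k w
    using ip_y[of k "E w"] ra unfolding op_simps distrib_right[symmetric]
    by (simp add: add.commute)
  have "\<exists>ub xb. weak_lim u ub sequentially \<and> weak_lim x xb sequentially \<and>
    subgrad F xb (r *\<^sub>R (ub - xb)) \<and> G \<alpha> xb (- (r *\<^sub>R (ub - xb)))"
  proof (rule douglas_rachford[OF r, where A = "subgrad F" and B = "G \<alpha>" and y = y])
    show "subgrad F xs (- (\<alpha> *\<^sub>R (xs - E xs) + ls))" by (rule sol)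
    show "G \<alpha> xs (- (- (\<alpha> *\<^sub>R (xs - E xs) + ls)))" using sol by (simp add: G_def)
    show "subgrad F (x k) (r *\<^sub>R (u k - x k))" for k
      using x[of k] r by (simp add: u_def algebra_simps)
    show "G \<alpha> (y k) (r *\<^sub>R (2 *\<^sub>R x k - u k - y k))" for k
      unfolding G_def perp_def
    proof (intro conjI ballI yN)
      fix v assume v: "v \<in> N"
      show "ip (r *\<^sub>R (2 *\<^sub>R x k - u k - y k) - \<alpha> *\<^sub>R (y k - E (y k))) v = 0"
        using ip_y[of k v] arg_cong[OF ip_y_E[of k v], of "\<lambda>t. \<alpha> * t"] perpD[OF lamN v] r
        by (simp add: ip_simps E_adj ip_u ip_P_right_N[OF v] algebra_simps)
    qed
    show "ip (u (Suc k) - (u k - x k + y k)) (u (Suc k) - (u k - x k + y k)) = 0" for k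
    proof (rule ip_eqI)
      fix w
      have "ip (z (Suc k)) (P w) = ip (z k) (P w) - ip (x k) (P w) + ip (y k) w"
        using ip_N_P[OF yN[of k], of w] unfolding z y_def[symmetric] by (simp add: ip_simps)
      moreover have "ip (lam (Suc k)) w / r = ip (lam k) w / r + (ip (x k) w - ip (x k) (P w))"
        using r unfolding lam by (simp add: ip_simps op_simps field_simps)
      ultimately show "ip (u (Suc k)) w = ip (u k - x k + y k) w"
        by (simp add: ip_u ip_simps)
    qed
  qed (use subgrad_monotone subgrad_maximal[OF cv lsc sol(3)] G_monotone[OF \<alpha>] G_closed in blast)+
  then obtain ub xb where wu: "weak_lim u ub sequentially" and wx: "weak_lim x xb sequentially"
    and Fb: "subgrad F xb (r *\<^sub>R (ub - xb))" and Gb: "G \<alpha> xb (- (r *\<^sub>R (ub - xb)))" by blast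
  have xbN: "xb \<in> N" using Gb by (simp add: G_def)

  \<comment> \<open>The component of \<open>z k - u k\<close> is conserved: in each step the part of
    \<open>z\<close> orthogonal to \<open>N\<close> loses \<open>x k - P (x k)\<close>, and
    \<open>(1 / r) *\<^sub>R lam k\<close> gains it.\<close>
  define d where "d = z 0 - P (z 0) + (1 / r) *\<^sub>R lam 0"
  define lb where "lb = (- r) *\<^sub>R (ub - P ub)"
  define zb where "zb = ub + d"
  have dN: "perp d"
    using perp_diff_P[of "z 0"] lam0 by (simp add: d_def perp_def ip_simps)
  have dP: "ip d (P w) = 0" "ip d (E w) = 0" for w
    using dN perpD P_in E_in by blast+
  have ip_lam: "ip (lam k) w = - r * (ip (u k) w - ip (u k) (P w))" for k w
    using r by (simp add: ip_u ip_PP lamP)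
  have wl: "weak_lim lam lb sequentially"
    unfolding weak_lim_def
  proof
    fix w
    have "(\<lambda>k. - r * (ip (u k) w - ip (u k) (P w))) \<longlonglongrightarrow> - r * (ip ub w - ip ub (P w))"
      by (intro tendsto_intros weak_limD[OF wu])
    then show "(\<lambda>k. ip (lam k) w) \<longlonglongrightarrow> ip lb w"
      by (simp add: ip_lam lb_def ip_simps op_simps)
  qed
  have ip_z: "ip (z k) w = ip (u k) w + ip d w" for k w
  proof -
    have "ip (z k) w - ip (z k) (P w) + ip (lam k) w / r = ip d w"
    proof (induction k)
      case 0
      show ?case by (simp add: d_def ip_simps op_simps)
    next
      case (Suc k)
      have "ip (z (Suc k)) w - ip (z (Suc k)) (P w) =
          (ip (z k) w - ip (z k) (P w)) - (ip (x k) w - ip (x k) (P w))"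
        using ip_N_P[OF yN[of k], of w] unfolding z y_def[symmetric] by (simp add: ip_simps)
      moreover have "ip (lam (Suc k)) w / r = ip (lam k) w / r + (ip (x k) w - ip (x k) (P w))"
        using r unfolding lam by (simp add: ip_simps op_simps field_simps)
      ultimately show ?case using Suc by simp
    qed
    then show ?thesis by (simp add: ip_u)
  qed
  have wz: "weak_lim z zb sequentially"
    unfolding weak_lim_def zb_def ip_z ip_add_left
    by (intro allI tendsto_intros weak_limD[OF wu])

  have Fb': "subgrad F xb (- (lb + r *\<^sub>R (xb - P zb)))"
  proof (rule subgrad_cong[OF lsc Fb])
    show "ip (xb - xb) (xb - xb) = 0" by simp
    show "ip (r *\<^sub>R (ub - xb) - - (lb + r *\<^sub>R (xb - P zb))) (r *\<^sub>R (ub - xb) - - (lb + r *\<^sub>R (xb - P zb))) = 0"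
      by (rule ip_eqI) (simp add: lb_def zb_def ip_simps op_simps dP algebra_simps)
  qed
  have Gv: "r * (ip xb v - ip ub v) = \<alpha> * (ip xb v - ip xb (E v))" if "v \<in> N" for v
  proof -
    have "ip (- (r *\<^sub>R (ub - xb)) - \<alpha> *\<^sub>R (xb - E xb)) v = 0"
      using Gb perpD[OF _ that] unfolding G_def by blast
    then show ?thesis by (simp add: ip_simps op_simps algebra_simps)
  qed
  have zfix: "ip zb w = ip (zb - xb + (1 / (r + \<alpha>)) *\<^sub>R
      (\<alpha> *\<^sub>R E (2 *\<^sub>R xb - zb) + r *\<^sub>R P (2 *\<^sub>R xb - zb))) w" for w
  proof -
    have "r * (ip xb (E w) - ip ub (E w)) = 0"
      using Gv[OF E_in[of w]] by (simp add: ip_EE)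
    then have 1: "ip ub (E w) = ip xb (E w)" using r by simp
    have 2: "r * (ip xb w - ip ub (P w)) = \<alpha> * (ip xb w - ip xb (E w))"
      using Gv[OF P_in[of w]] by (simp add: ip_EP ip_N_P[OF xbN])
    have "(r + \<alpha>) * ip xb w = \<alpha> * (2 * ip xb (E w) - ip zb (E w)) + r * (2 * ip xb (P w) - ip zb (P w))"
      using 2 by (simp add: zb_def ip_simps dP 1 ip_N_P[OF xbN] algebra_simps)
    then have "ip xb w = (\<alpha> * (2 * ip xb (E w) - ip zb (E w)) + r * (2 * ip xb (P w) - ip zb (P w))) / (r + \<alpha>)"
      using ra by (simp add: field_simps)
    then show ?thesis by (simp add: ip_simps op_simps)
  qed
  \<comment> \<open>The normal component of the second subgradient at the limit; up to a null vector
    it coincides with \<open>lb\<close>.\<close>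
  define n where "n = - (r *\<^sub>R (ub - xb)) - \<alpha> *\<^sub>R (xb - E xb)"
  have "perp n" using Gb by (simp add: G_def n_def)
  moreover have "subgrad F xb (- (\<alpha> *\<^sub>R (xb - E xb) + n))" using Fb by (simp add: n_def)
  ultimately show ?thesis using wx wl wz xbN Fb' zfix by blast
qed

end

section \<open>Square-integrable random processes\<close>

text \<open>Pointwise scaling makes the type of processes an instance of the class on which
  \<open>semi_hilbert\<close> is built.\<close>

instantiation "fun" :: (type, real_vector) real_vector
begin

definition scaleR_fun_def: "scaleR c f = (\<lambda>x. c *\<^sub>R f x)"

instance
  by standard (simp_all add: scaleR_fun_def fun_eq_iff scaleR_add_right scaleR_add_left)

end

section \<open>Completeness of square-integrable functions\<close>

lemma norm_sq_diff_le: "(norm (a - b))\<^sup>2 \<le> 2 * (norm a)\<^sup>2 + 2 * (norm b)\<^sup>2"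
  for a b :: "'b::real_inner"
  using inner_ge_zero[of "a + b"]
  by (simp add: power2_norm_eq_inner inner_add_left inner_add_right inner_diff_left inner_diff_right inner_commute)

lemma integrable_norm_sq_diff:
  fixes u v :: "'a \<Rightarrow> 'b::euclidean_space"
  assumes [measurable]: "u \<in> borel_measurable N" "v \<in> borel_measurable N"
    and "integrable N (\<lambda>t. (norm (u t))\<^sup>2)" "integrable N (\<lambda>t. (norm (v t))\<^sup>2)"
  shows "integrable N (\<lambda>t. (norm (u t - v t))\<^sup>2)"
proof (rule Bochner_Integration.integrable_bound)
  show "integrable N (\<lambda>t. 2 * (norm (u t))\<^sup>2 + 2 * (norm (v t))\<^sup>2)" using assms by simp
  show "AE t in N. norm ((norm (u t - v t))\<^sup>2) \<le> norm (2 * (norm (u t))\<^sup>2 + 2 * (norm (v t))\<^sup>2)"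
    by (intro always_eventually allI) (simp add: norm_sq_diff_le)
qed measurable

lemma convergent_if_summable_diff:
  fixes f :: "nat \<Rightarrow> 'b::real_normed_vector"
  assumes "summable (\<lambda>k. f (Suc k) - f k)"
  shows "convergent f"
proof -
  have "convergent (\<lambda>n. \<Sum>k<n. f (Suc k) - f k)"
    using assms by (simp add: summable_iff_convergent)
  then have "convergent (\<lambda>n. f n - f 0)" by (simp add: sum_lessThan_telescope)
  then obtain L where "(\<lambda>n. f n - f 0) \<longlonglongrightarrow> L" by (auto simp: convergent_def)
  from tendsto_add[OF this tendsto_const[of "f 0"]] show ?thesis by (auto simp: convergent_def)
qed

text \<open>Riesz--Fischer without Minkowski's inequality. Along a subsequence with squared gaps
  below \<open>(1/4) ^ k\<close>, the weights \<open>2 ^ k\<close> still leave a summable series of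
  integrals. Hence the weighted squares are summable almost everywhere, which forces absolute
  summability of the increments. Fatou's lemma then gives convergence in mean square.\<close>

theorem square_integrable_complete:
  fixes u :: "nat \<Rightarrow> 'a \<Rightarrow> 'b::euclidean_space"
  assumes meas [measurable]: "\<And>n. u n \<in> borel_measurable N"
    and int: "\<And>n. integrable N (\<lambda>t. (norm (u n t))\<^sup>2)"
    and cauchy: "\<And>e. e > 0 \<Longrightarrow> \<exists>K. \<forall>m\<ge>K. \<forall>n\<ge>K. (LINT t|N. (norm (u m t - u n t))\<^sup>2) < e"
  shows "\<exists>v\<in>borel_measurable N. integrable N (\<lambda>t. (norm (v t))\<^sup>2) \<and>
    (\<lambda>n. LINT t|N. (norm (u n t - v t))\<^sup>2) \<longlonglongrightarrow> 0"
proof -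
  have intd: "integrable N (\<lambda>t. (norm (u m t - u n t))\<^sup>2)" for m n
    by (rule integrable_norm_sq_diff) (use int in auto)
  have "\<exists>K>n. \<forall>i\<ge>K. \<forall>j\<ge>K. (LINT t|N. (norm (u i t - u j t))\<^sup>2) < (1/4) ^ k" for k n :: nat
  proof -
    obtain K where "\<forall>i\<ge>K. \<forall>j\<ge>K. (LINT t|N. (norm (u i t - u j t))\<^sup>2) < (1/4) ^ k"
      using cauchy[of "(1/4) ^ k"] by auto
    then show ?thesis by (intro exI[of _ "max K (Suc n)"]) auto
  qed
  then have "\<exists>r. \<forall>k. (\<forall>i\<ge>r k. \<forall>j\<ge>r k. (LINT t|N. (norm (u i t - u j t))\<^sup>2) < (1/4) ^ k) \<and> r k < r (Suc k)"
    by (intro dependent_nat_choice) (blast, metis)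
  then obtain r where r: "\<And>k i j. r k \<le> i \<Longrightarrow> r k \<le> j \<Longrightarrow> (LINT t|N. (norm (u i t - u j t))\<^sup>2) < (1/4) ^ k"
    and r_Suc: "\<And>k. r k < r (Suc k)" by blast
  define d where "d k t = u (r (Suc k)) t - u (r k) t" for k t
  have dm [measurable]: "d k \<in> borel_measurable N" for k unfolding d_def[abs_def] by measurable
  have dint: "integrable N (\<lambda>t. 2 ^ k * (norm (d k t))\<^sup>2)" for k
    unfolding d_def by (intro integrable_mult_right intd)
  have dle: "(LINT t|N. 2 ^ k * (norm (d k t))\<^sup>2) \<le> (1/2) ^ k" for k
  proof -
    have "(LINT t|N. (norm (d k t))\<^sup>2) \<le> (1/4) ^ k"
      unfolding d_def using r[of k "r (Suc k)" "r k"] r_Suc[of k] by simp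
    then have "2 ^ k * (LINT t|N. (norm (d k t))\<^sup>2) \<le> 2 ^ k * (1/4) ^ k"
      by (rule mult_left_mono) simp
    also have "\<dots> = (1/2) ^ k" by (simp add: power_mult_distrib[symmetric])
    finally show ?thesis by simp
  qed
  have "(\<integral>\<^sup>+t. (\<Sum>k. ennreal (2 ^ k * (norm (d k t))\<^sup>2)) \<partial>N) = (\<Sum>k. \<integral>\<^sup>+t. ennreal (2 ^ k * (norm (d k t))\<^sup>2) \<partial>N)"
    by (rule nn_integral_suminf) measurable
  also have "\<dots> = (\<Sum>k. ennreal (LINT t|N. 2 ^ k * (norm (d k t))\<^sup>2))"
    by (intro suminf_cong nn_integral_eq_integral dint) simp
  also have "\<dots> \<le> (\<Sum>k. ennreal ((1/2) ^ k))"
    by (intro suminf_le ennreal_leI dle) simp_all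
  also have "\<dots> = ennreal (\<Sum>k. (1/2) ^ k)"
    by (rule suminf_ennreal_eq) (auto intro: summable_sums summable_geometric)
  also have "\<dots> < \<infinity>" by simp
  finally have "AE t in N. (\<Sum>k. ennreal (2 ^ k * (norm (d k t))\<^sup>2)) \<noteq> \<infinity>"
    by (intro nn_integral_PInf_AE) (auto)
  then have conv: "AE t in N. (\<lambda>k. u (r k) t) \<longlonglongrightarrow> lim (\<lambda>k. u (r k) t)"
  proof eventually_elim
    case (elim t)
    then have s1: "summable (\<lambda>k. 2 ^ k * (norm (d k t))\<^sup>2)"
      by (intro summable_suminf_not_top) auto
    have "summable (\<lambda>k. norm (d k t))"
    proof (rule summable_comparison_test')
      show "summable (\<lambda>k. 2 ^ k * (norm (d k t))\<^sup>2 + (1/2) ^ k)"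
        by (intro summable_add s1 summable_geometric) simp
      fix k :: nat
      \<comment> \<open>The weight and its reciprocal balance: twice the norm is at most the
        weighted square plus a geometric term.\<close>
      have "0 \<le> 2 ^ k * (norm (d k t) - (1/2) ^ k)\<^sup>2" by simp
      also have "\<dots> = 2 ^ k * (norm (d k t))\<^sup>2 - 2 * norm (d k t) + (1/2) ^ k"
        by (simp add: power2_eq_square algebra_simps power_one_over)
      finally show "norm (norm (d k t)) \<le> 2 ^ k * (norm (d k t))\<^sup>2 + (1/2) ^ k"
        using norm_ge_zero[of "d k t"] unfolding real_norm_def abs_norm_cancel by linarith
    qed
    then have "summable (\<lambda>k. d k t)" by (rule summable_norm_cancel)
    then have "convergent (\<lambda>k. u (r k) t)"
      unfolding d_def by (rule convergent_if_summable_diff)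
    then show ?case by (simp add: convergent_LIMSEQ_iff)
  qed
  define v where "v t = lim (\<lambda>k. u (r k) t)" for t
  have vm [measurable]: "v \<in> borel_measurable N"
    unfolding v_def[abs_def] by (rule borel_measurable_lim_metric) simp
  have rk: "k \<le> r k" for k
    using r_Suc by (simp add: strict_mono_Suc_iff seq_suble)
  \<comment> \<open>This single bound gives both the integrability of the squared error and its rate
    of decay.\<close>
  have fatou: "(\<integral>\<^sup>+t. ennreal ((norm (u n t - v t))\<^sup>2) \<partial>N) \<le> ennreal ((1/4) ^ K)" if n: "r K \<le> n" for n K
  proof -
    have "(\<integral>\<^sup>+t. ennreal ((norm (u n t - v t))\<^sup>2) \<partial>N) =
        (\<integral>\<^sup>+t. liminf (\<lambda>k. ennreal ((norm (u n t - u (r k) t))\<^sup>2)) \<partial>N)"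
    proof (rule nn_integral_cong_AE)
      show "AE t in N. ennreal ((norm (u n t - v t))\<^sup>2) = liminf (\<lambda>k. ennreal ((norm (u n t - u (r k) t))\<^sup>2))"
        using conv
      proof eventually_elim
        case (elim t)
        then have "(\<lambda>k. ennreal ((norm (u n t - u (r k) t))\<^sup>2)) \<longlonglongrightarrow> ennreal ((norm (u n t - v t))\<^sup>2)"
          unfolding v_def by (intro tendsto_intros tendsto_ennrealI)
        then show ?case by (rule lim_imp_Liminf[symmetric, OF sequentially_bot])
      qed
    qed
    also have "\<dots> \<le> liminf (\<lambda>k. \<integral>\<^sup>+t. ennreal ((norm (u n t - u (r k) t))\<^sup>2) \<partial>N)"
      by (rule nn_integral_liminf) measurable
    also have "\<dots> = liminf (\<lambda>k. ennreal (LINT t|N. (norm (u n t - u (r k) t))\<^sup>2))"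
      by (simp add: nn_integral_eq_integral intd)
    also have "\<dots> \<le> liminf (\<lambda>k::nat. ennreal ((1/4) ^ K))"
    proof (rule Liminf_mono)
      show "\<forall>\<^sub>F k in sequentially. ennreal (LINT t|N. (norm (u n t - u (r k) t))\<^sup>2) \<le> ennreal ((1/4) ^ K)"
        using eventually_ge_at_top[of "r K"]
      proof eventually_elim
        case (elim k)
        then show ?case using r[of K n "r k"] n rk[of k] by (intro ennreal_leI) simp
      qed
    qed
    finally show ?thesis by (simp add: Liminf_const)
  qed
  have intv: "integrable N (\<lambda>t. (norm (u n t - v t))\<^sup>2)" if "r K \<le> n" for n K
    by (rule integrableI_bounded) (use fatou[OF that] in \<open>auto simp: le_less_trans[OF _ ennreal_less_top]\<close>)
  have lev: "(LINT t|N. (norm (u n t - v t))\<^sup>2) \<le> (1/4) ^ K" if "r K \<le> n" for n K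
    using fatou[OF that] nn_integral_eq_integral[OF intv[OF that]] by simp
  have "integrable N (\<lambda>t. (norm (u (r 0) t - (u (r 0) t - v t)))\<^sup>2)"
    by (rule integrable_norm_sq_diff) (use int intv[of 0 "r 0"] in auto)
  then have "integrable N (\<lambda>t. (norm (v t))\<^sup>2)" by simp
  moreover have "(\<lambda>n. LINT t|N. (norm (u n t - v t))\<^sup>2) \<longlonglongrightarrow> 0"
  proof (rule LIMSEQ_I)
    fix e :: real assume "e > 0"
    then obtain K where K: "(1/4) ^ K < e" using real_arch_pow_inv[of e "1/4"] by auto
    show "\<exists>no. \<forall>n\<ge>no. norm ((LINT t|N. (norm (u n t - v t))\<^sup>2) - 0) < e"
    proof (intro exI allI impI)
      fix n assume "r K \<le> n"
      from lev[OF this] K show "norm ((LINT t|N. (norm (u n t - v t))\<^sup>2) - 0) < e"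
        by (simp add: integral_nonneg_AE)
    qed
  qed
  ultimately show ?thesis using vm by blast
qed

lemma L2_measurable: "u \<in> L2 T \<Longrightarrow> u \<in> borel_measurable (lebesgue_on {0..T})"
  and L2_integrable: "u \<in> L2 T \<Longrightarrow> integrable (lebesgue_on {0..T}) (\<lambda>t. (norm (u t))\<^sup>2)"
  by (simp_all add: L2_def)

lemma L2_zero: "(\<lambda>_. 0) \<in> L2 T"
  by (simp add: L2_def)

lemma L2_diff:
  assumes "u \<in> L2 T" "v \<in> L2 T"
  shows "(\<lambda>t. u t - v t) \<in> L2 T"
  using assms integrable_norm_sq_diff[of u _ v] by (auto simp: L2_def)

lemma L2_scaleR: "u \<in> L2 T \<Longrightarrow> (\<lambda>t. c *\<^sub>R u t) \<in> L2 T"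
  by (auto simp: L2_def power_mult_distrib)

lemma L2_add:
  assumes "u \<in> L2 T" "v \<in> L2 T"
  shows "(\<lambda>t. u t + v t) \<in> L2 T"
  using L2_diff[OF assms(1) L2_scaleR[OF assms(2), of "-1"]] by simp

lemma L2_inner_integrable:
  assumes "u \<in> L2 T" "v \<in> L2 T"
  shows "integrable (lebesgue_on {0..T}) (\<lambda>t. u t \<bullet> v t)"
proof (rule Bochner_Integration.integrable_bound)
  note [measurable] = L2_measurable[OF assms(1)] L2_measurable[OF assms(2)]
  show "integrable (lebesgue_on {0..T}) (\<lambda>t. (norm (u t))\<^sup>2 + (norm (v t))\<^sup>2)"
    using assms by (simp add: L2_integrable)
  have "\<bar>a \<bullet> b\<bar> \<le> (norm a)\<^sup>2 + (norm b)\<^sup>2" for a b :: "real^'n"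
    using Cauchy_Schwarz_ineq2[of a b] zero_le_power2[of "norm a - norm b"]
      zero_le_power2[of "norm a"] zero_le_power2[of "norm b"]
    unfolding power2_diff by linarith
  then show "AE t in lebesgue_on {0..T}. norm (u t \<bullet> v t) \<le> norm ((norm (u t))\<^sup>2 + (norm (v t))\<^sup>2)"
    by (intro always_eventually allI) simp
  show "(\<lambda>t. u t \<bullet> v t) \<in> borel_measurable (lebesgue_on {0..T})" by measurable
qed

lemma L2_inner_commute: "L2_inner T u v = L2_inner T v u"
  by (simp add: L2_inner_def inner_commute)

lemma L2_inner_add_left:
  "u \<in> L2 T \<Longrightarrow> v \<in> L2 T \<Longrightarrow> w \<in> L2 T \<Longrightarrow>
    L2_inner T (\<lambda>t. u t + v t) w = L2_inner T u w + L2_inner T v w"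
  by (simp add: L2_inner_def inner_add_left L2_inner_integrable)

lemma L2_inner_scaleR_left: "L2_inner T (\<lambda>t. c *\<^sub>R u t) w = c * L2_inner T u w"
  by (simp add: L2_inner_def)

lemma L2_inner_self: "L2_inner T u u = (LINT t|lebesgue_on {0..T}. (norm (u t))\<^sup>2)"
  by (simp add: L2_inner_def power2_norm_eq_inner)

lemma L2_inner_nonneg: "0 \<le> L2_inner T u u"
  by (simp add: L2_inner_self integral_nonneg_AE)

lemma L2_norm_sq: "(L2_norm T u)\<^sup>2 = L2_inner T u u"
  by (simp add: L2_norm_def L2_inner_nonneg)

lemma L2_inner_self_eq_0:
  assumes "u \<in> L2 T"
  shows "L2_inner T u u = 0 \<longleftrightarrow> (AE t in lebesgue_on {0..T}. u t = 0)"
  using integral_nonneg_eq_0_iff_AE[OF L2_integrable[OF assms]] by (simp add: L2_inner_self)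

lemma L2_complete:
  fixes u :: "nat \<Rightarrow> real \<Rightarrow> real^'n"
  assumes "\<And>n. u n \<in> L2 T"
    and "\<And>e. e > 0 \<Longrightarrow> \<exists>K. \<forall>m\<ge>K. \<forall>n\<ge>K. L2_inner T (\<lambda>t. u m t - u n t) (\<lambda>t. u m t - u n t) < e"
  shows "\<exists>v\<in>L2 T. (\<lambda>n. L2_inner T (\<lambda>t. u n t - v t) (\<lambda>t. u n t - v t)) \<longlonglongrightarrow> 0"
  using square_integrable_complete[of u "lebesgue_on {0..T}"] assms
  unfolding L2_inner_self L2_def by auto

lemma borel_measurable_vec:
  fixes h :: "'a \<Rightarrow> real^'n"
  shows "h \<in> borel_measurable F \<longleftrightarrow> (\<forall>i. (\<lambda>s. h s $ i) \<in> borel_measurable F)"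
  by (subst borel_measurable_euclidean_space) (auto simp: Basis_vec_def inner_axis)

section \<open>Random processes over finitely many scenarios\<close>

locale finite_scenarios =
  fixes M :: "'s measure" and T :: real
  assumes finite_prob: "finite_prob_space M"
begin

sublocale prob_space M
  using finite_prob by (simp add: finite_prob_space_def)

lemma finite_space: "finite (space M)" and sets_M: "sets M = Pow (space M)"
  using finite_prob by (simp_all add: finite_prob_space_def)

lemma measurable_all: "g \<in> borel_measurable M"
  unfolding measurable_def by (auto simp: sets_M)

lemma AE_iff: "(AE s in M. Q s) \<longleftrightarrow> (\<forall>s\<in>space M. measure M {s} \<noteq> 0 \<longrightarrow> Q s)"
proof -
  define A where "A = {s \<in> space M. \<not> Q s}"
  have A: "A \<in> sets M" "finite A" "A \<subseteq> space M"
    using finite_space by (auto simp: A_def sets_M)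
  have "(AE s in M. Q s) \<longleftrightarrow> emeasure M A = 0"
    by (rule AE_iff_measurable[OF A(1)]) (simp add: A_def)
  also have "\<dots> \<longleftrightarrow> measure M A = 0"
    by (simp add: emeasure_eq_measure)
  also have "measure M A = (\<Sum>s\<in>A. measure M {s})"
    using A by (intro finite_measure_eq_sum_singleton) (auto simp: sets_M)
  also have "\<dots> = 0 \<longleftrightarrow> (\<forall>s\<in>A. measure M {s} = 0)"
    by (rule sum_nonneg_eq_0_iff[OF A(2)]) simp
  finally show ?thesis by (auto simp: A_def)
qed

lemma integrable_all:
  fixes g :: "'s \<Rightarrow> 'b::{banach, second_countable_topology}"
  shows "integrable M g"
proof (rule integrable_const_bound[OF _ measurable_all])
  show "AE s in M. norm (g s) \<le> (\<Sum>s\<in>space M. norm (g s))"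
    using finite_space by (auto intro!: AE_I2 member_le_sum)
qed

lemma integral_eq:
  fixes g :: "'s \<Rightarrow> 'b::{banach, second_countable_topology}"
  shows "(LINT s|M. g s) = (\<Sum>s\<in>space M. measure M {s} *\<^sub>R g s)"
proof -
  have "(LINT s|M. g s) = (LINT s|M. (\<Sum>a\<in>space M. indicator {a} s *\<^sub>R g a))"
  proof (rule Bochner_Integration.integral_cong[OF refl])
    fix s assume "s \<in> space M"
    moreover have "indicat_real {a} s *\<^sub>R g a = (if s = a then g a else 0)" for a
      by (simp add: indicator_def)
    ultimately show "g s = (\<Sum>a\<in>space M. indicator {a} s *\<^sub>R g a)"
      by (simp add: finite_space)
  qed
  also have "\<dots> = (\<Sum>a\<in>space M. LINT s|M. indicator {a} s *\<^sub>R g a)"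
    by (rule Bochner_Integration.integral_sum) (rule integrable_all)
  also have "\<dots> = (\<Sum>a\<in>space M. measure M {a} *\<^sub>R g a)"
    by (intro sum.cong refl) (simp add: sets_M emeasure_eq_measure)
  finally show ?thesis .
qed

lemma rv_inner_eq: "rv_inner M T x y = (\<Sum>s\<in>space M. measure M {s} * L2_inner T (x s) (y s))"
  by (simp add: rv_inner_def integral_eq)

lemma rv_norm_sq: "(rv_norm M T x)\<^sup>2 = rv_inner M T x x"
  by (simp add: rv_norm_def L2_norm_sq rv_inner_def integral_nonneg_AE L2_inner_nonneg)

lemma rvL2_D: "x \<in> rvL2 M T \<Longrightarrow> s \<in> space M \<Longrightarrow> x s \<in> L2 T"
  by (simp add: rvL2_def)

lemma rvL2_subspace: "subspace (rvL2 M T)"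
  unfolding subspace_def rvL2_def
  by (auto simp: zero_fun_def plus_fun_def scaleR_fun_def intro: L2_zero L2_add L2_scaleR)

lemma rv_inner_commute: "rv_inner M T x y = rv_inner M T y x"
  by (simp add: rv_inner_eq L2_inner_commute)

lemma rv_inner_add_left:
  assumes "x \<in> rvL2 M T" "y \<in> rvL2 M T" "w \<in> rvL2 M T"
  shows "rv_inner M T (x + y) w = rv_inner M T x w + rv_inner M T y w"
  using assms
  by (simp add: rv_inner_eq plus_fun_def L2_inner_add_left rvL2_D distrib_left sum.distrib)

lemma rv_inner_scaleR_left: "rv_inner M T (c *\<^sub>R x) w = c * rv_inner M T x w"
  by (simp add: rv_inner_eq scaleR_fun_def L2_inner_scaleR_left sum_distrib_left mult_ac)

lemma rv_inner_nonneg: "0 \<le> rv_inner M T x x"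
  by (simp add: rv_inner_eq sum_nonneg L2_inner_nonneg)

lemma L2_inner_le_rv_inner:
  "s \<in> space M \<Longrightarrow> measure M {s} * L2_inner T (x s) (x s) \<le> rv_inner M T x x"
  unfolding rv_inner_eq
  by (rule member_le_sum[OF _ _ finite_space]) (simp_all add: L2_inner_nonneg)

lemma diff_apply2: "(x - y) s = (\<lambda>t. x s t - y s t)" for x y :: "'a \<Rightarrow> 'b \<Rightarrow> 'c::minus"
  by (simp add: fun_eq_iff fun_diff_def)

text \<open>A scenario of positive mass inherits the Cauchy property, its mass times its squared
  error being at most the total. Keeping the mass as a factor lets the scenario limits be summed
  uniformly.\<close>

lemma rv_inner_complete:
  fixes X :: "nat \<Rightarrow> 's \<Rightarrow> real \<Rightarrow> real^'n"
  assumes X: "\<And>n. X n \<in> rvL2 M T"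
    and cauchy: "\<And>e. e > 0 \<Longrightarrow> \<exists>K. \<forall>m\<ge>K. \<forall>n\<ge>K. rv_inner M T (X m - X n) (X m - X n) < e"
  shows "\<exists>l\<in>rvL2 M T. (\<lambda>n. rv_inner M T (X n - l) (X n - l)) \<longlonglongrightarrow> 0"
proof -
  have ex: "\<exists>v\<in>L2 T. (\<lambda>n. measure M {s} * L2_inner T (\<lambda>t. X n s t - v t) (\<lambda>t. X n s t - v t)) \<longlonglongrightarrow> 0"
    if s: "s \<in> space M" for s
  proof (cases "measure M {s} = 0")
    case True
    \<comment> \<open>A scenario of mass zero does not affect the seminorm, so zero serves as its
      limit.\<close>
    then show ?thesis using L2_zero by (intro bexI[of _ "\<lambda>_. 0"]) auto
  next
    case False
    then have ps: "measure M {s} > 0" by (simp add: zero_less_measure_iff)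
    have "\<exists>v\<in>L2 T. (\<lambda>n. L2_inner T (\<lambda>t. X n s t - v t) (\<lambda>t. X n s t - v t)) \<longlonglongrightarrow> 0"
    proof (rule L2_complete)
      show "X n s \<in> L2 T" for n using X s by (rule rvL2_D)
      fix e :: real assume "e > 0"
      then obtain K where K: "\<And>m n. m \<ge> K \<Longrightarrow> n \<ge> K \<Longrightarrow>
          rv_inner M T (X m - X n) (X m - X n) < measure M {s} * e"
        using cauchy[of "measure M {s} * e"] ps by auto
      show "\<exists>K. \<forall>m\<ge>K. \<forall>n\<ge>K. L2_inner T (\<lambda>t. X m s t - X n s t) (\<lambda>t. X m s t - X n s t) < e"
      proof (intro exI allI impI)
        fix m n assume "K \<le> m" "K \<le> n"
        from le_less_trans[OF L2_inner_le_rv_inner[OF s] K[OF this]]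
        have "measure M {s} * L2_inner T (\<lambda>t. X m s t - X n s t) (\<lambda>t. X m s t - X n s t) < measure M {s} * e"
          unfolding diff_apply2 .
        with ps show "L2_inner T (\<lambda>t. X m s t - X n s t) (\<lambda>t. X m s t - X n s t) < e"
          by simp
      qed
    qed
    then show ?thesis by (auto intro: tendsto_mult_right_zero)
  qed
  have "\<exists>l. \<forall>s\<in>space M. l s \<in> L2 T \<and>
      (\<lambda>n. measure M {s} * L2_inner T (\<lambda>t. X n s t - l s t) (\<lambda>t. X n s t - l s t)) \<longlonglongrightarrow> 0"
    by (rule bchoice, rule ballI, drule ex, unfold Bex_def)
  then obtain l where l: "\<And>s. s \<in> space M \<Longrightarrow> l s \<in> L2 T"
    and lim: "\<And>s. s \<in> space M \<Longrightarrow>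
      (\<lambda>n. measure M {s} * L2_inner T (\<lambda>t. X n s t - l s t) (\<lambda>t. X n s t - l s t)) \<longlonglongrightarrow> 0"
    by blast
  have "l \<in> rvL2 M T" using l by (simp add: rvL2_def)
  moreover have "(\<lambda>n. rv_inner M T (X n - l) (X n - l)) \<longlonglongrightarrow> 0"
    unfolding rv_inner_eq diff_apply2 by (rule tendsto_null_sum) (rule lim)
  ultimately show ?thesis by blast
qed

lemma rv_eq_iff:
  assumes "x \<in> rvL2 M T" "y \<in> rvL2 M T"
  shows "rv_eq M T x y \<longleftrightarrow> rv_inner M T (x - y) (x - y) = 0"
proof -
  have "rv_inner M T (x - y) (x - y) = 0 \<longleftrightarrow>
      (\<forall>s\<in>space M. measure M {s} * L2_inner T ((x - y) s) ((x - y) s) = 0)"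
    unfolding rv_inner_eq
    by (rule sum_nonneg_eq_0_iff[OF finite_space]) (simp add: L2_inner_nonneg)
  also have "\<dots> \<longleftrightarrow> (\<forall>s\<in>space M. measure M {s} \<noteq> 0 \<longrightarrow> (AE t in lebesgue_on {0..T}. x s t = y s t))"
    using assms unfolding diff_apply2
    by (intro ball_cong refl) (auto simp: L2_inner_self_eq_0 L2_diff rvL2_D)
  finally show ?thesis by (simp add: rv_eq_def AE_iff)
qed

lemma rv_mean_eq: "rv_mean M x s = (\<lambda>t. \<Sum>w\<in>space M. measure M {w} *\<^sub>R x w t)"
  by (simp add: rv_mean_def integral_eq)

lemma L2_sum: "(\<And>w. w \<in> A \<Longrightarrow> u w \<in> L2 T) \<Longrightarrow> (\<lambda>t. \<Sum>w\<in>A. u w t) \<in> L2 T"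
  by (induction A rule: infinite_finite_induct) (auto intro: L2_zero L2_add)

lemma rv_mean_in: "x \<in> rvL2 M T \<Longrightarrow> rv_mean M x \<in> rvL2 M T"
  unfolding rvL2_def rv_mean_eq by (auto intro!: L2_sum L2_scaleR)

lemma L2_inner_mean_left:
  assumes "x \<in> rvL2 M T" "v \<in> L2 T"
  shows "L2_inner T (\<lambda>t. \<Sum>w\<in>space M. measure M {w} *\<^sub>R x w t) v =
    (\<Sum>w\<in>space M. measure M {w} * L2_inner T (x w) v)"
  using assms by (simp add: L2_inner_def inner_sum_left L2_inner_integrable rvL2_D)

text \<open>Means are constant over scenarios and the masses add up to one, so every expression
  reduces to the inner product of the two mean paths.\<close>

lemma rv_inner_mean:
  fixes x y :: "'s \<Rightarrow> real \<Rightarrow> real^'n"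
  assumes x: "x \<in> rvL2 M T" and y: "y \<in> rvL2 M T"
  shows "rv_inner M T (rv_mean M x) y = rv_inner M T x (rv_mean M y)"
    and "rv_inner M T (rv_mean M x) (rv_mean M y) = rv_inner M T x (rv_mean M y)"
proof -
  define m where "m x = (\<lambda>t. \<Sum>w\<in>space M. measure M {w} *\<^sub>R x w t)" for x :: "'s \<Rightarrow> real \<Rightarrow> real^'n"
  have mean: "rv_mean M x s = m x" for x s by (simp add: rv_mean_eq m_def)
  have mL2: "m x \<in> L2 T" if "x \<in> rvL2 M T" for x
    unfolding m_def using that by (intro L2_sum L2_scaleR) (rule rvL2_D)
  have right: "rv_inner M T x (rv_mean M y) = L2_inner T (m x) (m y)" if "x \<in> rvL2 M T" "y \<in> rvL2 M T" for x y
    using L2_inner_mean_left[OF that(1) mL2[OF that(2)]] by (simp add: rv_inner_eq mean m_def)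
  have total: "(\<Sum>s\<in>space M. measure M {s}) = 1"
    using finite_measure_eq_sum_singleton[OF finite_space] by (simp add: sets_M prob_space)
  show "rv_inner M T (rv_mean M x) y = rv_inner M T x (rv_mean M y)"
    using right[OF y x] right[OF x y] by (simp add: rv_inner_commute[of "rv_mean M x"] L2_inner_commute)
  show "rv_inner M T (rv_mean M x) (rv_mean M y) = rv_inner M T x (rv_mean M y)"
    unfolding right[OF x y] by (simp add: rv_inner_eq mean sum_distrib_right[symmetric] total)
qed

section \<open>The closed subspace of adapted processes\<close>

text \<open>Trades conditional expectations for the existence of a measurable version, a condition
  that visibly passes to sums, multiples and limits.\<close>

lemma eq_vec_cond_exp_iff:
  fixes X :: "'s \<Rightarrow> real^'n"
  assumes "subalgebra M F"
  shows "(AE s in M. X s = vec_cond_exp M F X s) \<longleftrightarrow> (\<exists>h\<in>borel_measurable F. AE s in M. X s = h s)"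
proof
  have "vec_cond_exp M F X \<in> borel_measurable F"
    unfolding borel_measurable_vec vec_cond_exp_def by simp
  then show "AE s in M. X s = vec_cond_exp M F X s \<Longrightarrow> \<exists>h\<in>borel_measurable F. AE s in M. X s = h s"
    by blast
next
  interpret finite_measure_subalgebra M F by standard fact
  assume "\<exists>h\<in>borel_measurable F. AE s in M. X s = h s"
  then obtain h where h: "h \<in> borel_measurable F" "AE s in M. X s = h s" by blast
  have "AE s in M. real_cond_exp M F (\<lambda>w. X w $ i) s = X s $ i" for i
  proof -
    have "AE s in M. real_cond_exp M F (\<lambda>w. X w $ i) s = real_cond_exp M F (\<lambda>w. h w $ i) s"
      by (rule real_cond_exp_cong) (use h(2) in eventually_elim, simp, (rule measurable_all)+)
    moreover have "AE s in M. real_cond_exp M F (\<lambda>w. h w $ i) s = h s $ i"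
      by (rule real_cond_exp_F_meas[OF integrable_all]) (use h(1) borel_measurable_vec in blast)
    ultimately show ?thesis using h(2) by eventually_elim simp
  qed
  then show "AE s in M. X s = vec_cond_exp M F X s"
    unfolding AE_iff by (simp add: vec_eq_iff vec_cond_exp_def)
qed

lemma subalgebra_filtration: "subalgebra M (rv_filtration M \<xi> t)"
proof -
  have "space (rv_filtration M \<xi> t) = space M" by (simp add: rv_filtration_def space_measure_of_conv)
  then show ?thesis
    unfolding subalgebra_def sets_M using sets.sets_into_space by (metis PowI subsetI)
qed

lemma Nspace_iff:
  "x \<in> Nspace M T \<xi> \<delta> \<longleftrightarrow> x \<in> rvL2 M T \<and> (AE t in lebesgue_on {0..T}. \<delta> \<le> t \<longrightarrow>
    (\<exists>h\<in>borel_measurable (rv_filtration M \<xi> (t - \<delta>)). AE s in M. x s t = h s))"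
  by (simp add: Nspace_def delta_adapted_def eq_vec_cond_exp_iff[OF subalgebra_filtration])

lemma Nspace_subset: "Nspace M T \<xi> \<delta> \<subseteq> rvL2 M T"
  by (auto simp: Nspace_def)

text \<open>Treats addition and scaling at once, through a pointwise operation that respects
  measurability for every \<sigma>-algebra.\<close>

lemma Nspace_combine:
  assumes c: "\<And>(F :: 's measure) h h'. h \<in> borel_measurable F \<Longrightarrow> h' \<in> borel_measurable F \<Longrightarrow>
      (\<lambda>s. c (h s) (h' s)) \<in> borel_measurable F"
    and x: "x \<in> Nspace M T \<xi> \<delta>" and y: "y \<in> Nspace M T \<xi> \<delta>"
    and "(\<lambda>s t. c (x s t) (y s t)) \<in> rvL2 M T"
  shows "(\<lambda>s t. c (x s t) (y s t)) \<in> Nspace M T \<xi> \<delta>"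
  unfolding Nspace_iff
proof
  have "AE t in lebesgue_on {0..T}. \<delta> \<le> t \<longrightarrow>
      (\<exists>h\<in>borel_measurable (rv_filtration M \<xi> (t - \<delta>)). AE s in M. x s t = h s)"
    "AE t in lebesgue_on {0..T}. \<delta> \<le> t \<longrightarrow>
      (\<exists>h\<in>borel_measurable (rv_filtration M \<xi> (t - \<delta>)). AE s in M. y s t = h s)"
    using x y by (simp_all add: Nspace_iff)
  then show "AE t in lebesgue_on {0..T}. \<delta> \<le> t \<longrightarrow>
      (\<exists>h\<in>borel_measurable (rv_filtration M \<xi> (t - \<delta>)). AE s in M. c (x s t) (y s t) = h s)"
  proof eventually_elim
    case (elim t)
    show ?case
    proof
      assume "\<delta> \<le> t"
      then obtain h h' where h: "h \<in> borel_measurable (rv_filtration M \<xi> (t - \<delta>))" "AE s in M. x s t = h s"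
        and h': "h' \<in> borel_measurable (rv_filtration M \<xi> (t - \<delta>))" "AE s in M. y s t = h' s"
        using elim by blast
      have "AE s in M. c (x s t) (y s t) = c (h s) (h' s)"
        using h(2) h'(2) by eventually_elim simp
      then show "\<exists>h\<in>borel_measurable (rv_filtration M \<xi> (t - \<delta>)). AE s in M. c (x s t) (y s t) = h s"
        by (rule bexI[of _ "\<lambda>s. c (h s) (h' s)"]) (rule c[OF h(1) h'(1)])
    qed
  qed
qed (fact assms(4))

text \<open>At each time a mean is constant over scenarios, hence measurable for any
  \<sigma>-algebra.\<close>

lemma rv_mean_in_Nspace:
  assumes "x \<in> rvL2 M T"
  shows "rv_mean M x \<in> Nspace M T \<xi> \<delta>"
  unfolding Nspace_iff
proof (intro conjI rv_mean_in[OF assms] always_eventually allI impI)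
  fix t
  show "\<exists>h\<in>borel_measurable (rv_filtration M \<xi> (t - \<delta>)). AE s in M. rv_mean M x s t = h s"
    by (rule bexI[of _ "\<lambda>_. \<Sum>w\<in>space M. measure M {w} *\<^sub>R x w t"]) (simp_all add: rv_mean_eq)
qed

lemma Nspace_subspace: "subspace (Nspace M T \<xi> \<delta> :: ('s \<Rightarrow> real \<Rightarrow> real^'n) set)"
  unfolding subspace_def
proof (intro conjI ballI allI)
  have "rv_mean M (0 :: 's \<Rightarrow> real \<Rightarrow> real^'n) = 0"
    by (simp add: fun_eq_iff rv_mean_eq zero_fun_def)
  moreover have "rv_mean M (0 :: 's \<Rightarrow> real \<Rightarrow> real^'n) \<in> Nspace M T \<xi> \<delta>"
    by (rule rv_mean_in_Nspace[OF subspace_0[OF rvL2_subspace]])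
  ultimately show "(0 :: 's \<Rightarrow> real \<Rightarrow> real^'n) \<in> Nspace M T \<xi> \<delta>" by simp
next
  fix x y :: "'s \<Rightarrow> real \<Rightarrow> real^'n" assume x: "x \<in> Nspace M T \<xi> \<delta>" and y: "y \<in> Nspace M T \<xi> \<delta>"
  then have "x + y \<in> rvL2 M T" "c *\<^sub>R x \<in> rvL2 M T" for c
    using Nspace_subset subspace_add[OF rvL2_subspace] subspace_scale[OF rvL2_subspace] by blast+
  then show "x + y \<in> Nspace M T \<xi> \<delta>"
    using Nspace_combine[OF _ x y, of "\<lambda>a b. a + b"] by (simp add: plus_fun_def)
next
  fix x :: "'s \<Rightarrow> real \<Rightarrow> real^'n" and c :: real assume x: "x \<in> Nspace M T \<xi> \<delta>"
  then have "c *\<^sub>R x \<in> rvL2 M T"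
    using Nspace_subset subspace_scale[OF rvL2_subspace] by blast
  then show "c *\<^sub>R x \<in> Nspace M T \<xi> \<delta>"
    using Nspace_combine[OF _ x x, of "\<lambda>a b. c *\<^sub>R a"] by (simp add: scaleR_fun_def)
qed

text \<open>The expected squared error, as a function of time, tends to 0 in mean, so a subsequence
  tends to 0 at almost every time. At such a time all scenarios of positive mass converge
  simultaneously, and the limit of the measurable versions is a measurable version of the
  limit.\<close>

lemma Nspace_closed:
  fixes X :: "nat \<Rightarrow> 's \<Rightarrow> real \<Rightarrow> real^'n"
  assumes X: "\<And>n. X n \<in> Nspace M T \<xi> \<delta>" and l: "l \<in> rvL2 M T"
    and lim: "(\<lambda>n. rv_inner M T (X n - l) (X n - l)) \<longlonglongrightarrow> 0"
  shows "l \<in> Nspace M T \<xi> \<delta>"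
proof -
  define g where "g n t = (\<Sum>s\<in>space M. measure M {s} * (norm (X n s t - l s t))\<^sup>2)" for n t
  have XL: "X n \<in> rvL2 M T" for n using X Nspace_subset by blast
  have int: "integrable (lebesgue_on {0..T}) (\<lambda>t. (norm (X n s t - l s t))\<^sup>2)" if "s \<in> space M" for n s
    using L2_integrable[OF L2_diff[OF rvL2_D[OF XL that] rvL2_D[OF l that]]] by simp
  have g0: "0 \<le> g n t" for n t unfolding g_def by (simp add: sum_nonneg)
  have "(LINT t|lebesgue_on {0..T}. norm (g n t)) = rv_inner M T (X n - l) (X n - l)" for n
    using g0[of n] int by (simp add: g_def rv_inner_eq diff_apply2 L2_inner_self)
  then have "(\<lambda>n. LINT t|lebesgue_on {0..T}. norm (g n t)) \<longlonglongrightarrow> 0" using lim by simp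
  moreover have "integrable (lebesgue_on {0..T}) (g n)" for n
    unfolding g_def using int by simp
  ultimately obtain r where "AE t in lebesgue_on {0..T}. (\<lambda>n. g (r n) t) \<longlonglongrightarrow> 0"
    using tendsto_L1_AE_subseq[of "lebesgue_on {0..T}" g] by blast
  moreover have "AE t in lebesgue_on {0..T}. \<forall>n. \<delta> \<le> t \<longrightarrow>
      (\<exists>h\<in>borel_measurable (rv_filtration M \<xi> (t - \<delta>)). AE s in M. X n s t = h s)"
    using X unfolding Nspace_iff AE_all_countable by blast
  ultimately have "AE t in lebesgue_on {0..T}. \<delta> \<le> t \<longrightarrow>
      (\<exists>h\<in>borel_measurable (rv_filtration M \<xi> (t - \<delta>)). AE s in M. l s t = h s)"
  proof eventually_elim
    case (elim t)
    show ?case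
    proof
      assume "\<delta> \<le> t"
      with elim(2) obtain h where h: "\<And>n. h n \<in> borel_measurable (rv_filtration M \<xi> (t - \<delta>))"
        and Xh: "\<And>n. AE s in M. X n s t = h n s" by metis
      have "l s t = lim (\<lambda>n. h (r n) s)" if s: "s \<in> space M" "measure M {s} \<noteq> 0" for s
      proof -
        have "(\<lambda>n. measure M {s} * (norm (X (r n) s t - l s t))\<^sup>2) \<longlonglongrightarrow> 0"
        proof (rule tendsto_sandwich[OF _ _ tendsto_const elim(1)])
          show "\<forall>\<^sub>F n in sequentially. measure M {s} * (norm (X (r n) s t - l s t))\<^sup>2 \<le> g (r n) t"
            unfolding g_def by (intro always_eventually allI member_le_sum finite_space s(1)) simp_all
        qed simp
        from tendsto_mult_left[OF this, of "1 / measure M {s}"]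
        have "(\<lambda>n. (norm (X (r n) s t - l s t))\<^sup>2) \<longlonglongrightarrow> 0" using s(2) by simp
        then have "(\<lambda>n. norm (X (r n) s t - l s t)) \<longlonglongrightarrow> 0"
          using tendsto_real_sqrt[of "\<lambda>n. (norm (X (r n) s t - l s t))\<^sup>2" 0] by simp
        then have "(\<lambda>n. X (r n) s t) \<longlonglongrightarrow> l s t"
          by (simp add: tendsto_norm_zero_iff Lim_null[symmetric])
        moreover have "X n s t = h n s" for n
          using Xh[of n] s unfolding AE_iff by blast
        ultimately show ?thesis by (simp add: limI)
      qed
      then have "AE s in M. l s t = lim (\<lambda>n. h (r n) s)" unfolding AE_iff by blast
      moreover have "(\<lambda>s. lim (\<lambda>n. h (r n) s)) \<in> borel_measurable (rv_filtration M \<xi> (t - \<delta>))"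
        by (rule borel_measurable_lim_metric) (rule h)
      ultimately show "\<exists>h\<in>borel_measurable (rv_filtration M \<xi> (t - \<delta>)). AE s in M. l s t = h s"
        by (rule bexI[of _ "\<lambda>s. lim (\<lambda>n. h (r n) s)"])
    qed
  qed
  with l show ?thesis by (simp add: Nspace_iff)
qed

end

section \<open>The scenario problem\<close>

lemma sum_ereal_neq_minf:
  fixes a :: "'a \<Rightarrow> ereal"
  assumes "\<And>i. i \<in> A \<Longrightarrow> a i \<noteq> -\<infinity>"
  shows "sum a A \<noteq> -\<infinity>"
  using assms by (induction A rule: infinite_finite_induct) (auto simp: ereal_plus_eq_MInfty)

text \<open>Superadditivity of the lower limit fails for opposite infinities; lower bounds different
  from -\<infinity> rule this out.\<close>

lemma sum_le_liminf_sum: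
  fixes a :: "'a \<Rightarrow> ereal" and A :: "'a \<Rightarrow> nat \<Rightarrow> ereal"
  assumes "finite S" "\<And>s. s \<in> S \<Longrightarrow> a s \<le> liminf (A s)" "\<And>s. s \<in> S \<Longrightarrow> a s \<noteq> -\<infinity>"
  shows "sum a S \<le> liminf (\<lambda>n. \<Sum>s\<in>S. A s n)"
  using assms
proof (induction S rule: finite_induct)
  case (insert s S)
  have le: "sum a S \<le> liminf (\<lambda>n. \<Sum>s\<in>S. A s n)" by (rule insert.IH) (use insert.prems in auto)
  have ne: "liminf (A s) \<noteq> -\<infinity>" "liminf (\<lambda>n. \<Sum>s\<in>S. A s n) \<noteq> -\<infinity>"
    using insert.prems[of s] le sum_ereal_neq_minf[of S a] insert.prems(2) by auto
  have "a s + sum a S \<le> liminf (A s) + liminf (\<lambda>n. \<Sum>s\<in>S. A s n)"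
    using insert.prems(1)[of s] le by (intro add_mono) auto
  also have "\<dots> \<le> liminf (\<lambda>n. A s n + (\<Sum>s\<in>S. A s n))"
    by (rule ereal_liminf_add_mono) (use ne in auto)
  finally show ?case using insert.hyps by simp
qed (simp add: Liminf_const)

locale scenario_problem = finite_scenarios M T for M :: "'s measure" and T +
  fixes \<delta> :: real and \<xi> :: "'s \<Rightarrow> real \<Rightarrow> real^'d"
    and f :: "(real \<Rightarrow> real^'m) \<Rightarrow> (real \<Rightarrow> real^'d) \<Rightarrow> ereal"
  assumes f_convex: "\<And>s. s \<in> space M \<Longrightarrow> L2_convex T (\<lambda>u. f u (\<xi> s))"
    and f_proper: "\<And>s. s \<in> space M \<Longrightarrow> L2_proper T (\<lambda>u. f u (\<xi> s))"
    and f_lsc: "\<And>s. s \<in> space M \<Longrightarrow> L2_lsc T (\<lambda>u. f u (\<xi> s))"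
begin

abbreviation H :: "('s \<Rightarrow> real \<Rightarrow> real^'m) set" where "H \<equiv> rvL2 M T"
abbreviation NS :: "('s \<Rightarrow> real \<Rightarrow> real^'m) set" where "NS \<equiv> Nspace M T \<xi> \<delta>"

section \<open>The expected cost\<close>

lemma term_neq_minf:
  assumes "x \<in> H" "s \<in> space M"
  shows "ereal (measure M {s}) * f (x s) (\<xi> s) \<noteq> -\<infinity>"
proof -
  have "f (x s) (\<xi> s) \<noteq> -\<infinity>"
    using f_proper[OF assms(2)] rvL2_D[OF assms] by (simp add: L2_proper_def)
  then show ?thesis by (cases "f (x s) (\<xi> s)") (auto simp: ereal_mult_eq_MInfty zero_less_measure_iff)
qed

lemma expected_cost_neq_minf: "x \<in> H \<Longrightarrow> expected_cost M f \<xi> x \<noteq> -\<infinity>"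
  unfolding expected_cost_def by (rule sum_ereal_neq_minf) (rule term_neq_minf)

lemma expected_cost_le:
  assumes "\<And>s. s \<in> space M \<Longrightarrow> measure M {s} \<noteq> 0 \<Longrightarrow> f (x s) (\<xi> s) \<le> ereal (v s)"
  shows "expected_cost M f \<xi> x \<le> ereal (\<Sum>s\<in>space M. measure M {s} * v s)"
  unfolding expected_cost_def sum_ereal[symmetric]
proof (rule sum_mono)
  fix s assume s: "s \<in> space M"
  show "ereal (measure M {s}) * f (x s) (\<xi> s) \<le> ereal (measure M {s} * v s)"
  proof (cases "measure M {s} = 0")
    case False
    then have "ereal (measure M {s}) * f (x s) (\<xi> s) \<le> ereal (measure M {s}) * ereal (v s)"
      using assms[OF s] by (intro ereal_mult_left_mono) auto
    then show ?thesis by simp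
  qed (simp add: zero_ereal_def[symmetric])
qed

text \<open>Since zero times \<infinity> is zero, a finite expectation controls only the scenarios
  of positive mass. There the values become real numbers and later estimates avoid
  \<open>ereal\<close> arithmetic.\<close>

lemma expected_cost_finite:
  assumes x: "x \<in> H" and le: "expected_cost M f \<xi> x \<le> ereal a"
  shows "\<exists>v. (\<forall>s\<in>space M. measure M {s} \<noteq> 0 \<longrightarrow> f (x s) (\<xi> s) = ereal (v s)) \<and>
    (\<Sum>s\<in>space M. measure M {s} * v s) \<le> a"
proof -
  define v where "v s = real_of_ereal (f (x s) (\<xi> s))" for s
  have v: "f (x s) (\<xi> s) = ereal (v s)" if s: "s \<in> space M" "measure M {s} \<noteq> 0" for s
  proof -
    have "expected_cost M f \<xi> x \<noteq> \<infinity>" using le by auto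
    then have "ereal (measure M {s}) * f (x s) (\<xi> s) \<noteq> \<infinity>"
      using s(1) finite_space unfolding expected_cost_def sum_Pinfty by blast
    moreover have "f (x s) (\<xi> s) \<noteq> -\<infinity>"
      using f_proper[OF s(1)] rvL2_D[OF x s(1)] by (simp add: L2_proper_def)
    ultimately show ?thesis
      using s(2) unfolding v_def by (cases "f (x s) (\<xi> s)") (auto simp: zero_less_measure_iff)
  qed
  have "expected_cost M f \<xi> x = ereal (\<Sum>s\<in>space M. measure M {s} * v s)"
    unfolding expected_cost_def sum_ereal[symmetric]
  proof (rule sum.cong[OF refl])
    fix s assume "s \<in> space M"
    then show "ereal (measure M {s}) * f (x s) (\<xi> s) = ereal (measure M {s} * v s)"
      using v by (cases "measure M {s} = 0") (auto simp: zero_ereal_def[symmetric])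
  qed
  with le v show ?thesis by auto
qed

lemma expected_cost_convex:
  assumes x: "x \<in> H" and y: "y \<in> H" and t: "0 < t" "t < 1"
    and "expected_cost M f \<xi> x \<le> ereal a" "expected_cost M f \<xi> y \<le> ereal b"
  shows "expected_cost M f \<xi> ((1 - t) *\<^sub>R x + t *\<^sub>R y) \<le> ereal ((1 - t) * a + t * b)"
proof -
  obtain v where v: "\<And>s. s \<in> space M \<Longrightarrow> measure M {s} \<noteq> 0 \<Longrightarrow> f (x s) (\<xi> s) = ereal (v s)"
    "(\<Sum>s\<in>space M. measure M {s} * v s) \<le> a"
    using expected_cost_finite[OF x assms(5)] by blast
  obtain w where w: "\<And>s. s \<in> space M \<Longrightarrow> measure M {s} \<noteq> 0 \<Longrightarrow> f (y s) (\<xi> s) = ereal (w s)"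
    "(\<Sum>s\<in>space M. measure M {s} * w s) \<le> b"
    using expected_cost_finite[OF y assms(6)] by blast
  have "expected_cost M f \<xi> ((1 - t) *\<^sub>R x + t *\<^sub>R y) \<le>
      ereal (\<Sum>s\<in>space M. measure M {s} * ((1 - t) * v s + t * w s))"
  proof (rule expected_cost_le)
    fix s assume s: "s \<in> space M" "measure M {s} \<noteq> 0"
    have "f (\<lambda>\<tau>. (1 - t) *\<^sub>R x s \<tau> + (1 - (1 - t)) *\<^sub>R y s \<tau>) (\<xi> s) \<le>
        ereal (1 - t) * f (x s) (\<xi> s) + ereal (1 - (1 - t)) * f (y s) (\<xi> s)"
      by (rule f_convex[OF s(1), unfolded L2_convex_def, rule_format])
        (use rvL2_D[OF x s(1)] rvL2_D[OF y s(1)] t in simp_all)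
    then show "f (((1 - t) *\<^sub>R x + t *\<^sub>R y) s) (\<xi> s) \<le> ereal ((1 - t) * v s + t * w s)"
      by (simp add: v(1)[OF s] w(1)[OF s] plus_fun_def scaleR_fun_def)
  qed
  also have "(\<Sum>s\<in>space M. measure M {s} * ((1 - t) * v s + t * w s)) =
      (1 - t) * (\<Sum>s\<in>space M. measure M {s} * v s) + t * (\<Sum>s\<in>space M. measure M {s} * w s)"
    by (simp add: sum_distrib_left sum.distrib distrib_left mult_ac)
  also have "ereal \<dots> \<le> ereal ((1 - t) * a + t * b)"
    using v(2) w(2) t by (simp add: add_mono)
  finally show ?thesis .
qed

text \<open>Convergence in the total seminorm implies convergence in every scenario of positive
  mass; the others contribute zero throughout.\<close>

lemma expected_cost_lsc:
  assumes X: "\<And>n. X n \<in> H" and l: "l \<in> H"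
    and lim: "(\<lambda>n. rv_inner M T (X n - l) (X n - l)) \<longlonglongrightarrow> 0"
    and le: "\<And>n. expected_cost M f \<xi> (X n) \<le> ereal (c n)" and c: "c \<longlonglongrightarrow> c'"
  shows "expected_cost M f \<xi> l \<le> ereal c'"
proof -
  have "expected_cost M f \<xi> l \<le> liminf (\<lambda>n. expected_cost M f \<xi> (X n))"
    unfolding expected_cost_def
  proof (rule sum_le_liminf_sum[OF finite_space])
    fix s assume s: "s \<in> space M"
    show "ereal (measure M {s}) * f (l s) (\<xi> s) \<noteq> -\<infinity>" by (rule term_neq_minf[OF l s])
    show "ereal (measure M {s}) * f (l s) (\<xi> s) \<le> liminf (\<lambda>n. ereal (measure M {s}) * f (X n s) (\<xi> s))"
    proof (cases "measure M {s} = 0")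
      case True
      then show ?thesis by (simp add: zero_ereal_def[symmetric] Liminf_const)
    next
      case False
      have "(\<lambda>n. measure M {s} * L2_inner T (\<lambda>t. X n s t - l s t) (\<lambda>t. X n s t - l s t)) \<longlonglongrightarrow> 0"
      proof (rule tendsto_sandwich[OF _ _ tendsto_const lim])
        show "\<forall>\<^sub>F n in sequentially. measure M {s} * L2_inner T (\<lambda>t. X n s t - l s t) (\<lambda>t. X n s t - l s t)
            \<le> rv_inner M T (X n - l) (X n - l)"
          using L2_inner_le_rv_inner[OF s] unfolding diff_apply2[symmetric] by (intro always_eventually allI)
      qed (simp add: L2_inner_nonneg)
      from tendsto_mult_left[OF this, of "1 / measure M {s}"]
      have "(\<lambda>n. L2_inner T (\<lambda>t. X n s t - l s t) (\<lambda>t. X n s t - l s t)) \<longlonglongrightarrow> 0"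
        using False by simp
      then have "(\<lambda>n. L2_norm T (\<lambda>t. X n s t - l s t)) \<longlonglongrightarrow> 0"
        unfolding L2_norm_def using tendsto_real_sqrt by fastforce
      then have "f (l s) (\<xi> s) \<le> liminf (\<lambda>n. f (X n s) (\<xi> s))"
        using f_lsc[OF s, unfolded L2_lsc_def, THEN bspec, OF rvL2_D[OF l s], THEN spec, of "\<lambda>n. X n s"]
          rvL2_D[OF X s] by simp
      then have "ereal (measure M {s}) * f (l s) (\<xi> s) \<le> ereal (measure M {s}) * liminf (\<lambda>n. f (X n s) (\<xi> s))"
        by (intro ereal_mult_left_mono) simp_all
      then show ?thesis by (simp add: Liminf_ereal_mult_left)
    qed
  qed
  also have "\<dots> \<le> liminf (\<lambda>n. ereal (c n))"
    by (intro Liminf_mono always_eventually allI le)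
  also have "\<dots> = ereal c'"
    by (rule lim_imp_Liminf[OF sequentially_bot]) (use c in simp)
  finally show ?thesis .
qed

lemma expected_cost_proper: "\<exists>x\<in>H. expected_cost M f \<xi> x < \<infinity>"
proof -
  have "\<forall>s\<in>space M. \<exists>u. u \<in> L2 T \<and> f u (\<xi> s) < \<infinity>"
    using f_proper by (auto simp: L2_proper_def)
  then obtain x where x: "\<forall>s\<in>space M. x s \<in> L2 T \<and> f (x s) (\<xi> s) < \<infinity>"
    using bchoice[of "space M" "\<lambda>s u. u \<in> L2 T \<and> f u (\<xi> s) < \<infinity>"] by blast
  have "expected_cost M f \<xi> x \<le> ereal (\<Sum>s\<in>space M. measure M {s} * real_of_ereal (f (x s) (\<xi> s)))"
  proof (rule expected_cost_le)
    fix s assume "s \<in> space M"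
    then show "f (x s) (\<xi> s) \<le> ereal (real_of_ereal (f (x s) (\<xi> s)))"
      using x by (cases "f (x s) (\<xi> s)") auto
  qed
  then have "expected_cost M f \<xi> x < \<infinity>" by (rule le_less_trans) simp
  then show ?thesis using x by (auto simp: rvL2_def)
qed

text \<open>The inner product of \<open>H\<close> is extended to all functions through a linear projection onto \<open>H\<close>, so
  that no membership conditions are needed.\<close>

definition emb :: "('s \<Rightarrow> real \<Rightarrow> real^'m) \<Rightarrow> 's \<Rightarrow> real \<Rightarrow> real^'m" where
  "emb = (SOME g. linear g \<and> range g \<subseteq> H \<and> (\<forall>x\<in>H. g x = x))"

lemma emb_linear: "linear emb" and emb_in: "emb x \<in> H" and emb_id: "x \<in> H \<Longrightarrow> emb x = x"
proof -
  have "\<exists>g. range g \<subseteq> H \<and> linear g \<and> (\<forall>v\<in>H. g (id v) = v)"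
    by (rule linear_exists_left_inverse_on[OF linear_id rvL2_subspace]) simp
  then have "\<exists>g. linear g \<and> range g \<subseteq> H \<and> (\<forall>x\<in>H. g x = x)" by auto
  then have "linear emb \<and> range emb \<subseteq> H \<and> (\<forall>x\<in>H. emb x = x)"
    unfolding emb_def by (rule someI_ex)
  then show "linear emb" "emb x \<in> H" "x \<in> H \<Longrightarrow> emb x = x" by auto
qed

lemma emb_emb [simp]: "emb (emb x) = emb x"
  by (rule emb_id[OF emb_in])

lemmas emb_simps = linear_add[OF emb_linear] linear_diff[OF emb_linear] linear_scale[OF emb_linear]

definition ip :: "('s \<Rightarrow> real \<Rightarrow> real^'m) \<Rightarrow> ('s \<Rightarrow> real \<Rightarrow> real^'m) \<Rightarrow> real" where
  "ip x y = rv_inner M T (emb x) (emb y)"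

lemma ip_eq: "x \<in> H \<Longrightarrow> y \<in> H \<Longrightarrow> ip x y = rv_inner M T x y"
  by (simp add: ip_def emb_id)

lemma ip_emb [simp]: "ip (emb x) y = ip x y" "ip x (emb y) = ip x y"
  by (simp_all add: ip_def)

section \<open>Random processes as an instance of the abstract setting\<close>

sublocale semi_hilbert ip
proof
  fix x y w :: "'s \<Rightarrow> real \<Rightarrow> real^'m" and c :: real
  show "ip x y = ip y x" by (simp add: ip_def rv_inner_commute)
  show "ip (x + y) w = ip x w + ip y w"
    by (simp add: ip_def emb_simps rv_inner_add_left emb_in)
  show "ip (c *\<^sub>R x) y = c * ip x y"
    by (simp add: ip_def emb_simps rv_inner_scaleR_left)
  show "0 \<le> ip x x" by (simp add: ip_def rv_inner_nonneg)
next
  fix X :: "nat \<Rightarrow> 's \<Rightarrow> real \<Rightarrow> real^'m"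
  assume "\<And>e. e > 0 \<Longrightarrow> \<exists>K. \<forall>m\<ge>K. \<forall>n\<ge>K. ip (X m - X n) (X m - X n) < e"
  then have "\<exists>l\<in>H. (\<lambda>n. rv_inner M T (emb (X n) - l) (emb (X n) - l)) \<longlonglongrightarrow> 0"
    by (intro rv_inner_complete emb_in) (simp add: ip_def emb_simps)
  then obtain l where "l \<in> H" "(\<lambda>n. rv_inner M T (emb (X n) - l) (emb (X n) - l)) \<longlonglongrightarrow> 0" by blast
  then have "(\<lambda>n. ip (X n - l) (X n - l)) \<longlonglongrightarrow> 0"
    by (simp add: ip_def emb_simps emb_id)
  then show "\<exists>l. (\<lambda>n. ip (X n - l) (X n - l)) \<longlonglongrightarrow> 0" by blast
qed

text \<open>Reading every vector through \<open>emb\<close> makes membership invariant under null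
  differences, including those that leave \<open>H\<close>.\<close>

definition N :: "('s \<Rightarrow> real \<Rightarrow> real^'m) set" where "N = {x. emb x \<in> NS}"
definition P :: "('s \<Rightarrow> real \<Rightarrow> real^'m) \<Rightarrow> 's \<Rightarrow> real \<Rightarrow> real^'m" where "P x = Proj M T NS (emb x)"
definition E :: "('s \<Rightarrow> real \<Rightarrow> real^'m) \<Rightarrow> 's \<Rightarrow> real \<Rightarrow> real^'m" where "E x = rv_mean M (emb x)"

lemma NS_H: "x \<in> NS \<Longrightarrow> x \<in> H"
  using Nspace_subset by blast

lemma NS_N: "x \<in> NS \<Longrightarrow> x \<in> N"
  by (simp add: N_def emb_id NS_H)

lemma N_subspace: "subspace N"
  using linear_subspace_vimage[OF emb_linear Nspace_subspace[of \<xi> \<delta>]] by (simp add: N_def vimage_def)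

lemma N_closed:
  assumes "\<And>n. X n \<in> N" "(\<lambda>n. ip (X n - l) (X n - l)) \<longlonglongrightarrow> 0"
  shows "l \<in> N"
  unfolding N_def mem_Collect_eq
  by (rule Nspace_closed[of "\<lambda>n. emb (X n)", OF _ emb_in]) (use assms in \<open>simp_all add: N_def ip_def emb_simps\<close>)

lemma Proj_spec:
  assumes "V \<subseteq> H" "x \<in> H" "\<exists>p\<in>V. \<forall>v\<in>V. rv_inner M T (x - p) v = 0"
  shows "Proj M T V x \<in> V" "x - Proj M T V x \<in> orth_compl M T V"
proof -
  obtain p where p: "p \<in> V" "\<And>v. v \<in> V \<Longrightarrow> rv_inner M T (x - p) v = 0" using assms(3) by blast
  moreover have "x - p \<in> H" using p(1) assms(1,2) by (intro subspace_diff[OF rvL2_subspace]) blast+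
  ultimately have "p \<in> V \<and> (\<lambda>s t. x s t - p s t) \<in> orth_compl M T V"
    by (auto simp: orth_compl_def fun_diff_def)
  then have "Proj M T V x \<in> V \<and> (\<lambda>s t. x s t - Proj M T V x s t) \<in> orth_compl M T V"
    unfolding Proj_def
    by (rule someI[where P = "\<lambda>p. p \<in> V \<and> (\<lambda>s t. x s t - p s t) \<in> orth_compl M T V"])
  then show "Proj M T V x \<in> V" "x - Proj M T V x \<in> orth_compl M T V"
    by (simp_all add: fun_diff_def)
qed

lemma P_spec: "P x \<in> NS" "emb x - P x \<in> orth_compl M T NS"
proof -
  have "\<exists>p\<in>N. \<forall>v\<in>N. ip (x - p) v = 0"
  proof (rule projection_exists[OF N_subspace])
    fix X l assume "\<And>n :: nat. X n \<in> N" "(\<lambda>n. ip (X n - l) (X n - l)) \<longlonglongrightarrow> 0"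
    then show "l \<in> N" by (rule N_closed[of X l])
  qed
  then obtain p where p: "p \<in> N" "\<And>v. v \<in> N \<Longrightarrow> ip (x - p) v = 0" by blast
  have "\<exists>p\<in>NS. \<forall>v\<in>NS. rv_inner M T (emb x - p) v = 0"
  proof (intro bexI ballI)
    show "emb p \<in> NS" using p(1) by (simp add: N_def)
    fix v assume v: "v \<in> NS"
    then have "v \<in> H" using Nspace_subset by blast
    with p(2)[OF NS_N[OF v]] show "rv_inner M T (emb x - emb p) v = 0"
      by (simp add: ip_def emb_simps emb_id)
  qed
  from Proj_spec[OF Nspace_subset emb_in this]
  show "P x \<in> NS" "emb x - P x \<in> orth_compl M T NS" by (simp_all add: P_def)
qed

sublocale decoupling ip N P E
proof
  fix x y v :: "'s \<Rightarrow> real \<Rightarrow> real^'m"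
  show "subspace N" by (rule N_subspace)
  show "y \<in> N" if "x \<in> N" "ip (x - y) (x - y) = 0"
    by (rule N_closed[of "\<lambda>_. x"]) (use that in simp_all)
  show "P x \<in> N" by (rule NS_N[OF P_spec(1)])
  have PH: "P x \<in> H" using P_spec(1) Nspace_subset by blast
  show "ip (x - P x) v = 0" if "v \<in> N"
  proof -
    have "rv_inner M T (emb x - P x) (emb v) = 0"
      using P_spec(2)[of x] that by (simp add: orth_compl_def N_def)
    then show ?thesis by (simp add: ip_def emb_simps emb_id[OF PH])
  qed
  have EH: "E x \<in> H" for x by (simp add: E_def rv_mean_in emb_in)
  show "E x \<in> N" unfolding E_def by (rule NS_N[OF rv_mean_in_Nspace[OF emb_in]])
  show "ip (E x) y = ip x (E y)" "ip (E x) (E y) = ip x (E y)"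
    unfolding ip_def emb_id[OF EH] by (simp_all add: E_def rv_inner_mean emb_in)
qed

definition cost :: "('s \<Rightarrow> real \<Rightarrow> real^'m) \<Rightarrow> ereal" where "cost x = expected_cost M f \<xi> (emb x)"

lemma cost_eq: "x \<in> H \<Longrightarrow> cost x = expected_cost M f \<xi> x"
  by (simp add: cost_def emb_id)

lemma cost_convex: "econvex cost"
  unfolding econvex_def cost_def emb_simps using expected_cost_convex[OF emb_in emb_in] by blast

lemma cost_lsc: "elsc cost"
  unfolding elsc_def cost_def
proof (intro allI impI)
  fix X :: "nat \<Rightarrow> 's \<Rightarrow> real \<Rightarrow> real^'m" and l c c'
  assume le: "\<forall>n. expected_cost M f \<xi> (emb (X n)) \<le> ereal (c n)" and c: "c \<longlonglongrightarrow> c'"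
    and lim: "(\<lambda>n. ip (X n - l) (X n - l)) \<longlonglongrightarrow> 0"
  show "expected_cost M f \<xi> (emb l) \<le> ereal c'"
  proof (rule expected_cost_lsc[of "\<lambda>n. emb (X n)" "emb l" c])
    show "(\<lambda>n. rv_inner M T (emb (X n) - emb l) (emb (X n) - emb l)) \<longlonglongrightarrow> 0"
      using lim by (simp add: ip_def emb_simps)
    show "expected_cost M f \<xi> (emb (X n)) \<le> ereal (c n)" for n using le by blast
  qed (rule emb_in c)+
qed

lemma P_H: "P x \<in> H"
  using P_spec(1) NS_H by blast

lemma E_H: "E x \<in> H"
  by (simp add: E_def rv_mean_in emb_in)

lemmas H_closed = subspace_add[OF rvL2_subspace] subspace_diff[OF rvL2_subspace]
  subspace_scale[OF rvL2_subspace] emb_in P_H E_H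

lemma orth_compl_perp: "y \<in> orth_compl M T NS \<longleftrightarrow> y \<in> H \<and> perp y"
proof (cases "y \<in> H")
  case True
  have "(\<forall>v\<in>NS. rv_inner M T y v = 0) \<longleftrightarrow> (\<forall>v\<in>N. ip y v = 0)"
    using NS_N NS_H by (auto simp: N_def ip_def emb_id[OF True]) (metis emb_id)
  then show ?thesis using True by (simp add: orth_compl_def perp_def)
qed (simp add: orth_compl_def)

lemma Proj_N: "x \<in> H \<Longrightarrow> Proj M T NS x = P x"
  by (simp add: P_def emb_id)

lemma rv_mean_E: "x \<in> H \<Longrightarrow> rv_mean M x = E x"
  by (simp add: E_def emb_id)

text \<open>The chosen projection \<open>?Q\<close> and \<open>x - P x\<close> differ by a vector
  \<open>d\<close> of the complement. It is orthogonal to \<open>x - ?Q\<close> by the choice of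
  \<open>?Q\<close> and to \<open>P x\<close>; as \<open>d\<close> is the difference of these two
  vectors, it is null.\<close>

lemma Proj_orth:
  assumes x: "x \<in> H"
  shows "Proj M T (orth_compl M T NS) x \<in> H"
    and "ip (Proj M T (orth_compl M T NS) x) w = ip (x - P x) w"
proof -
  let ?V = "orth_compl M T NS" and ?Q = "Proj M T (orth_compl M T NS) x"
  have VH: "?V \<subseteq> H" by (auto simp: orth_compl_def)
  have ex: "\<exists>p\<in>?V. \<forall>v\<in>?V. rv_inner M T (x - p) v = 0"
  proof (intro bexI ballI)
    show "x - P x \<in> ?V"
      using x perp_diff_P[of x] by (simp add: orth_compl_perp H_closed)
    fix v assume v: "v \<in> ?V"
    then have "rv_inner M T v (P x) = 0" using P_spec(1) by (simp add: orth_compl_def)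
    then show "rv_inner M T (x - (x - P x)) v = 0" by (simp add: rv_inner_commute)
  qed
  note Q = Proj_spec[OF VH x ex]
  show QH: "?Q \<in> H" using Q(1) VH by blast
  define d where "d = ?Q - (x - P x)"
  have dH: "d \<in> H" using QH x by (simp add: d_def H_closed)
  have perpQ: "perp ?Q" using Q(1) by (simp add: orth_compl_perp)
  then have "perp d" using perp_diff_P[of x] by (simp add: d_def perp_def ip_diff_left)
  then have dV: "d \<in> ?V" using dH by (simp add: orth_compl_perp)
  then have "rv_inner M T (x - ?Q) d = 0" using Q(2) unfolding orth_compl_def by blast
  then have "ip (x - ?Q) d = 0" using x QH dH by (simp add: ip_eq H_closed)
  moreover have "ip (P x) d = 0"
    using perpD[OF \<open>perp d\<close> P_in[of x]] by (simp add: ip_commute)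
  moreover have "d = P x - (x - ?Q)" by (simp add: d_def)
  ultimately have "ip d d = 0" by (metis ip_diff_left diff_self)
  then show "ip ?Q w = ip (x - P x) w"
    using ip_null_cong(1)[of ?Q "x - P x" w] by (simp add: d_def)
qed

lemma rv_eq_ip:
  assumes "x \<in> H" "y \<in> H"
  shows "rv_eq M T x y \<longleftrightarrow> (\<forall>w. ip x w = ip y w)"
proof
  assume "rv_eq M T x y"
  then have "ip (x - y) (x - y) = 0" using assms by (simp add: rv_eq_iff ip_eq H_closed)
  then show "\<forall>w. ip x w = ip y w" using ip_null_cong(1) by blast
next
  assume "\<forall>w. ip x w = ip y w"
  then have "ip (x - y) (x - y) = 0" by (intro ip_eqI) blast
  then show "rv_eq M T x y" using assms by (simp add: rv_eq_iff ip_eq H_closed)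
qed

lemma lambda_diff: "(\<lambda>s t. x s t - y s t) = x - y" for x y :: "'a \<Rightarrow> 'b \<Rightarrow> 'c::minus"
  by (simp add: fun_eq_iff)

section \<open>Optimality conditions and the iteration step\<close>

lemma subgrad_of_argmin_H:
  assumes p: "p \<in> H"
    and min: "\<And>y. y \<in> H \<Longrightarrow> expected_cost M f \<xi> p + ereal (q p) \<le> expected_cost M f \<xi> y + ereal (q y)"
    and q: "\<And>y. y \<in> H \<Longrightarrow> q y \<le> q p + ip h (y - p) + K * ip (y - p) (y - p)"
  shows "subgrad cost p (- h)"
proof (rule subgrad_of_argmin[where q = "\<lambda>y. q (emb y)" and K = K, OF cost_convex])
  \<comment> \<open>A competitor of finite cost forces the minimal value below \<infinity>; the
    value -\<infinity> is excluded by properness.\<close>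
  obtain y where y: "y \<in> H" "expected_cost M f \<xi> y < \<infinity>" using expected_cost_proper by blast
  then have "expected_cost M f \<xi> y + ereal (q y) < \<infinity>" by simp
  with min[OF y(1)] have "expected_cost M f \<xi> p + ereal (q p) < \<infinity>" by (rule le_less_trans)
  then have "expected_cost M f \<xi> p \<noteq> \<infinity>" by auto
  then show "\<bar>cost p\<bar> \<noteq> \<infinity>"
    using expected_cost_neq_minf[OF p] unfolding cost_eq[OF p]
    by (cases "expected_cost M f \<xi> p") auto
  fix y
  show "cost p + ereal (q (emb p)) \<le> cost y + ereal (q (emb y))"
    using min[OF emb_in[of y]] by (simp add: cost_def emb_id[OF p])
  have "emb y - p = emb (y - p)" by (simp add: emb_simps emb_id[OF p])
  then show "q (emb y) \<le> q (emb p) + ip h (y - p) + K * ip (y - p) (y - p)"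
    using q[OF emb_in[of y]] by (simp add: emb_id[OF p])
qed

lemma expected_cost_argmin_of_subgrad:
  assumes p: "p \<in> H" and y: "y \<in> H" and sg: "subgrad cost p g" and q: "q p \<le> q y + ip g (y - p)"
  shows "expected_cost M f \<xi> p + ereal (q p) \<le> expected_cost M f \<xi> y + ereal (q y)"
  using argmin_of_subgrad[OF sg, of q y] q by (simp add: cost_eq p y)

text \<open>Rewrites one step entirely in terms of \<open>ip\<close>, \<open>P\<close> and
  \<open>E\<close>. Equality of random variables becomes equality against all test vectors, and the
  projection onto the complement becomes \<open>x' - P x'\<close>.\<close>

lemma iteration_step_iff:
  assumes l: "l \<in> H" and z: "z \<in> H"
  shows "iteration_step M T \<xi> \<delta> f r \<alpha> l z x' l' z' \<longleftrightarrow>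
    x' \<in> H \<and> l' \<in> H \<and> z' \<in> H \<and>
    (\<forall>y\<in>H. expected_cost M f \<xi> x' + ereal (ip l x' + r / 2 * ip (x' - P z) (x' - P z)) \<le>
      expected_cost M f \<xi> y + ereal (ip l y + r / 2 * ip (y - P z) (y - P z))) \<and>
    (\<forall>w. ip l' w = ip (l + r *\<^sub>R (x' - P x')) w) \<and>
    (\<forall>w. ip z' w = ip (z - x' + (1 / (r + \<alpha>)) *\<^sub>R
      (\<alpha> *\<^sub>R E (2 *\<^sub>R x' - z) + r *\<^sub>R P (2 *\<^sub>R x' - z))) w)"
proof (cases "x' \<in> H \<and> l' \<in> H \<and> z' \<in> H")
  case True
  define w where "w = 2 *\<^sub>R x' - z"
  have wH: "w \<in> H" using True z by (simp add: w_def H_closed)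
  have eqs: "(\<lambda>s t. 2 *\<^sub>R x' s t - z s t) = w"
    "(\<lambda>s t. l s t + r *\<^sub>R Proj M T (orth_compl M T NS) x' s t) = l + r *\<^sub>R Proj M T (orth_compl M T NS) x'"
    "(\<lambda>s t. z s t - x' s t + (1 / (r + \<alpha>)) *\<^sub>R (\<alpha> *\<^sub>R rv_mean M w s t + r *\<^sub>R Proj M T NS w s t)) =
      z - x' + (1 / (r + \<alpha>)) *\<^sub>R (\<alpha> *\<^sub>R rv_mean M w + r *\<^sub>R Proj M T NS w)"
    by (simp_all add: w_def fun_eq_iff plus_fun_def scaleR_fun_def)
  have obj: "expected_cost M f \<xi> y + ereal (rv_inner M T l y)
        + ereal (r / 2 * (rv_norm M T (\<lambda>s t. y s t - Proj M T NS z s t))\<^sup>2) =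
      expected_cost M f \<xi> y + ereal (ip l y + r / 2 * ip (y - P z) (y - P z))" if "y \<in> H" for y
    using that l z unfolding lambda_diff[of y "Proj M T NS z"]
    by (simp add: Proj_N rv_norm_sq ip_eq H_closed add.assoc)
  have arg: "is_arg_min (\<lambda>y. expected_cost M f \<xi> y + ereal (rv_inner M T l y)
        + ereal (r / 2 * (rv_norm M T (\<lambda>s t. y s t - Proj M T NS z s t))\<^sup>2)) (\<lambda>y. y \<in> H) x' \<longleftrightarrow>
      (\<forall>y\<in>H. expected_cost M f \<xi> x' + ereal (ip l x' + r / 2 * ip (x' - P z) (x' - P z)) \<le>
        expected_cost M f \<xi> y + ereal (ip l y + r / 2 * ip (y - P z) (y - P z)))"
    unfolding is_arg_min_linorder Ball_def using True obj by (simp only: simp_thms cong: imp_cong)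
  have eq1: "rv_eq M T l' (l + r *\<^sub>R Proj M T (orth_compl M T NS) x') \<longleftrightarrow>
      (\<forall>w. ip l' w = ip (l + r *\<^sub>R (x' - P x')) w)"
    using True l Proj_orth by (simp add: rv_eq_ip H_closed ip_add_left ip_scaleR_left)
  have eq2: "rv_eq M T z' (z - x' + (1 / (r + \<alpha>)) *\<^sub>R (\<alpha> *\<^sub>R rv_mean M w + r *\<^sub>R Proj M T NS w)) \<longleftrightarrow>
      (\<forall>v. ip z' v = ip (z - x' + (1 / (r + \<alpha>)) *\<^sub>R (\<alpha> *\<^sub>R E w + r *\<^sub>R P w)) v)"
    using True z wH unfolding rv_mean_E[OF wH] Proj_N[OF wH] by (intro rv_eq_ip) (simp_all add: H_closed)
  show ?thesis
    unfolding iteration_step_def Let_def w_def[symmetric] eqs arg eq1 eq2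
    using True by (elim conjE) (intro iffI conjI; elim conjE; assumption)
qed (auto simp: iteration_step_def Let_def is_arg_min_def)

text \<open>The smooth part is quadratic, so its expansion at \<open>x'\<close> is exact, with
  gradient \<open>l + r *\<^sub>R (x' - P z)\<close> and second-order coefficient
  \<open>r / 2\<close>.\<close>

lemma iteration_step_subgrad:
  assumes l: "l \<in> H" and z: "z \<in> H" and step: "iteration_step M T \<xi> \<delta> f r \<alpha> l z x' l' z'"
  shows "subgrad cost x' (- (l + r *\<^sub>R (x' - P z)))"
proof (rule subgrad_of_argmin_H[where K = "r / 2" and q = "\<lambda>y. ip l y + r / 2 * ip (y - P z) (y - P z)"])
  note st = step[unfolded iteration_step_iff[OF l z]]
  show "x' \<in> H" using st by blast
  fix y assume "y \<in> H"
  then show "expected_cost M f \<xi> x' + ereal (ip l x' + r / 2 * ip (x' - P z) (x' - P z)) \<le>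
      expected_cost M f \<xi> y + ereal (ip l y + r / 2 * ip (y - P z) (y - P z))"
    using st by blast
  define a d where "a = x' - P z" and "d = y - x'"
  have "y - P z = a + d" "ip l y = ip l x' + ip l d"
    by (simp_all add: a_def d_def ip_diff_right)
  then show "ip l y + r / 2 * ip (y - P z) (y - P z) \<le>
      ip l x' + r / 2 * ip (x' - P z) (x' - P z) + ip (l + r *\<^sub>R (x' - P z)) (y - x')
      + r / 2 * ip (y - x') (y - x')"
    unfolding a_def[symmetric] d_def[symmetric]
    by (simp add: ip_simps ip_commute[of d a] field_simps)
qed

lemma deviation_eq:
  assumes "y \<in> H"
  shows "(rv_norm M T (\<lambda>s t. y s t - rv_mean M y s t))\<^sup>2 = ip y y - ip y (E y)"
  using assms ip_diff_E[of y] unfolding lambda_diff[of y "rv_mean M y"]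
  by (simp add: rv_mean_E rv_norm_sq ip_eq H_closed)

text \<open>Exact second-order expansion of the squared seminorm of \<open>y - E y\<close> about
  \<open>p\<close>. Its remainder lies between 0 and the squared seminorm of \<open>y - p\<close>;
  the upper bound serves to extract subgradients, the lower one to prove optimality.\<close>

lemma deviation_expand:
  "ip y y - ip y (E y) = (ip p p - ip p (E p)) + 2 * ip (p - E p) (y - p)
    + (ip (y - p) (y - p) - ip (y - p) (E (y - p)))"
  using ip_E_commute[of y p]
  by (simp add: ip_simps ip_E_diff E_adj ip_commute[of y p])

lemma primal_dual_subgrad:
  assumes "primal_dual_solution M T \<xi> \<delta> f \<alpha> xs ls" "\<alpha> \<ge> 0"
  shows "xs \<in> N" "perp ls" "subgrad cost xs (- (\<alpha> *\<^sub>R (xs - E xs) + ls))"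
proof -
  have xs: "xs \<in> NS" and ls: "ls \<in> orth_compl M T NS"
    and min: "\<And>y. y \<in> H \<Longrightarrow> expected_cost M f \<xi> xs
        + ereal (\<alpha> / 2 * (rv_norm M T (\<lambda>s t. xs s t - rv_mean M xs s t))\<^sup>2) + ereal (rv_inner M T ls xs)
      \<le> expected_cost M f \<xi> y
        + ereal (\<alpha> / 2 * (rv_norm M T (\<lambda>s t. y s t - rv_mean M y s t))\<^sup>2) + ereal (rv_inner M T ls y)"
    using assms(1) by (simp_all add: primal_dual_solution_def is_arg_min_linorder)
  have lsH: "ls \<in> H" using ls by (simp add: orth_compl_perp)
  show "xs \<in> N" "perp ls" using xs ls by (simp_all add: NS_N orth_compl_perp)
  show "subgrad cost xs (- (\<alpha> *\<^sub>R (xs - E xs) + ls))"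
  proof (rule subgrad_of_argmin_H[where K = "\<alpha> / 2" and q = "\<lambda>y. \<alpha> / 2 * (ip y y - ip y (E y)) + ip ls y"])
    show xsH: "xs \<in> H" using xs by (rule NS_H)
    fix y assume y: "y \<in> H"
    show "expected_cost M f \<xi> xs + ereal (\<alpha> / 2 * (ip xs xs - ip xs (E xs)) + ip ls xs) \<le>
        expected_cost M f \<xi> y + ereal (\<alpha> / 2 * (ip y y - ip y (E y)) + ip ls y)"
      using min[OF y] by (simp add: deviation_eq xsH y ip_eq lsH add.assoc)
    have "\<alpha> / 2 * (ip y y - ip y (E y)) = \<alpha> / 2 * (ip xs xs - ip xs (E xs)) + \<alpha> * ip (xs - E xs) (y - xs)
        + \<alpha> / 2 * (ip (y - xs) (y - xs) - ip (y - xs) (E (y - xs)))"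
      unfolding deviation_expand[of y xs] by (simp add: algebra_simps)
    moreover have "\<alpha> / 2 * (ip (y - xs) (y - xs) - ip (y - xs) (E (y - xs))) \<le> \<alpha> / 2 * ip (y - xs) (y - xs)"
      using assms(2) ip_E_self_nonneg[of "y - xs"] by (intro mult_left_mono) simp_all
    ultimately show "\<alpha> / 2 * (ip y y - ip y (E y)) + ip ls y \<le>
        \<alpha> / 2 * (ip xs xs - ip xs (E xs)) + ip ls xs + ip (\<alpha> *\<^sub>R (xs - E xs) + ls) (y - xs)
        + \<alpha> / 2 * ip (y - xs) (y - xs)"
      unfolding ip_add_left ip_scaleR_left ip_diff_right[of ls y xs] by linarith
  qed
qed

text \<open>Between two adapted processes the multiplier \<open>n\<close> contributes nothing and
  the deviation term lies above its linearisation. For other competitors the objective is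
  \<infinity>, since the expected cost is never -\<infinity>.\<close>

lemma optimal_of_subgrad:
  assumes x: "x \<in> NS" and n: "perp n" and \<alpha>: "\<alpha> \<ge> 0"
    and sg: "subgrad cost x (- (\<alpha> *\<^sub>R (x - E x) + n))"
  shows "optimal_solution M T \<xi> \<delta> f \<alpha> x"
  unfolding optimal_solution_def is_arg_min_linorder
proof (intro conjI allI impI)
  show xH: "x \<in> H" using x by (rule NS_H)
  fix y assume y: "y \<in> H"
  show "expected_cost M f \<xi> x + ereal (\<alpha> / 2 * (rv_norm M T (\<lambda>s t. x s t - rv_mean M x s t))\<^sup>2)
      + indicator_fun NS x
    \<le> expected_cost M f \<xi> y + ereal (\<alpha> / 2 * (rv_norm M T (\<lambda>s t. y s t - rv_mean M y s t))\<^sup>2)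
      + indicator_fun NS y"
  proof (cases "y \<in> NS")
    case True
    have "ip n (y - x) = 0"
      by (rule perpD[OF n subspace_diff[OF N_subspace NS_N[OF True] NS_N[OF x]]])
    moreover have "\<alpha> / 2 * (ip y y - ip y (E y)) = \<alpha> / 2 * (ip x x - ip x (E x)) + \<alpha> * ip (x - E x) (y - x)
        + \<alpha> / 2 * (ip (y - x) (y - x) - ip (y - x) (E (y - x)))"
      unfolding deviation_expand[of y x] by (simp add: algebra_simps)
    moreover have "0 \<le> \<alpha> / 2 * (ip (y - x) (y - x) - ip (y - x) (E (y - x)))"
      using \<alpha> ip_E_le by simp
    ultimately have "\<alpha> / 2 * (ip x x - ip x (E x)) \<le>
        \<alpha> / 2 * (ip y y - ip y (E y)) + ip (- (\<alpha> *\<^sub>R (x - E x) + n)) (y - x)"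
      unfolding ip_minus_left ip_add_left ip_scaleR_left by linarith
    from expected_cost_argmin_of_subgrad[where q = "\<lambda>y. \<alpha> / 2 * (ip y y - ip y (E y))", OF xH y sg this]
    show ?thesis by (simp add: deviation_eq xH y indicator_fun_def x True)
  next
    case False
    then show ?thesis using expected_cost_neq_minf[OF y] by (simp add: indicator_fun_def)
  qed
qed

section \<open>Convergence in the scenario problem\<close>

lemma weakly_converges_emb:
  assumes u: "\<And>k. u k \<in> H" and lim: "weak_lim u l sequentially"
  shows "weakly_converges M T u (emb l)"
  unfolding weakly_converges_def
proof (intro conjI emb_in ballI)
  fix y assume "y \<in> H"
  then show "(\<lambda>k. rv_inner M T (u k) y) \<longlonglongrightarrow> rv_inner M T (emb l) y"
    using weak_limD[OF lim, of y] by (simp add: ip_def emb_id u)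
qed

theorem iteration_converges:
  fixes x lam z :: "nat \<Rightarrow> 's \<Rightarrow> real \<Rightarrow> real^'m"
  assumes r: "r > 0" and \<alpha>: "\<alpha> \<ge> 0" and sol: "primal_dual_solution M T \<xi> \<delta> f \<alpha> xs ls"
    and lam0: "lam 0 \<in> orth_compl M T NS" and z0: "z 0 \<in> H"
    and step: "\<And>k. iteration_step M T \<xi> \<delta> f r \<alpha> (lam k) (z k) (x (Suc k)) (lam (Suc k)) (z (Suc k))"
  shows "\<exists>xb lb zb. weakly_converges M T x xb \<and> weakly_converges M T lam lb \<and> weakly_converges M T z zb \<and>
    iteration_fixed_point M T \<xi> \<delta> f r \<alpha> xb lb zb \<and> optimal_solution M T \<xi> \<delta> f \<alpha> xb"
proof -
  have lam0': "lam 0 \<in> H" "perp (lam 0)" using lam0 by (simp_all add: orth_compl_perp)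
  have lz: "lam k \<in> H" "z k \<in> H" for k
    using lam0'(1) z0 step[of "k - 1"] by (cases k; simp add: iteration_step_def Let_def)+
  note st = step[unfolded iteration_step_iff[OF lz]]
  have xH: "x (Suc k) \<in> H"
    and lamS: "ip (lam (Suc k)) w = ip (lam k + r *\<^sub>R (x (Suc k) - P (x (Suc k)))) w"
    and zS: "ip (z (Suc k)) w = ip (z k - x (Suc k) + (1 / (r + \<alpha>)) *\<^sub>R
      (\<alpha> *\<^sub>R E (2 *\<^sub>R x (Suc k) - z k) + r *\<^sub>R P (2 *\<^sub>R x (Suc k) - z k))) w" for k w
    using st[of k] by blast+
  obtain xb lb zb n where wx: "weak_lim (\<lambda>k. x (Suc k)) xb sequentially"
    and wl: "weak_lim lam lb sequentially" and wz: "weak_lim z zb sequentially"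
    and xbN: "xb \<in> N" and Fb: "subgrad cost xb (- (lb + r *\<^sub>R (xb - P zb)))"
    and zfix: "\<And>w. ip zb w = ip (zb - xb + (1 / (r + \<alpha>)) *\<^sub>R
      (\<alpha> *\<^sub>R E (2 *\<^sub>R xb - zb) + r *\<^sub>R P (2 *\<^sub>R xb - zb))) w"
    and n: "perp n" and Fn: "subgrad cost xb (- (\<alpha> *\<^sub>R (xb - E xb) + n))"
    using decoupling_converges[where x = "\<lambda>k. x (Suc k)" and lam = lam and z = z and F = cost,
        OF r \<alpha> cost_convex cost_lsc primal_dual_subgrad[OF sol \<alpha>] lam0'(2)
          iteration_step_subgrad[OF lz step] lamS zS] by metis
  \<comment> \<open>The abstract limits may lie outside \<open>H\<close>. Their images under
    \<open>emb\<close> are representatives in \<open>H\<close> at distance zero.\<close>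
  define X L Z where "X = emb xb" and "L = emb lb" and "Z = emb zb"
  have XLZ: "X \<in> H" "L \<in> H" "Z \<in> H" by (simp_all add: X_def L_def Z_def emb_in)
  have XNS: "X \<in> NS" using xbN by (simp add: X_def N_def)
  have sg: "subgrad cost X g'" if "subgrad cost xb g" "\<And>w. ip g w = ip g' w" for g g'
    by (rule subgrad_cong[OF cost_lsc that(1)])
      (auto simp: X_def intro!: ip_eqI that(2))
  have FX: "subgrad cost X (- (L + r *\<^sub>R (X - P Z)))"
    by (rule sg[OF Fb]) (simp add: X_def L_def Z_def ip_simps op_simps)
  have FX': "subgrad cost X (- (\<alpha> *\<^sub>R (X - E X) + n))"
    by (rule sg[OF Fn]) (simp add: X_def ip_simps op_simps)
  have "weakly_converges M T (\<lambda>k. x (Suc k)) X"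
    using weakly_converges_emb[OF xH wx] by (simp add: X_def)
  \<comment> \<open>The iteration produces \<open>x\<close> only from index 1 on, so the limit is
    transferred from the shifted sequence.\<close>
  then have "weakly_converges M T x X"
    unfolding weakly_converges_def by (auto dest!: bspec intro: LIMSEQ_imp_Suc)
  moreover have "weakly_converges M T lam L" "weakly_converges M T z Z"
    using weakly_converges_emb[OF lz(1) wl] weakly_converges_emb[OF lz(2) wz] by (simp_all add: L_def Z_def)
  moreover have "iteration_fixed_point M T \<xi> \<delta> f r \<alpha> X L Z"
    unfolding iteration_fixed_point_def iteration_step_iff[OF XLZ(2,3)]
  proof (intro conjI XLZ ballI allI)
    fix y assume y: "y \<in> H"
    show "expected_cost M f \<xi> X + ereal (ip L X + r / 2 * ip (X - P Z) (X - P Z)) \<le>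
        expected_cost M f \<xi> y + ereal (ip L y + r / 2 * ip (y - P Z) (y - P Z))"
    proof (rule expected_cost_argmin_of_subgrad[where q = "\<lambda>y. ip L y + r / 2 * ip (y - P Z) (y - P Z)", OF XLZ(1) y FX])
      define a d where "a = X - P Z" and "d = y - X"
      have eq: "y - P Z = a + d" "ip L y = ip L X + ip L d"
        by (simp_all add: a_def d_def ip_diff_right)
      have "0 \<le> r / 2 * ip d d" using r by (simp add: ip_nonneg)
      then show "ip L X + r / 2 * ip (X - P Z) (X - P Z) \<le>
          ip L y + r / 2 * ip (y - P Z) (y - P Z) + ip (- (L + r *\<^sub>R (X - P Z))) (y - X)"
        unfolding eq a_def[symmetric] d_def[symmetric]
        by (simp add: ip_simps ip_commute[of d a] field_simps)
    qed
  next
    fix w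
    show "ip L w = ip (L + r *\<^sub>R (X - P X)) w"
      using ip_N_P[OF NS_N[OF XNS], of w] by (simp add: ip_simps op_simps)
    show "ip Z w = ip (Z - X + (1 / (r + \<alpha>)) *\<^sub>R
        (\<alpha> *\<^sub>R E (2 *\<^sub>R X - Z) + r *\<^sub>R P (2 *\<^sub>R X - Z))) w"
      using zfix[of w] by (simp add: X_def Z_def ip_simps op_simps)
  qed
  moreover have "optimal_solution M T \<xi> \<delta> f \<alpha> X"
    by (rule optimal_of_subgrad[OF XNS n \<alpha> FX'])
  ultimately show ?thesis by blast
qed

end

theorem theorem1:
  fixes M :: "'s measure" and T \<delta> r \<alpha> :: real
    and \<xi> :: "'s \<Rightarrow> real \<Rightarrow> real^'d"
    and f :: "(real \<Rightarrow> real^'m) \<Rightarrow> (real \<Rightarrow> real^'d) \<Rightarrow> ereal"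
    and x lam z :: "nat \<Rightarrow> 's \<Rightarrow> real \<Rightarrow> real^'m"
  assumes "finite_prob_space M" and "T > 0" and "\<delta> \<ge> 0" and "r > 0" and "\<alpha> \<ge> 0"
    and "\<xi> \<in> rvL2 M T"
    and "\<And>s. s \<in> space M \<Longrightarrow> L2_convex T (\<lambda>u. f u (\<xi> s))"
    and "\<And>s. s \<in> space M \<Longrightarrow> L2_proper T (\<lambda>u. f u (\<xi> s))"
    and "\<And>s. s \<in> space M \<Longrightarrow> L2_lsc T (\<lambda>u. f u (\<xi> s))"
    and "\<exists>xs ls. primal_dual_solution M T \<xi> \<delta> f \<alpha> xs ls"
    and "lam 0 \<in> orth_compl M T (Nspace M T \<xi> \<delta>)"
    and "z 0 \<in> rvL2 M T"
    and "\<And>k. iteration_step M T \<xi> \<delta> f r \<alpha> (lam k) (z k) (x (Suc k)) (lam (Suc k)) (z (Suc k))"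
  shows "\<exists>xb lb zb.
           weakly_converges M T x xb \<and> weakly_converges M T lam lb \<and> weakly_converges M T z zb \<and>
           iteration_fixed_point M T \<xi> \<delta> f r \<alpha> xb lb zb \<and>
           optimal_solution M T \<xi> \<delta> f \<alpha> xb"
proof -
  interpret scenario_problem M T \<delta> \<xi> f
    by standard (use assms in auto)
  obtain xs ls where "primal_dual_solution M T \<xi> \<delta> f \<alpha> xs ls" using assms(10) by blast
  then show ?thesis by (rule iteration_converges[OF assms(4,5) _ assms(11-13)])
qed

end
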